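(* Let $\phi:S^n\to\mathbb{R}$ be bounded and continuous. Then $$\lim_{N\to\infty}\frac1N\log\sum_{\alpha\in\Sigma_N}\exp\left[\sum_{i=1}^N\phi(X_{\alpha,i})\right]=J^*(\phi)+\log2\quad\mathbb{P}\text{-almost surely},$$ where $$J^*(\phi)=\sup\left\{\int\phi\,d\nu-H(\nu\mid\mu):\nu\in\bigcap_{j=1}^n\mathcal{R}_j\right\}.$$
   Context: Let $S$ be a Polish space with its Borel $\sigma$-field, let $n\in\mathbb{N}$ be fixed, and let $\mu_1,\dots,\mu_n$ be Borel probability measures on $S$; put $\mu=\mu_1\otimes\cdots\otimes\mu_n$. For a Polish space $T$, $\mathcal{M}_1^+(T)$ denotes the set of Borel probability measures on $T$ with the weak topology. Let $\gamma_1,\dots,\gamma_n>0$ with $\sum_{k=1}^n\gamma_k=1$, and $\Gamma_j=\sum_{k=1}^j\gamma_k$. It is assumed that all $\gamma_kN$ are integers ($N$ runs over the positive integers with this property, assumed to be infinitely many, and limits $N\to\infty$ are along such $N$). Let $\Sigma_N=\prod_{k=1}^n\{1,\dots,2^{\gamma_kN}\}$, so $|\Sigma_N|=2^N$; write $\alpha=(\alpha_1,\dots,\alpha_n)\in\Sigma_N$. On a probability space $(\Omega,\mathcal{F},\mathbb{P})$, for each $N$, let $X^j_{\alpha_1,\dots,\alpha_j,i}$ ($1\le j\le n$, $1\le\alpha_k\le2^{\gamma_kN}$, $1\le i\le N$) be independent $S$-valued random variables, $X^j_{\alpha_1,\dots,\alpha_j,i}$ having distribution $\mu_j$. Put $$X_{\alpha,i}=\left(X^1_{\alpha_1,i},X^2_{\alpha_1,\alpha_2,i},\dots,X^n_{\alpha_1,\dots,\alpha_n,i}\right)\in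 S^n.$$ $H(\nu\mid\mu)$ is the relative entropy: $\int\log\frac{d\nu}{d\mu}\,d\nu$ if $\nu\ll\mu$, and $\infty$ otherwise. For $\nu\in\mathcal{M}_1^+(S^n)$, $\nu^{(j)}$ denotes its marginal on the first $j$ coordinates (so $\mu^{(j)}=\mu_1\otimes\cdots\otimes\mu_j$), and $$\mathcal{R}_j=\left\{\nu\in\mathcal{M}_1^+(S^n): H(\nu^{(j)}\mid\mu^{(j)})\le\Gamma_j\log2\right\}.$$ *)

theory Defs
  imports "HOL-Probability.Probability"
begin

text \<open>
  A point of \<open>S\<^sup>n\<close> is an extensional function on \<open>{1..n}\<close>. Its topology is the product topology
  and its Borel \<open>\<sigma>\<close>-field is the product \<open>\<sigma>\<close>-field; the latter is the Borel \<open>\<sigma>\<close>-field of the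
  former because \<open>S\<close> is second countable.
\<close>

definition product_borel :: "nat \<Rightarrow> (nat \<Rightarrow> 's::polish_space) measure" where
  "product_borel n = PiM {1..n} (\<lambda>_. borel)"

text \<open>
  \<open>KL_divergence\<close> is a Bochner integral, hence \<open>0\<close> when the log-density is not integrable.
  For probability measures the negative part of \<open>ln (d\<nu>/d\<mu>)\<close> is always \<open>\<nu>\<close>-integrable
  (as \<open>t * ln t \<ge> - exp (-1)\<close>), so non-integrability means that the integral is \<open>\<infinity>\<close>.
\<close>

definition relative_entropy :: "'a measure \<Rightarrow> 'a measure \<Rightarrow> ereal" where
  "relative_entropy \<nu> \<mu> =
    (if absolutely_continuous \<mu> \<nu> \<and> integrable \<nu> (entropy_density (exp 1) \<mu> \<nu>)
     then ereal (KL_divergence (exp 1) \<mu> \<nu>) else \<infinity>)"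

definition marginal :: "nat \<Rightarrow> (nat \<Rightarrow> 's::polish_space) measure \<Rightarrow> (nat \<Rightarrow> 's) measure" where
  "marginal j \<nu> = distr \<nu> (product_borel j) (\<lambda>x. restrict x {1..j})"

definition entropy_ball ::
  "nat \<Rightarrow> (nat \<Rightarrow> real) \<Rightarrow> (nat \<Rightarrow> 's::polish_space measure) \<Rightarrow> nat \<Rightarrow> (nat \<Rightarrow> 's) measure set" where
  "entropy_ball n \<gamma> \<mu> j =
    {\<nu> \<in> space (prob_algebra (product_borel n)).
       relative_entropy (marginal j \<nu>) (marginal j (PiM {1..n} \<mu>)) \<le> ereal ((\<Sum>k=1..j. \<gamma> k) * ln 2)}"

definition J_star ::
  "nat \<Rightarrow> (nat \<Rightarrow> real) \<Rightarrow> (nat \<Rightarrow> 's::polish_space measure) \<Rightarrow> ((nat \<Rightarrow> 's) \<Rightarrow> real) \<Rightarrow> ereal" where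
  "J_star n \<gamma> \<mu> \<phi> =
    (SUP \<nu> \<in> (\<Inter>j\<in>{1..n}. entropy_ball n \<gamma> \<mu> j).
       ereal (\<integral>x. \<phi> x \<partial>\<nu>) - relative_entropy \<nu> (PiM {1..n} \<mu>))"

definition admissible_sizes :: "nat \<Rightarrow> (nat \<Rightarrow> real) \<Rightarrow> nat set" where
  "admissible_sizes n \<gamma> = {N. N > 0 \<and> (\<forall>k\<in>{1..n}. \<gamma> k * real N \<in> \<int>)}"

text \<open>
  The index tuples \<open>(\<alpha>\<^sub>1, \<dots>, \<alpha>\<^sub>j)\<close> with \<open>1 \<le> \<alpha>\<^sub>k \<le> 2\<^bsup>\<gamma>\<^sub>k N\<^esup>\<close>; in particular \<open>\<Sigma>\<^sub>N\<close> is \<open>configs \<gamma> N n\<close>.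
  The floor is exact for the admissible sizes.
\<close>

definition configs :: "(nat \<Rightarrow> real) \<Rightarrow> nat \<Rightarrow> nat \<Rightarrow> (nat \<Rightarrow> nat) set" where
  "configs \<gamma> N j = PiE {1..j} (\<lambda>k. {1..2 ^ nat \<lfloor>\<gamma> k * real N\<rfloor>})"

definition env_index :: "nat \<Rightarrow> (nat \<Rightarrow> real) \<Rightarrow> nat \<Rightarrow> (nat \<times> (nat \<Rightarrow> nat) \<times> nat) set" where
  "env_index n \<gamma> N = (SIGMA j:{1..n}. configs \<gamma> N j \<times> {1..N})"

text \<open>
  \<open>X (j, \<beta>, i)\<close> is the variable \<open>X\<^sup>j\<close> with lower indices \<open>\<beta>\<^sub>1, \<dots>, \<beta>\<^sub>j, i\<close>.
\<close>

definition config_vec ::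
  "nat \<Rightarrow> (nat \<times> (nat \<Rightarrow> nat) \<times> nat \<Rightarrow> 'w \<Rightarrow> 's) \<Rightarrow> (nat \<Rightarrow> nat) \<Rightarrow> nat \<Rightarrow> 'w \<Rightarrow> nat \<Rightarrow> 's" where
  "config_vec n X \<alpha> i \<omega> = (\<lambda>j\<in>{1..n}. X (j, restrict \<alpha> {1..j}, i) \<omega>)"

end

(*
  By convex duality for the problem defining J_star, there are multipliers l_k \<ge> 0 and a probability
  measure nu whose marginal densities f_k, with respect to mu_1 x ... x mu_k, satisfy
    phi = c + ln f_n + sum_k l_k ln f_k,   H(nu^(k) | mu^(k)) \<le> Gamma_k ln 2  with equality if l_k > 0.
  The measure nu is obtained by successive exponential tilts with parameters 1 / (1 + l_j + ... + l_n), as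
  in a Parisi formula, at a minimizer l of the dual function.
  Write F_k(alpha) = prod_i f_k(X_(alpha,i)).  Each F_k(alpha) has mean one, so by Markov's inequality
  all 2^(Gamma_k N) of them are eventually at most exp(N (Gamma_k ln 2 + epsilon)) and
  sum_alpha F_n(alpha) is at most exp(N (ln 2 + epsilon)); inserting this into the identity for phi is
  the upper bound.  For the lower bound, mix nu with mu to make the entropy constraints strict.  Then
  2^(-N) sum_alpha F_n(alpha), restricted to those alpha with F_k(alpha) at most about
  exp(N H(nu^(k) | mu^(k))) for all k, has mean and second moment exponentially close to one.
*)
theory Submission
  imports Defs
begin

text \<open>The tilt parameters are forced by the identity for phi: the conditional log density of
  coordinate j occurs in ln f_n and in every ln f_k with k >= j, so its total coefficient is u_j = 1
  + l_j + ... + l_n. Normalizing it given the earlier coordinates produces u_j times the log-mean of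
  an exponential with parameter 1 / u_j, from the last coordinate down. Since u_j >= 1 and phi is
  bounded, all ln f_k are bounded uniformly in l. Hence the entropies are finite and continuous in
  l, and the optimal measure comes from minimizing a convex function of n real variables over a box,
  instead of from a compactness argument for measures. The obstacle to the second moment method are
  pairs of configurations that agree up to level k: they contribute E[F_k^2] / 2^(Gamma_k N), which
  may grow exponentially. Truncating F_k near exp(N H_k), where H_k is the entropy at level k, loses
  almost no mass under the law tilted by F_n and lowers this to about exp(N (H_k - Gamma_k ln 2));
  this is why the constraints have to be strict there.\<close>

declare One_nat_def [simp del]

section \<open>Functions of the first coordinates, and resampling of a single coordinate\<close>

text \<open>Being a function of the first j coordinates is a property of functions on all sequences.
  So the same \<open>f k\<close> can serve as a density on S^n and on S^k, without conversions
  between the spaces.\<close>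

definition depends_upto :: "nat \<Rightarrow> ((nat \<Rightarrow> 's) \<Rightarrow> 'b) \<Rightarrow> bool" where
  "depends_upto j f \<longleftrightarrow> (\<forall>x y. (\<forall>i\<in>{1..j}. x i = y i) \<longrightarrow> f x = f y)"

lemma depends_uptoD: "depends_upto j f \<Longrightarrow> (\<And>i. i \<in> {1..j} \<Longrightarrow> x i = y i) \<Longrightarrow> f x = f y"
  unfolding depends_upto_def by blast

lemma depends_upto_upd: "depends_upto j f \<Longrightarrow> j < k \<Longrightarrow> f (x(k := y)) = f x"
  by (erule depends_uptoD) auto

lemma depends_upto_mono: "depends_upto j f \<Longrightarrow> j \<le> k \<Longrightarrow> depends_upto k f"
  unfolding depends_upto_def by (meson atLeastAtMost_iff order_trans)

lemma depends_upto_comp: "depends_upto j f \<Longrightarrow> depends_upto j (\<lambda>x. h (f x))"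
  unfolding depends_upto_def by metis

text \<open>Fubini splits off coordinate p; in \<open>x(p := z, p := y)\<close> the value z is
  overwritten, and its law has mass one. Resampling averages over one coordinate without leaving the
  product space, so it can be iterated over coordinates with the index set fixed.\<close>

lemma (in product_prob_space) nn_integral_resample:
  assumes "finite I" "p \<in> I" and f: "f \<in> borel_measurable (PiM I M)"
  shows "(\<integral>\<^sup>+x. f x \<partial>PiM I M) = (\<integral>\<^sup>+x. \<integral>\<^sup>+y. f (x(p := y)) \<partial>M p \<partial>PiM I M)"
proof -
  define J where "J = I - {p}"
  have I: "I = insert p J" "p \<notin> J" "finite J" using assms by (auto simp: J_def)
  note [measurable] = f[unfolded I]
  have *: "(\<integral>\<^sup>+x. f x \<partial>PiM I M) = (\<integral>\<^sup>+x. \<integral>\<^sup>+y. f (x(p := y)) \<partial>M p \<partial>PiM J M)"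
    unfolding I by (rule product_nn_integral_insert) (use I in auto)
  have m: "(\<lambda>x. \<integral>\<^sup>+y. f (x(p := y)) \<partial>M p) \<in> borel_measurable (PiM (insert p J) M)"
  proof -
    have "(\<lambda>(x, y). x(p := y)) \<in> PiM (insert p J) M \<Otimes>\<^sub>M M p \<rightarrow>\<^sub>M PiM (insert p J) M"
      using measurable_add_dim[of p "insert p J" M] by simp
    from measurable_compose[OF this f[unfolded I]]
    show ?thesis by (intro M.borel_measurable_nn_integral) (simp add: case_prod_unfold)
  qed
  have "(\<integral>\<^sup>+x. \<integral>\<^sup>+y. f (x(p := y)) \<partial>M p \<partial>PiM I M)
      = (\<integral>\<^sup>+x. \<integral>\<^sup>+z. \<integral>\<^sup>+y. f ((x(p := z))(p := y)) \<partial>M p \<partial>M p \<partial>PiM J M)"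
    unfolding I by (rule product_nn_integral_insert) (use I m in auto)
  also have "\<dots> = (\<integral>\<^sup>+x. \<integral>\<^sup>+y. f (x(p := y)) \<partial>M p \<partial>PiM J M)"
    by (simp add: M.emeasure_space_1)
  finally show ?thesis using * by simp
qed

section \<open>The product measure and the densities of its marginals\<close>

locale product_law =
  fixes n :: nat and \<mu> :: "nat \<Rightarrow> 's::polish_space measure"
  assumes prob_factor: "prob_space (\<mu> j)"
    and sets_factor [measurable_cong]: "sets (\<mu> j) = sets borel"
begin

abbreviation M :: "(nat \<Rightarrow> 's) measure" where "M \<equiv> PiM {1..n} \<mu>"

sublocale L: product_prob_space \<mu> "{1..n}"
  unfolding product_prob_space_def product_sigma_finite_def product_prob_space_axioms_def
  using prob_factor prob_space_imp_sigma_finite by blast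

lemma space_factor: "space (\<mu> j) = UNIV"
  using sets_eq_imp_space_eq[OF sets_factor] by simp

lemma space_M: "space M = PiE {1..n} (\<lambda>_. UNIV)"
  by (simp add: space_PiM space_factor)

lemma sets_M: "sets M = sets (product_borel n)"
  unfolding product_borel_def by (rule sets_PiM_cong) (auto simp: sets_factor)

lemma upd_space_M: "x \<in> space M \<Longrightarrow> j \<in> {1..n} \<Longrightarrow> x(j := y) \<in> space M"
  unfolding space_M by (auto simp: PiE_iff extensional_def)

lemma measurable_upd_M [measurable]:
  "j \<in> {1..n} \<Longrightarrow> (\<lambda>(x, y). x(j := y)) \<in> M \<Otimes>\<^sub>M \<mu> j \<rightarrow>\<^sub>M M"
  using measurable_add_dim[of j "{1..n}" \<mu>] by (simp add: insert_absorb)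

lemma measurable_upd_slice:
  "j \<in> {1..n} \<Longrightarrow> x \<in> space M \<Longrightarrow> (\<lambda>y. x(j := y)) \<in> \<mu> j \<rightarrow>\<^sub>M M"
  using measurable_Pair2[OF measurable_upd_M, of j x] by simp

lemma measurable_upd_integral:
  assumes "j \<in> {1..n}" "f \<in> borel_measurable M"
  shows "(\<lambda>x. \<integral>y. (f (x(j := y)) :: real) \<partial>\<mu> j) \<in> borel_measurable M"
  using measurable_compose[OF measurable_upd_M[OF assms(1)] assms(2)]
  by (intro L.M.borel_measurable_lebesgue_integral) (simp add: case_prod_unfold)

lemma measurable_upd_nn_integral:
  assumes "j \<in> {1..n}" "f \<in> borel_measurable M"
  shows "(\<lambda>x. \<integral>\<^sup>+y. f (x(j := y)) \<partial>\<mu> j) \<in> borel_measurable M"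
  using measurable_compose[OF measurable_upd_M[OF assms(1)] assms(2)]
  by (intro L.M.borel_measurable_nn_integral) (simp add: case_prod_unfold)

text \<open>Coordinates are integrated out from the last to the first, so inductions over levels
  start at n and descend.\<close>

lemma down_induct [consumes 1, case_names top step]:
  assumes "j \<le> n" "P n" "\<And>j. j \<in> {1..n} \<Longrightarrow> P j \<Longrightarrow> P (j - 1)"
  shows "P j"
proof -
  have "P (n - d)" if "d \<le> n" for d
    using that
  proof (induction d)
    case (Suc d)
    then have "P (n - d - 1)" by (intro assms(3)) auto
    then show ?case by (simp add: One_nat_def)
  qed (simp add: assms)
  from this[of "n - j"] show ?thesis using assms(1) by simp
qed

text \<open>
  A density flow is the family of densities, with respect to \<open>\<mu>\<^sub>1 \<otimes> \<dots> \<otimes> \<mu>\<^sub>k\<close>, of the marginals of one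
  probability measure.
\<close>

definition density_flow :: "(nat \<Rightarrow> (nat \<Rightarrow> 's) \<Rightarrow> real) \<Rightarrow> bool" where
  "density_flow f \<longleftrightarrow>
    (\<forall>k\<le>n. f k \<in> borel_measurable M \<and> depends_upto k (f k)) \<and> (\<forall>x. f 0 x = 1) \<and>
    (\<exists>K. \<forall>k\<le>n. \<forall>x\<in>space M. 0 < f k x \<and> \<bar>ln (f k x)\<bar> \<le> K) \<and>
    (\<forall>k\<in>{1..n}. \<forall>x\<in>space M. (\<integral>y. f k (x(k := y)) \<partial>\<mu> k) = f (k - 1) x)"

lemma density_flowD:
  assumes "density_flow f"
  shows density_flow_measurable: "k \<le> n \<Longrightarrow> f k \<in> borel_measurable M"
    and density_flow_depends: "k \<le> n \<Longrightarrow> depends_upto k (f k)"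
    and density_flow_0: "f 0 x = 1"
    and density_flow_pos: "k \<le> n \<Longrightarrow> x \<in> space M \<Longrightarrow> 0 < f k x"
    and density_flow_step: "k \<in> {1..n} \<Longrightarrow> x \<in> space M \<Longrightarrow> (\<integral>y. f k (x(k := y)) \<partial>\<mu> k) = f (k - 1) x"
  using assms unfolding density_flow_def by blast+

lemma density_flow_bounds:
  assumes "density_flow f"
  obtains K where "K > 0" "\<And>k x. k \<le> n \<Longrightarrow> x \<in> space M \<Longrightarrow> \<bar>ln (f k x)\<bar> \<le> K"
    "\<And>k x. k \<le> n \<Longrightarrow> x \<in> space M \<Longrightarrow> f k x \<le> exp K"
proof -
  obtain K where K: "\<And>k x. k \<le> n \<Longrightarrow> x \<in> space M \<Longrightarrow> 0 < f k x \<and> \<bar>ln (f k x)\<bar> \<le> K"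
    using assms unfolding density_flow_def by blast
  show ?thesis
  proof (rule that[of "max K 1"])
    fix k x assume *: "k \<le> n" "x \<in> space M"
    from K[OF *] show "\<bar>ln (f k x)\<bar> \<le> max K 1" by auto
    from K[OF *] have "f k x \<le> exp K" by (metis abs_le_D1 exp_le_cancel_iff exp_ln)
    also have "\<dots> \<le> exp (max K 1)" by simp
    finally show "f k x \<le> exp (max K 1)" .
  qed simp
qed

lemma integrable_bounded:
  assumes "g \<in> borel_measurable M" "\<And>x. x \<in> space M \<Longrightarrow> \<bar>g x :: real\<bar> \<le> K"
  shows "integrable M g"
  by (rule L.integrable_const_bound[of _ K]) (use assms in auto)

lemma integrable_slice:
  assumes "j \<in> {1..n}" "x \<in> space M" "g \<in> borel_measurable M" "\<And>x. x \<in> space M \<Longrightarrow> \<bar>g x :: real\<bar> \<le> K"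
  shows "integrable (\<mu> j) (\<lambda>y. g (x(j := y)))"
proof (rule L.M.integrable_const_bound[of _ K])
  show "AE y in \<mu> j. norm (g (x(j := y))) \<le> K"
    using assms(4) upd_space_M[OF assms(2,1)] by auto
  show "(\<lambda>y. g (x(j := y))) \<in> borel_measurable (\<mu> j)"
    using measurable_compose[OF measurable_upd_slice[OF assms(1,2)] assms(3)] .
qed

lemma density_flow_step_nn:
  assumes f: "density_flow f" and k: "k \<in> {1..n}" and x: "x \<in> space M"
  shows "(\<integral>\<^sup>+y. ennreal (f k (x(k := y))) \<partial>\<mu> k) = ennreal (f (k - 1) x)"
proof -
  obtain K where K: "\<And>k x. k \<le> n \<Longrightarrow> x \<in> space M \<Longrightarrow> f k x \<le> exp K"
    using density_flow_bounds[OF f] by metis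
  have "integrable (\<mu> k) (\<lambda>y. f k (x(k := y)))"
    by (rule integrable_slice[of _ _ _ "exp K"])
       (use k x K f in \<open>auto simp: density_flow_measurable density_flow_pos less_imp_le\<close>)
  then show ?thesis
    using density_flow_step[OF f k x] upd_space_M[OF x k] density_flow_pos[OF f] k
    by (subst nn_integral_eq_integral) (auto intro!: AE_I2 less_imp_le)
qed

text \<open>The coordinates n, ..., k + 1 are averaged out one at a time: \<open>G\<close> is
  constant in the resampled coordinate j, and averaging \<open>f j\<close> over it gives
  \<open>f (j - 1)\<close>. In other words, \<open>f k\<close> is the density of the first k
  coordinates under the measure with density \<open>f n\<close>.\<close>

lemma density_flow_tower:
  assumes f: "density_flow f" and k: "k \<le> n"
    and G: "G \<in> borel_measurable M" "depends_upto k G"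
  shows "(\<integral>\<^sup>+x. G x * ennreal (f n x) \<partial>M) = (\<integral>\<^sup>+x. G x * ennreal (f k x) \<partial>M)"
proof -
  have "k \<le> j \<longrightarrow> (\<integral>\<^sup>+x. G x * ennreal (f n x) \<partial>M) = (\<integral>\<^sup>+x. G x * ennreal (f j x) \<partial>M)" if "j \<le> n" for j
    using that
  proof (induction j rule: down_induct)
    case (step j)
    show ?case
    proof
      assume kj: "k \<le> j - 1"
      note [measurable] = G(1) density_flow_measurable[OF f, of j]
      have "(\<integral>\<^sup>+x. G x * ennreal (f j x) \<partial>M)
          = (\<integral>\<^sup>+x. \<integral>\<^sup>+y. G (x(j := y)) * ennreal (f j (x(j := y))) \<partial>\<mu> j \<partial>M)"
        using step(1) by (subst L.nn_integral_resample[of j]) auto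
      also have "\<dots> = (\<integral>\<^sup>+x. G x * ennreal (f (j - 1) x) \<partial>M)"
      proof (rule nn_integral_cong)
        fix x assume x: "x \<in> space M"
        have [measurable]: "(\<lambda>y. f j (x(j := y))) \<in> borel_measurable (\<mu> j)"
          by (rule measurable_compose[OF measurable_upd_slice]) (use step x in auto)
        have "(\<integral>\<^sup>+y. G (x(j := y)) * ennreal (f j (x(j := y))) \<partial>\<mu> j)
            = (\<integral>\<^sup>+y. G x * ennreal (f j (x(j := y))) \<partial>\<mu> j)"
          using kj step(1) by (subst depends_upto_upd[OF G(2)]) auto
        also have "\<dots> = G x * ennreal (f (j - 1) x)"
          by (subst nn_integral_cmult) (auto simp: density_flow_step_nn[OF f step(1) x])
        finally show "(\<integral>\<^sup>+y. G (x(j := y)) * ennreal (f j (x(j := y))) \<partial>\<mu> j) = G x * ennreal (f (j - 1) x)" .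
      qed
      finally show "(\<integral>\<^sup>+x. G x * ennreal (f n x) \<partial>M) = (\<integral>\<^sup>+x. G x * ennreal (f (j - 1) x) \<partial>M)"
        using step kj by auto
    qed
  qed auto
  then show ?thesis using k by blast
qed

lemma density_flow_nn_integral:
  assumes f: "density_flow f" and k: "k \<le> n"
  shows "(\<integral>\<^sup>+x. ennreal (f k x) \<partial>M) = 1"
proof -
  have "(\<integral>\<^sup>+x. 1 * ennreal (f n x) \<partial>M) = (\<integral>\<^sup>+x. 1 * ennreal (f 0 x) \<partial>M)"
    by (rule density_flow_tower[OF f]) (auto simp: depends_upto_def)
  moreover have "(\<integral>\<^sup>+x. 1 * ennreal (f n x) \<partial>M) = (\<integral>\<^sup>+x. 1 * ennreal (f k x) \<partial>M)"
    by (rule density_flow_tower[OF f k]) (auto simp: depends_upto_def)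
  ultimately show ?thesis by (simp add: density_flow_0[OF f] L.emeasure_space_1)
qed

lemma integrable_flow:
  assumes f: "density_flow f" and k: "k \<le> n"
    and G: "G \<in> borel_measurable M" "\<And>x. x \<in> space M \<Longrightarrow> \<bar>G x :: real\<bar> \<le> K"
  shows "integrable M (\<lambda>x. f k x * G x)"
proof -
  obtain K' where K': "\<And>k x. k \<le> n \<Longrightarrow> x \<in> space M \<Longrightarrow> f k x \<le> exp K'"
    using density_flow_bounds[OF f] by metis
  show ?thesis
  proof (rule integrable_bounded[of _ "exp K' * K"])
    show "(\<lambda>x. f k x * G x) \<in> borel_measurable M"
      using density_flow_measurable[OF f k] G(1) by simp
    fix x assume "x \<in> space M"
    then show "\<bar>f k x * G x\<bar> \<le> exp K' * K"
      using K'[OF k] density_flow_pos[OF f k] G(2)[of x]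
      by (simp add: abs_mult mult_mono less_imp_le)
  qed
qed

lemma density_flow_integral:
  assumes f: "density_flow f" and k: "k \<le> n"
  shows "integrable M (f k)" "(\<integral>x. f k x \<partial>M) = 1"
proof -
  show *: "integrable M (f k)"
    using integrable_flow[OF f k, of "\<lambda>_. 1" 1] by simp
  show "(\<integral>x. f k x \<partial>M) = 1"
    using density_flow_nn_integral[OF f k] density_flow_pos[OF f k] density_flow_measurable[OF f k]
    by (subst integral_eq_nn_integral) (auto intro!: AE_I2 less_imp_le)
qed

lemma density_flow_tower_integral:
  assumes f: "density_flow f" and k: "k \<le> n"
    and G: "G \<in> borel_measurable M" "depends_upto k G" "\<And>x. x \<in> space M \<Longrightarrow> \<bar>G x :: real\<bar> \<le> K"
  shows "(\<integral>x. f n x * G x \<partial>M) = (\<integral>x. f k x * G x \<partial>M)"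
proof -
  \<comment> \<open>Shifting by the bound K makes the integrand nonnegative, so the tower property
    for nonnegative integrals applies; the shift adds K on both sides because both densities have
    mass one.\<close>
  have *: "(\<integral>x. f n x * (G x + K) \<partial>M) = (\<integral>x. f k x * (G x + K) \<partial>M)"
  proof -
    have eq: "(\<integral>\<^sup>+x. ennreal (f j x * (G x + K)) \<partial>M) = (\<integral>\<^sup>+x. ennreal (G x + K) * ennreal (f j x) \<partial>M)"
      if "j \<le> n" for j
      by (intro nn_integral_cong)
         (use density_flow_pos[OF f that] G(3) in \<open>force simp: ennreal_mult[symmetric] mult.commute less_imp_le\<close>)
    have "(\<integral>\<^sup>+x. ennreal (f n x * (G x + K)) \<partial>M) = (\<integral>\<^sup>+x. ennreal (f k x * (G x + K)) \<partial>M)"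
      unfolding eq[OF k] eq[OF order.refl]
      by (rule density_flow_tower[OF f k]) (use G(1) depends_upto_comp[OF G(2)] in auto)
    moreover have "0 \<le> f j x * (G x + K)" if "j \<le> n" "x \<in> space M" for j x
      using density_flow_pos[OF f that] G(3)[OF that(2)] by (intro mult_nonneg_nonneg) auto
    moreover have "(\<lambda>x. f j x * (G x + K)) \<in> borel_measurable M" if "j \<le> n" for j
      using density_flow_measurable[OF f that] G(1) by simp
    ultimately show ?thesis
      using k by (simp add: integral_eq_nn_integral)
  qed
  have "(\<integral>x. f j x * (G x + K) \<partial>M) = (\<integral>x. f j x * G x \<partial>M) + K" if "j \<le> n" for j
    using integrable_flow[OF f that G(1,3)] density_flow_integral[OF f that]
    by (simp add: distrib_left)
  with * k show ?thesis by simp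
qed

section \<open>Entropies and cross-entropies along a density flow\<close>

text \<open>The relative entropy of the k-th marginal as a real number, computed on S^n;
  \<open>relative_entropy_marginal\<close> makes the connection.\<close>

definition flow_entropy :: "(nat \<Rightarrow> (nat \<Rightarrow> 's) \<Rightarrow> real) \<Rightarrow> nat \<Rightarrow> real" where
  "flow_entropy f k = (\<integral>x. f k x * ln (f k x) \<partial>M)"

lemma measurable_ln_flow: "density_flow f \<Longrightarrow> k \<le> n \<Longrightarrow> (\<lambda>x. ln (f k x)) \<in> borel_measurable M"
  using density_flow_measurable by simp

lemma integrable_flow_ln:
  assumes f: "density_flow f" "k \<le> n" and g: "density_flow g" "j \<le> n"
  shows "integrable M (\<lambda>x. f k x * ln (g j x))"
proof -
  obtain K where "\<And>k x. k \<le> n \<Longrightarrow> x \<in> space M \<Longrightarrow> \<bar>ln (g k x)\<bar> \<le> K"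
    using density_flow_bounds[OF g(1)] by metis
  then show ?thesis
    using g by (intro integrable_flow[OF f measurable_ln_flow[OF g], of K]) auto
qed

lemma flow_ln_tower:
  assumes f: "density_flow f" "k \<le> n" and g: "density_flow g"
  shows "(\<integral>x. f n x * ln (g k x) \<partial>M) = (\<integral>x. f k x * ln (g k x) \<partial>M)"
proof -
  obtain K where "\<And>k x. k \<le> n \<Longrightarrow> x \<in> space M \<Longrightarrow> \<bar>ln (g k x)\<bar> \<le> K"
    using density_flow_bounds[OF g(1)] by metis
  then show ?thesis
    using f(2) by (intro density_flow_tower_integral[OF f measurable_ln_flow[OF g f(2)]
          depends_upto_comp[OF density_flow_depends[OF g f(2)]], of K]) auto
qed

text \<open>Gibbs' inequality: ln t <= t - 1 at the quotient t of the two densities, weighted by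
  \<open>f k\<close>; both densities have mass one. This is the source of the convexity of the dual
  function.\<close>

lemma flow_gibbs:
  assumes f: "density_flow f" "k \<le> n" and g: "density_flow g"
  shows "(\<integral>x. f k x * ln (g k x) \<partial>M) \<le> flow_entropy f k"
proof -
  have "(\<integral>x. f k x * ln (g k x) - f k x * ln (f k x) \<partial>M) \<le> (\<integral>x. g k x - f k x \<partial>M)"
  proof (rule integral_mono)
    show "integrable M (\<lambda>x. f k x * ln (g k x) - f k x * ln (f k x))"
      using integrable_flow_ln[OF f f] integrable_flow_ln[OF f g f(2)] by simp
    show "integrable M (\<lambda>x. g k x - f k x)"
      using density_flow_integral[OF f] density_flow_integral[OF g f(2)] by simp
    fix x assume "x \<in> space M"
    then have pos: "f k x > 0" "g k x > 0" using density_flow_pos[OF f] density_flow_pos[OF g f(2)] by auto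
    then have "f k x * ln (g k x / f k x) \<le> f k x * (g k x / f k x - 1)"
      by (intro mult_left_mono ln_le_minus_one) auto
    then show "f k x * ln (g k x) - f k x * ln (f k x) \<le> g k x - f k x"
      using pos by (simp add: ln_div algebra_simps)
  qed
  then show ?thesis
    using integrable_flow_ln[OF f f] integrable_flow_ln[OF f g f(2)]
      density_flow_integral[OF f] density_flow_integral[OF g f(2)]
    by (simp add: flow_entropy_def)
qed

end

section \<open>Tilted measures and convex duality\<close>

context product_law
begin

text \<open>The counter d is the number of coordinates already integrated out, since a primitive
  recursion counts upwards while the levels descend; the step \<open>Suc d\<close> therefore
  integrates coordinate n - d.\<close>

primrec potential_aux :: "((nat \<Rightarrow> 's) \<Rightarrow> real) \<Rightarrow> (nat \<Rightarrow> real) \<Rightarrow> nat \<Rightarrow> (nat \<Rightarrow> 's) \<Rightarrow> real" where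
  "potential_aux \<Phi> u 0 x = \<Phi> x"
| "potential_aux \<Phi> u (Suc d) x =
    u (n - d) * ln (\<integral>y. exp (potential_aux \<Phi> u d (x(n - d := y)) / u (n - d)) \<partial>\<mu> (n - d))"

definition potential :: "((nat \<Rightarrow> 's) \<Rightarrow> real) \<Rightarrow> (nat \<Rightarrow> real) \<Rightarrow> nat \<Rightarrow> (nat \<Rightarrow> 's) \<Rightarrow> real" where
  "potential \<Phi> u j = potential_aux \<Phi> u (n - j)"

lemma potential_top: "potential \<Phi> u n = \<Phi>"
  by (simp add: potential_def fun_eq_iff)

lemma potential_step:
  assumes "j \<in> {1..n}"
  shows "potential \<Phi> u (j - 1) x = u j * ln (\<integral>y. exp (potential \<Phi> u j (x(j := y)) / u j) \<partial>\<mu> j)"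
proof -
  have "n - (j - 1) = Suc (n - j)" "n - (n - j) = j" using assms by auto
  then show ?thesis by (simp add: potential_def)
qed

text \<open>Each summand is a conditional log density: given the coordinates before j, the mean of
  \<open>exp (potential \<Phi> u j x / u j)\<close> is
  \<open>exp (potential \<Phi> u (j - 1) x / u j)\<close>, by the recursion for the
  potentials.\<close>

definition gibbs_flow :: "((nat \<Rightarrow> 's) \<Rightarrow> real) \<Rightarrow> (nat \<Rightarrow> real) \<Rightarrow> nat \<Rightarrow> (nat \<Rightarrow> 's) \<Rightarrow> real" where
  "gibbs_flow \<Phi> u k x = exp (\<Sum>j=1..k. (potential \<Phi> u j x - potential \<Phi> u (j - 1) x) / u j)"

context
  fixes \<Phi> :: "(nat \<Rightarrow> 's) \<Rightarrow> real" and C :: real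
  assumes Phi_meas: "\<Phi> \<in> borel_measurable M"
    and Phi_dep: "depends_upto n \<Phi>"
    and Phi_bound: "\<And>x. x \<in> space M \<Longrightarrow> \<bar>\<Phi> x\<bar> \<le> C"
begin

lemma potential_measurable: "j \<le> n \<Longrightarrow> potential \<Phi> u j \<in> borel_measurable M"
proof (induction j rule: down_induct)
  case (step j)
  have "(\<lambda>x. \<integral>y. exp (potential \<Phi> u j (x(j := y)) / u j) \<partial>\<mu> j) \<in> borel_measurable M"
    by (rule measurable_upd_integral) (use step in auto)
  then show ?case
    unfolding potential_step[OF step(1), abs_def] by simp
qed (simp add: potential_top Phi_meas)

lemma potential_depends: "j \<le> n \<Longrightarrow> depends_upto j (potential \<Phi> u j)"
proof (induction j rule: down_induct)
  case (step j)
  show ?case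
    unfolding depends_upto_def potential_step[OF step(1)]
  proof (intro allI impI)
    fix x y :: "nat \<Rightarrow> 's" assume *: "\<forall>i\<in>{1..j - 1}. x i = y i"
    then have "potential \<Phi> u j (x(j := z)) = potential \<Phi> u j (y(j := z))" for z
    proof (intro depends_uptoD[OF step(2)])
      fix i assume "i \<in> {1..j}"
      then have "i = j \<or> i \<in> {1..j - 1}" by auto
      then show "(x(j := z)) i = (y(j := z)) i" using * by auto
    qed
    then show "u j * ln (\<integral>z. exp (potential \<Phi> u j (x(j := z)) / u j) \<partial>\<mu> j) =
      u j * ln (\<integral>z. exp (potential \<Phi> u j (y(j := z)) / u j) \<partial>\<mu> j)" by simp
  qed
qed (simp add: potential_top Phi_dep)

lemma integral_exp_bounds:
  assumes "integrable (\<mu> j) (\<lambda>y. exp (g y))" "\<And>y. \<bar>g y :: real\<bar> \<le> c"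
  shows "exp (- c) \<le> (\<integral>y. exp (g y) \<partial>\<mu> j)" "(\<integral>y. exp (g y) \<partial>\<mu> j) \<le> exp c"
proof -
  have 1: "- c \<le> g y" "g y \<le> c" for y using assms(2)[of y] by auto
  show "exp (- c) \<le> (\<integral>y. exp (g y) \<partial>\<mu> j)"
    using integral_mono[OF _ assms(1), of "\<lambda>_. exp (- c)"] 1 by (simp add: L.M.prob_space)
  show "(\<integral>y. exp (g y) \<partial>\<mu> j) \<le> exp c"
    using integral_mono[OF assms(1), of "\<lambda>_. exp c"] 1 by (simp add: L.M.prob_space)
qed

text \<open>Passing from psi to u ln E[exp (psi / u)] preserves a bound on the absolute value,
  whatever u > 0 is. The bound at level j also gives integrability of the exponential and keeps its
  mean away from 0, where the logarithm would be meaningless.\<close>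

lemma potential_bound:
  assumes "\<And>j. j \<in> {1..n} \<Longrightarrow> u j > 0"
  shows "j \<le> n \<Longrightarrow> x \<in> space M \<Longrightarrow> \<bar>potential \<Phi> u j x\<bar> \<le> C"
    and "j \<in> {1..n} \<Longrightarrow> x \<in> space M \<Longrightarrow> integrable (\<mu> j) (\<lambda>y. exp (potential \<Phi> u j (x(j := y)) / u j))"
    and "j \<in> {1..n} \<Longrightarrow> x \<in> space M \<Longrightarrow>
      exp (- C / u j) \<le> (\<integral>y. exp (potential \<Phi> u j (x(j := y)) / u j) \<partial>\<mu> j)"
proof -
  have int: "integrable (\<mu> j) (\<lambda>y. exp (potential \<Phi> u j (x(j := y)) / u j))"
    if "j \<in> {1..n}" "x \<in> space M" "\<forall>x\<in>space M. \<bar>potential \<Phi> u j x\<bar> \<le> C" for j x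
  proof (rule integrable_slice[of _ _ _ "exp (C / u j)"])
    show "(\<lambda>x. exp (potential \<Phi> u j x / u j)) \<in> borel_measurable M"
      using potential_measurable[of j u] that by simp
    fix z assume "z \<in> space M"
    with that(3) have "potential \<Phi> u j z \<le> C" by (auto simp: abs_le_iff)
    then show "\<bar>exp (potential \<Phi> u j z / u j)\<bar> \<le> exp (C / u j)"
      using assms[OF that(1)] by (simp add: divide_right_mono)
  qed fact+
  have est: "exp (- (C / u j)) \<le> (\<integral>y. exp (potential \<Phi> u j (x(j := y)) / u j) \<partial>\<mu> j)
     \<and> (\<integral>y. exp (potential \<Phi> u j (x(j := y)) / u j) \<partial>\<mu> j) \<le> exp (C / u j)"
    if "j \<in> {1..n}" "x \<in> space M" "\<forall>x\<in>space M. \<bar>potential \<Phi> u j x\<bar> \<le> C" for j x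
  proof -
    have "\<bar>potential \<Phi> u j (x(j := y)) / u j\<bar> \<le> C / u j" for y
      using that(3) upd_space_M[OF that(2,1)] assms[OF that(1)]
      by (simp add: abs_divide divide_right_mono)
    then show ?thesis using integral_exp_bounds[OF int[OF that]] by blast
  qed
  have b: "\<forall>x\<in>space M. \<bar>potential \<Phi> u j x\<bar> \<le> C" if "j \<le> n" for j
    using that
  proof (induction j rule: down_induct)
    case (step j)
    show ?case
    proof
      fix x assume x: "x \<in> space M"
      define I where "I = (\<integral>y. exp (potential \<Phi> u j (x(j := y)) / u j) \<partial>\<mu> j)"
      have e: "exp (- (C / u j)) \<le> I" "I \<le> exp (C / u j)"
        using est[OF step(1) x step(2)] by (auto simp: I_def)
      then have "I > 0" by (meson exp_gt_zero less_le_trans)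
      then have "- (C / u j) \<le> ln I" "ln I \<le> C / u j"
        using e by (metis exp_le_cancel_iff exp_ln)+
      then have "\<bar>ln I\<bar> \<le> C / u j" by auto
      then show "\<bar>potential \<Phi> u (j - 1) x\<bar> \<le> C"
        unfolding potential_step[OF step(1)] I_def[symmetric]
        using assms[OF step(1)] by (simp add: abs_mult field_simps)
    qed
  qed (simp add: potential_top Phi_bound)
  then show "j \<le> n \<Longrightarrow> x \<in> space M \<Longrightarrow> \<bar>potential \<Phi> u j x\<bar> \<le> C" by blast
  show "j \<in> {1..n} \<Longrightarrow> x \<in> space M \<Longrightarrow> integrable (\<mu> j) (\<lambda>y. exp (potential \<Phi> u j (x(j := y)) / u j))"
    using int b by simp
  show "j \<in> {1..n} \<Longrightarrow> x \<in> space M \<Longrightarrow>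
      exp (- C / u j) \<le> (\<integral>y. exp (potential \<Phi> u j (x(j := y)) / u j) \<partial>\<mu> j)"
    using est[of j x] b[of j] by simp
qed

text \<open>An increment of potentials is at most 2 C, dividing by \<open>u j\<close> >= 1 does not
  enlarge it, and there are at most n of them. The bound does not involve \<open>u\<close>, so it
  supplies a dominating constant and a Lipschitz constant for all multipliers at once.\<close>

lemma gibbs_flow_ln_bound:
  assumes u: "\<And>j. j \<in> {1..n} \<Longrightarrow> u j \<ge> 1" and k: "k \<le> n" and x: "x \<in> space M"
  shows "\<bar>ln (gibbs_flow \<Phi> u k x)\<bar> \<le> 2 * C * n"
proof -
  have C: "C \<ge> 0" using Phi_bound[OF x] by linarith
  have "\<bar>(potential \<Phi> u j x - potential \<Phi> u (j - 1) x) / u j\<bar> \<le> 2 * C" if "j \<in> {1..n}" for j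
  proof -
    have pos: "\<And>j. j \<in> {1..n} \<Longrightarrow> 0 < u j" by (rule less_le_trans[OF zero_less_one u])
    have "\<bar>potential \<Phi> u j x - potential \<Phi> u (j - 1) x\<bar> \<le> 2 * C"
    proof -
      have "\<bar>potential \<Phi> u j x\<bar> \<le> C" "\<bar>potential \<Phi> u (j - 1) x\<bar> \<le> C"
        using that x by (auto intro!: potential_bound(1)[where u=u, OF pos])
      then show ?thesis by linarith
    qed
    also have "2 * C \<le> 2 * C * u j" using u[OF that] C by (simp add: mult_le_cancel_left1)
    finally show ?thesis using pos[OF that] by (simp add: abs_divide divide_le_eq)
  qed
  then have "\<bar>\<Sum>j=1..k. (potential \<Phi> u j x - potential \<Phi> u (j - 1) x) / u j\<bar> \<le> (\<Sum>j=1..k. 2 * C)"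
    using k by (intro order.trans[OF sum_abs] sum_mono) auto
  also have "\<dots> \<le> 2 * C * n" using k C by (simp add: mult.commute mult_left_mono)
  finally show ?thesis by (simp add: gibbs_flow_def)
qed

lemma density_flow_gibbs_flow:
  assumes u: "\<And>j. j \<in> {1..n} \<Longrightarrow> u j \<ge> 1"
  shows "density_flow (gibbs_flow \<Phi> u)"
proof -
  have pos: "\<And>j. j \<in> {1..n} \<Longrightarrow> 0 < u j" by (rule less_le_trans[OF zero_less_one u])
  have "gibbs_flow \<Phi> u k \<in> borel_measurable M" if "k \<le> n" for k
  proof -
    have "(\<lambda>x. exp (\<Sum>j=1..k. (potential \<Phi> u j x - potential \<Phi> u (j - 1) x) / u j)) \<in> borel_measurable M"
      using that by (intro borel_measurable_exp borel_measurable_sum measurable_compose[OF _ borel_measurable_exp]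
          borel_measurable_divide borel_measurable_diff potential_measurable) auto
    then show ?thesis by (simp add: gibbs_flow_def[abs_def])
  qed
  moreover have "depends_upto k (gibbs_flow \<Phi> u k)" if "k \<le> n" for k
    unfolding depends_upto_def
  proof (intro allI impI)
    fix x y :: "nat \<Rightarrow> 's" assume "\<forall>i\<in>{1..k}. x i = y i"
    then have "potential \<Phi> u j x = potential \<Phi> u j y" if "j \<le> k" for j
      using that \<open>k \<le> n\<close> by (intro depends_uptoD[OF potential_depends]) auto
    then show "gibbs_flow \<Phi> u k x = gibbs_flow \<Phi> u k y"
      by (auto simp: gibbs_flow_def intro!: arg_cong[where f=exp] sum.cong)
  qed
  moreover have "gibbs_flow \<Phi> u 0 x = 1" for x by (simp add: gibbs_flow_def)
  moreover have "0 < gibbs_flow \<Phi> u k x" for k x by (simp add: gibbs_flow_def)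
  moreover have "(\<integral>y. gibbs_flow \<Phi> u k (x(k := y)) \<partial>\<mu> k) = gibbs_flow \<Phi> u (k - 1) x"
    if k: "k \<in> {1..n}" and x: "x \<in> space M" for k x
  proof -
    define I where "I = (\<integral>y. exp (potential \<Phi> u k (x(k := y)) / u k) \<partial>\<mu> k)"
    have I: "I > 0" using potential_bound(3)[where u=u, OF pos k x] unfolding I_def by (meson exp_gt_zero less_le_trans)
    have low: "potential \<Phi> u j (x(k := y)) = potential \<Phi> u j x" if "j < k" for j y
      using k that by (intro depends_upto_upd[OF potential_depends]) auto
    have "gibbs_flow \<Phi> u k (x(k := y)) = gibbs_flow \<Phi> u (k - 1) x *
        (exp (potential \<Phi> u k (x(k := y)) / u k) / I)" for y
    proof -
      have "{1..k} = insert k {1..k - 1}" "k \<notin> {1..k - 1}" using k by auto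
      then have "gibbs_flow \<Phi> u k (x(k := y)) = gibbs_flow \<Phi> u (k - 1) (x(k := y)) *
        exp ((potential \<Phi> u k (x(k := y)) - potential \<Phi> u (k - 1) (x(k := y))) / u k)"
        using k by (simp add: gibbs_flow_def exp_add mult.commute)
      moreover have "gibbs_flow \<Phi> u (k - 1) (x(k := y)) = gibbs_flow \<Phi> u (k - 1) x"
        unfolding gibbs_flow_def using k by (intro arg_cong[where f=exp] sum.cong) (auto simp: low)
      \<comment> \<open>The potential one level down is exactly the logarithm of the normalizing
        constant of the conditional density at level k.\<close>
      moreover have "exp (potential \<Phi> u (k - 1) (x(k := y)) / u k) = I"
      proof -
        have "potential \<Phi> u (k - 1) (x(k := y)) = u k * ln I"
          using k low[of "k - 1" y] by (simp add: potential_step[OF k] I_def)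
        then show ?thesis using pos[OF k] I by simp
      qed
      ultimately show ?thesis by (simp add: diff_divide_distrib exp_diff)
    qed
    then show ?thesis using I by (simp add: I_def)
  qed
  ultimately show ?thesis
    unfolding density_flow_def using gibbs_flow_ln_bound[where u=u, OF u] by blast
qed

text \<open>Summation by parts. \<open>\<Phi>\<close> minus the potential at level 0 telescopes into
  the terms \<open>u j * g j\<close>; writing \<open>u j\<close> as 1 + l j + ... + l n and
  exchanging the sums collects the g j with j <= k into the logarithm of the k-th density. The
  potential at level 0 depends on no coordinate, so it may be evaluated at
  \<open>undefined\<close>.\<close>

lemma tilted_potential_identity:
  assumes u: "\<And>j. u j = 1 + (\<Sum>k=j..n. l k)" "\<And>j. j \<in> {1..n} \<Longrightarrow> u j > 0"
  shows "\<Phi> x = potential \<Phi> u 0 undefined + ln (gibbs_flow \<Phi> u n x) + (\<Sum>k=1..n. l k * ln (gibbs_flow \<Phi> u k x))"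
proof -
  define g where "g j = (potential \<Phi> u j x - potential \<Phi> u (j - 1) x) / u j" for j
  have ln: "ln (gibbs_flow \<Phi> u k x) = (\<Sum>j=1..k. g j)" for k
    by (simp add: gibbs_flow_def g_def)
  have "(\<Sum>j=1..n. potential \<Phi> u j x - potential \<Phi> u (j - 1) x) = potential \<Phi> u n x - potential \<Phi> u 0 x"
  proof -
    have "(\<Sum>j=1..m. potential \<Phi> u j x - potential \<Phi> u (j - 1) x) = potential \<Phi> u m x - potential \<Phi> u 0 x" for m
      by (induction m) auto
    then show ?thesis .
  qed
  moreover have "u j * g j = potential \<Phi> u j x - potential \<Phi> u (j - 1) x" if "j \<in> {1..n}" for j
    using u(2)[OF that] by (simp add: g_def)
  ultimately have "\<Phi> x = potential \<Phi> u 0 x + (\<Sum>j=1..n. u j * g j)"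
    by (simp add: potential_top)
  also have "(\<Sum>j=1..n. u j * g j) = (\<Sum>j=1..n. g j) + (\<Sum>j=1..n. \<Sum>k=j..n. l k * g j)"
    by (simp add: u(1) distrib_right sum.distrib sum_distrib_right)
  also have "(\<Sum>j=1..n. \<Sum>k=j..n. l k * g j) = (\<Sum>k=1..n. \<Sum>j=1..k. l k * g j)"
  proof -
    have "(\<Sum>j=1..n. \<Sum>k=j..n. l k * g j) = (\<Sum>(j, k)\<in>(SIGMA j:{1..n}. {j..n}). l k * g j)"
      by (rule sum.Sigma) auto
    also have "\<dots> = (\<Sum>(k, j)\<in>(SIGMA k:{1..n}. {1..k}). l k * g j)"
      by (rule sum.reindex_bij_witness[of _ "\<lambda>(k, j). (j, k)" "\<lambda>(j, k). (k, j)"]) auto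
    also have "\<dots> = (\<Sum>k=1..n. \<Sum>j=1..k. l k * g j)"
      by (rule sum.Sigma[symmetric]) auto
    finally show ?thesis .
  qed
  also have "potential \<Phi> u 0 x = potential \<Phi> u 0 undefined"
    by (rule depends_uptoD[OF potential_depends]) auto
  finally show ?thesis by (simp add: ln sum_distrib_left)
qed

lemma potential_tendsto:
  assumes u: "\<And>l j. j \<in> {1..n} \<Longrightarrow> u l j \<ge> 1" "\<And>j. j \<in> {1..n} \<Longrightarrow> (\<lambda>l. u l j) \<longlonglongrightarrow> v j"
  shows "j \<le> n \<Longrightarrow> x \<in> space M \<Longrightarrow> (\<lambda>l. potential \<Phi> (u l) j x) \<longlonglongrightarrow> potential \<Phi> v j x"
proof (induction j arbitrary: x rule: down_induct)
  case (step j)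
  have v: "v j \<ge> 1" if "j \<in> {1..n}" for j
    using u(2)[OF that] by (rule LIMSEQ_le_const) (use u(1)[OF that] in auto)
  have pos: "\<And>j. j \<in> {1..n} \<Longrightarrow> 0 < u l j" "\<And>j. j \<in> {1..n} \<Longrightarrow> 0 < v j" for l
    by (rule less_le_trans[OF zero_less_one u(1)], assumption) (rule less_le_trans[OF zero_less_one v])
  have C: "C \<ge> 0" using Phi_bound[OF step(3)] by linarith
  have "(\<lambda>l. \<integral>y. exp (potential \<Phi> (u l) j (x(j := y)) / u l j) \<partial>\<mu> j)
      \<longlonglongrightarrow> (\<integral>y. exp (potential \<Phi> v j (x(j := y)) / v j) \<partial>\<mu> j)"
  \<comment> \<open>As \<open>u l j\<close> >= 1, every exponent stays below C along the whole
    sequence.\<close>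
  proof (rule integral_dominated_convergence[where w="\<lambda>_. exp C"])
    show "(\<lambda>y. exp (potential \<Phi> v j (x(j := y)) / v j)) \<in> borel_measurable (\<mu> j)"
      using potential_bound(2)[OF pos(2) step(1,3)] by auto
    show "(\<lambda>y. exp (potential \<Phi> (u l) j (x(j := y)) / u l j)) \<in> borel_measurable (\<mu> j)" for l
      using potential_bound(2)[OF pos(1) step(1,3)] by auto
    show "AE y in \<mu> j. (\<lambda>l. exp (potential \<Phi> (u l) j (x(j := y)) / u l j))
        \<longlonglongrightarrow> exp (potential \<Phi> v j (x(j := y)) / v j)"
      using pos(2)[OF step(1)]
      by (intro AE_I2 tendsto_exp tendsto_divide step(2) upd_space_M[OF step(3,1)] u(2)[OF step(1)]) auto
    show "AE y in \<mu> j. norm (exp (potential \<Phi> (u l) j (x(j := y)) / u l j)) \<le> exp C" for l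
    proof (rule AE_I2)
      fix y
      have "potential \<Phi> (u l) j (x(j := y)) \<le> C"
        using potential_bound(1)[where u="u l", OF pos(1) _ upd_space_M[OF step(3,1)], of j] step(1)
        by (metis abs_le_D1 atLeastAtMost_iff)
      also have "C \<le> C * u l j" using u(1)[OF step(1), of l] C by (simp add: mult_le_cancel_left1)
      finally show "norm (exp (potential \<Phi> (u l) j (x(j := y)) / u l j)) \<le> exp C"
        using pos(1)[OF step(1), of l] by (simp add: divide_le_eq)
    qed
  qed simp
  moreover have "(\<integral>y. exp (potential \<Phi> v j (x(j := y)) / v j) \<partial>\<mu> j) \<noteq> 0"
  proof -
    have "0 < exp (- C / v j)" by simp
    also have "\<dots> \<le> (\<integral>y. exp (potential \<Phi> v j (x(j := y)) / v j) \<partial>\<mu> j)"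
      by (rule potential_bound(3)[OF pos(2) step(1,3)])
    finally show ?thesis by simp
  qed
  ultimately show ?case
    unfolding potential_step[OF step(1)] using u(2)[OF step(1)] by (intro tendsto_mult tendsto_ln)
qed (simp add: potential_top)

text \<open>Dominated convergence; the constant is \<open>gibbs_flow_ln_bound\<close> used once for
  the density and once for its logarithm.\<close>

lemma gibbs_flow_entropy_tendsto:
  assumes u: "\<And>l j. j \<in> {1..n} \<Longrightarrow> u l j \<ge> 1" "\<And>j. j \<in> {1..n} \<Longrightarrow> (\<lambda>l. u l j) \<longlonglongrightarrow> v j"
    and k: "k \<le> n"
  shows "(\<lambda>l. flow_entropy (gibbs_flow \<Phi> (u l)) k) \<longlonglongrightarrow> flow_entropy (gibbs_flow \<Phi> v) k"
  unfolding flow_entropy_def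
proof (rule integral_dominated_convergence[where w="\<lambda>_. exp (2 * C * n) * (2 * C * n)"])
  have v: "v j \<ge> 1" if "j \<in> {1..n}" for j
    using u(2)[OF that] by (rule LIMSEQ_le_const) (use u(1)[OF that] in auto)
  show "(\<lambda>x. gibbs_flow \<Phi> v k x * ln (gibbs_flow \<Phi> v k x)) \<in> borel_measurable M"
    using density_flow_measurable[OF density_flow_gibbs_flow[OF v] k] by simp
  show "(\<lambda>x. gibbs_flow \<Phi> (u l) k x * ln (gibbs_flow \<Phi> (u l) k x)) \<in> borel_measurable M" for l
    using density_flow_measurable[OF density_flow_gibbs_flow[OF u(1)] k] by simp
  show "AE x in M. (\<lambda>l. gibbs_flow \<Phi> (u l) k x * ln (gibbs_flow \<Phi> (u l) k x))
      \<longlonglongrightarrow> gibbs_flow \<Phi> v k x * ln (gibbs_flow \<Phi> v k x)"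
  proof (rule AE_I2)
    fix x assume x: "x \<in> space M"
    have "(\<lambda>l. gibbs_flow \<Phi> (u l) k x) \<longlonglongrightarrow> gibbs_flow \<Phi> v k x"
      unfolding gibbs_flow_def
    proof (intro tendsto_exp tendsto_sum tendsto_divide tendsto_diff potential_tendsto[OF u] x)
      fix j assume j: "j \<in> {1..k}"
      show "v j \<noteq> 0" "(\<lambda>l. u l j) \<longlonglongrightarrow> v j" using v[of j] u(2)[of j] j k by auto
    qed (use k in auto)
    then show "(\<lambda>l. gibbs_flow \<Phi> (u l) k x * ln (gibbs_flow \<Phi> (u l) k x))
      \<longlonglongrightarrow> gibbs_flow \<Phi> v k x * ln (gibbs_flow \<Phi> v k x)"
      by (intro tendsto_mult tendsto_ln) (auto simp: gibbs_flow_def)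
  qed
  show "AE x in M. norm (gibbs_flow \<Phi> (u l) k x * ln (gibbs_flow \<Phi> (u l) k x))
      \<le> exp (2 * C * n) * (2 * C * n)" for l
  proof (rule AE_I2)
    fix x assume x: "x \<in> space M"
    note b = gibbs_flow_ln_bound[where u="u l", OF u(1) k x]
    have "gibbs_flow \<Phi> (u l) k x \<le> exp (2 * C * n)"
      using b unfolding gibbs_flow_def by (simp add: abs_le_iff)
    then show "norm (gibbs_flow \<Phi> (u l) k x * ln (gibbs_flow \<Phi> (u l) k x))
      \<le> exp (2 * C * n) * (2 * C * n)"
      using b by (auto simp: abs_mult gibbs_flow_def intro!: mult_mono)
  qed
qed simp


section \<open>The dual problem over the multipliers\<close>

text \<open>
  \<open>dual_value\<close> is convex in \<open>l\<close>, with the gradient at \<open>l\<close> given by the slacks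
  \<open>G k - flow_entropy (gibbs_flow \<Phi> (tilt l)) k\<close>; so the minimum over \<open>l \<ge> 0\<close> has exactly the feasibility
  and complementary slackness properties of an optimal pair.
\<close>

definition tilt :: "(nat \<Rightarrow> real) \<Rightarrow> nat \<Rightarrow> real" where
  "tilt l j = 1 + (\<Sum>k=j..n. l k)"

definition dual_value :: "(nat \<Rightarrow> real) \<Rightarrow> (nat \<Rightarrow> real) \<Rightarrow> real" where
  "dual_value G l = potential \<Phi> (tilt l) 0 undefined + (\<Sum>k=1..n. l k * G k)"

lemma tilt_ge_1:
  assumes "\<And>k. k \<in> {1..n} \<Longrightarrow> 0 \<le> l k" "j \<in> {1..n}"
  shows "1 \<le> tilt l j"
  using assms by (auto simp: tilt_def intro!: sum_nonneg)

text \<open>The function ln (g k) sees only the first k coordinates, so the density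
  \<open>f n\<close> may be replaced by \<open>f k\<close> in its term; the integral of
  \<open>\<Phi>\<close> becomes a combination of cross-entropies of marginals.\<close>

lemma integral_flow_decomposition:
  assumes f: "density_flow f" and g: "density_flow g"
    and eq: "\<And>x. x \<in> space M \<Longrightarrow> \<Phi> x = c + ln (g n x) + (\<Sum>k=1..n. l k * ln (g k x))"
  shows "(\<integral>x. f n x * \<Phi> x \<partial>M) = c + (\<integral>x. f n x * ln (g n x) \<partial>M) + (\<Sum>k=1..n. l k * (\<integral>x. f k x * ln (g k x) \<partial>M))"
proof -
  have int: "integrable M (\<lambda>x. f n x * ln (g k x))" if "k \<le> n" for k
    using integrable_flow_ln[OF f order.refl g that] .
  have "(\<integral>x. f n x * \<Phi> x \<partial>M) = (\<integral>x. c * f n x + f n x * ln (g n x) + (\<Sum>k=1..n. l k * (f n x * ln (g k x))) \<partial>M)"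
    by (rule Bochner_Integration.integral_cong) (auto simp: eq algebra_simps sum_distrib_left)
  also have "\<dots> = c + (\<integral>x. f n x * ln (g n x) \<partial>M) + (\<Sum>k=1..n. l k * (\<integral>x. f n x * ln (g k x) \<partial>M))"
    using int density_flow_integral[OF f order.refl]
    by (subst Bochner_Integration.integral_add Bochner_Integration.integral_sum | auto)+
  also have "(\<Sum>k=1..n. l k * (\<integral>x. f n x * ln (g k x) \<partial>M)) = (\<Sum>k=1..n. l k * (\<integral>x. f k x * ln (g k x) \<partial>M))"
    by (intro sum.cong) (auto simp: flow_ln_tower[OF f _ g])
  finally show ?thesis .
qed

text \<open>The integral of \<open>\<Phi>\<close> against the flow of l is computed twice, through
  the identity for l and through the one for l'. The first gives the entropies of this flow, the
  second gives cross-entropies, which Gibbs' inequality bounds by the same entropies because l' >=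
  0. This yields the gradient inequality without differentiating under the integral.\<close>

lemma dual_value_subgradient:
  assumes l: "\<And>k. k \<in> {1..n} \<Longrightarrow> 0 \<le> l k" and l': "\<And>k. k \<in> {1..n} \<Longrightarrow> 0 \<le> l' k"
  shows "dual_value G l + (\<Sum>k=1..n. (l' k - l k) * (G k - flow_entropy (gibbs_flow \<Phi> (tilt l)) k)) \<le> dual_value G l'"
proof -
  define f where "f = gibbs_flow \<Phi> (tilt l)"
  define g where "g = gibbs_flow \<Phi> (tilt l')"
  have f: "density_flow f" unfolding f_def by (rule density_flow_gibbs_flow[OF tilt_ge_1[OF l]])
  have g: "density_flow g" unfolding g_def by (rule density_flow_gibbs_flow[OF tilt_ge_1[OF l']])
  have ef: "\<Phi> x = potential \<Phi> (tilt l) 0 undefined + ln (f n x) + (\<Sum>k=1..n. l k * ln (f k x))" for x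
    unfolding f_def by (rule tilted_potential_identity[OF tilt_def])
      (rule less_le_trans[OF zero_less_one tilt_ge_1[OF l]])
  have eg: "\<Phi> x = potential \<Phi> (tilt l') 0 undefined + ln (g n x) + (\<Sum>k=1..n. l' k * ln (g k x))" for x
    unfolding g_def by (rule tilted_potential_identity[OF tilt_def])
      (rule less_le_trans[OF zero_less_one tilt_ge_1[OF l']])
  have "potential \<Phi> (tilt l) 0 undefined + flow_entropy f n + (\<Sum>k=1..n. l k * flow_entropy f k) = (\<integral>x. f n x * \<Phi> x \<partial>M)"
    unfolding flow_entropy_def by (rule integral_flow_decomposition[OF f f ef, symmetric])
  also have "\<dots> = potential \<Phi> (tilt l') 0 undefined + (\<integral>x. f n x * ln (g n x) \<partial>M)
      + (\<Sum>k=1..n. l' k * (\<integral>x. f k x * ln (g k x) \<partial>M))"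
    by (rule integral_flow_decomposition[OF f g eg])
  also have "\<dots> \<le> potential \<Phi> (tilt l') 0 undefined + flow_entropy f n + (\<Sum>k=1..n. l' k * flow_entropy f k)"
    by (intro add_mono sum_mono mult_left_mono flow_gibbs f g l') auto
  finally have "potential \<Phi> (tilt l) 0 undefined + (\<Sum>k=1..n. l k * flow_entropy f k)
    \<le> potential \<Phi> (tilt l') 0 undefined + (\<Sum>k=1..n. l' k * flow_entropy f k)" by simp
  then show ?thesis
    unfolding dual_value_def f_def[symmetric] by (simp add: algebra_simps sum.distrib sum_subtractf)
qed

lemma flow_entropy_gibbs_flow_bound:
  assumes u: "\<And>j. j \<in> {1..n} \<Longrightarrow> u j \<ge> 1" and k: "k \<le> n"
  shows "\<bar>flow_entropy (gibbs_flow \<Phi> u) k\<bar> \<le> 2 * C * n"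
proof -
  note f = density_flow_gibbs_flow[where u=u, OF u]
  have "\<bar>flow_entropy (gibbs_flow \<Phi> u) k\<bar> \<le> (\<integral>x. gibbs_flow \<Phi> u k x * (2 * C * n) \<partial>M)"
    unfolding flow_entropy_def
  proof (rule order.trans[OF integral_abs_bound], rule integral_mono)
    show "integrable M (\<lambda>x. \<bar>gibbs_flow \<Phi> u k x * ln (gibbs_flow \<Phi> u k x)\<bar>)"
      using integrable_flow_ln[OF f k f k] by simp
    show "integrable M (\<lambda>x. gibbs_flow \<Phi> u k x * (2 * C * n))"
      using density_flow_integral(1)[OF f k] by simp
    show "\<bar>gibbs_flow \<Phi> u k x * ln (gibbs_flow \<Phi> u k x)\<bar> \<le> gibbs_flow \<Phi> u k x * (2 * C * n)"
      if "x \<in> space M" for x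
      using gibbs_flow_ln_bound[where u=u, OF u k that] density_flow_pos[OF f k that]
      by (simp add: abs_mult)
  qed
  also have "\<dots> = 2 * C * n" using density_flow_integral[OF f k] by simp
  finally show ?thesis .
qed

text \<open>The subgradient inequality used from both ends, with slopes bounded by
  \<open>flow_entropy_gibbs_flow_bound\<close>; it supplies the continuity for the
  minimization.\<close>

lemma dual_value_lipschitz:
  assumes l: "\<And>k. k \<in> {1..n} \<Longrightarrow> 0 \<le> l k" and l': "\<And>k. k \<in> {1..n} \<Longrightarrow> 0 \<le> l' k"
  shows "\<bar>dual_value G l' - dual_value G l\<bar> \<le> (\<Sum>k=1..n. \<bar>l' k - l k\<bar> * (\<bar>G k\<bar> + 2 * C * n))"
proof -
  have *: "dual_value G l - dual_value G l' \<le> (\<Sum>k=1..n. \<bar>l' k - l k\<bar> * (\<bar>G k\<bar> + 2 * C * n))"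
    if l: "\<And>k. k \<in> {1..n} \<Longrightarrow> 0 \<le> l k" and l': "\<And>k. k \<in> {1..n} \<Longrightarrow> 0 \<le> l' k" for l l'
  proof -
    have "- (\<Sum>k=1..n. (l' k - l k) * (G k - flow_entropy (gibbs_flow \<Phi> (tilt l)) k))
      \<le> (\<Sum>k=1..n. \<bar>l' k - l k\<bar> * (\<bar>G k\<bar> + 2 * C * n))"
      unfolding sum_negf[symmetric]
    proof (rule sum_mono)
      fix k assume k: "k \<in> {1..n}"
      have "- ((l' k - l k) * (G k - flow_entropy (gibbs_flow \<Phi> (tilt l)) k))
        \<le> \<bar>l' k - l k\<bar> * \<bar>G k - flow_entropy (gibbs_flow \<Phi> (tilt l)) k\<bar>"
        by (metis abs_ge_minus_self abs_mult)
      also have "\<bar>G k - flow_entropy (gibbs_flow \<Phi> (tilt l)) k\<bar> \<le> \<bar>G k\<bar> + 2 * C * n"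
        using flow_entropy_gibbs_flow_bound[of "tilt l" k, OF tilt_ge_1[OF l]] k
        by (auto intro!: order.trans[OF abs_triangle_ineq4])
      finally show "- ((l' k - l k) * (G k - flow_entropy (gibbs_flow \<Phi> (tilt l)) k))
        \<le> \<bar>l' k - l k\<bar> * (\<bar>G k\<bar> + 2 * C * n)" by (simp add: mult_left_mono)
    qed
    with dual_value_subgradient[of l l' G, OF l l'] show ?thesis by linarith
  qed
  show ?thesis
    using *[of l l', OF l l'] *[of l' l, OF l' l] by (simp add: abs_le_iff abs_minus_commute)
qed

text \<open>Multipliers are functions on all of \<open>nat\<close>; fixing them to be 0 outside
  {1..n} makes the box compact in the product topology.\<close>

definition tilt_box :: "real \<Rightarrow> (nat \<Rightarrow> real) set" where
  "tilt_box L = {l. (\<forall>k\<in>{1..n}. 0 \<le> l k \<and> l k \<le> L) \<and> (\<forall>k. k \<notin> {1..n} \<longrightarrow> l k = 0)}"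

lemma dual_value_minimizer:
  assumes L: "L \<ge> 0"
  obtains l where "l \<in> tilt_box L" "\<And>l'. l' \<in> tilt_box L \<Longrightarrow> dual_value G l \<le> dual_value G l'"
proof -
  define B where "B = PiE UNIV (\<lambda>k. if k \<in> {1..n} then {0..L} else {0::real})"
  have B: "l \<in> B \<longleftrightarrow> (\<forall>k\<in>{1..n}. 0 \<le> l k \<and> l k \<le> L) \<and> (\<forall>k. k \<notin> {1..n} \<longrightarrow> l k = 0)" for l
    unfolding B_def PiE_iff by (auto split: if_splits)
  have "compactin (product_topology (\<lambda>_. euclidean) UNIV) B"
    unfolding B_def compactin_PiE by auto
  then have "compact B" by (simp add: euclidean_product_topology)
  moreover have "B \<noteq> {}" using L B[of "\<lambda>_. 0"] by auto
  moreover have "continuous_on B (dual_value G)"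
    unfolding continuous_on_sequentially comp_def
  proof (intro allI ballI impI, elim conjE)
    fix x :: "nat \<Rightarrow> nat \<Rightarrow> real" and a assume a: "a \<in> B" and x: "\<forall>m. x m \<in> B" and lim: "x \<longlonglongrightarrow> a"
    have co: "(\<lambda>m. x m k) \<longlonglongrightarrow> a k" for k
      using continuous_on_tendsto_compose[OF continuous_on_product_coordinates[of k] lim] by simp
    have "(\<lambda>m. \<Sum>k=1..n. \<bar>x m k - a k\<bar> * (\<bar>G k\<bar> + 2 * C * n)) \<longlonglongrightarrow> (\<Sum>k=1..n. \<bar>a k - a k\<bar> * (\<bar>G k\<bar> + 2 * C * n))"
      by (intro tendsto_intros co)
    then have z: "(\<lambda>m. \<Sum>k=1..n. \<bar>x m k - a k\<bar> * (\<bar>G k\<bar> + 2 * C * n)) \<longlonglongrightarrow> 0" by simp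
    have "(\<lambda>m. dual_value G (x m) - dual_value G a) \<longlonglongrightarrow> 0"
      using a x by (intro Lim_null_comparison[OF _ z] always_eventually allI)
        (auto simp: B intro!: dual_value_lipschitz)
    then show "(\<lambda>m. dual_value G (x m)) \<longlonglongrightarrow> dual_value G a" by (rule LIM_zero_cancel)
  qed
  ultimately obtain l where "l \<in> B" "\<forall>l'\<in>B. dual_value G l \<le> dual_value G l'"
    using continuous_attains_inf by blast
  then show ?thesis using that[of l] B by (auto simp: tilt_box_def)
qed

lemma flow_entropy_tilt_tendsto:
  assumes "\<And>m k. k \<in> {1..n} \<Longrightarrow> 0 \<le> l m k" "\<And>k. k \<in> {1..n} \<Longrightarrow> (\<lambda>m. l m k) \<longlonglongrightarrow> l' k" "k \<le> n"
  shows "(\<lambda>m. flow_entropy (gibbs_flow \<Phi> (tilt (l m))) k) \<longlonglongrightarrow> flow_entropy (gibbs_flow \<Phi> (tilt l')) k"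
proof (rule gibbs_flow_entropy_tendsto[OF _ _ assms(3)])
  show "1 \<le> tilt (l m) j" if "j \<in> {1..n}" for m j
    using tilt_ge_1[of "l m", OF assms(1) that] .
  show "(\<lambda>m. tilt (l m) j) \<longlonglongrightarrow> tilt l' j" if "j \<in> {1..n}" for j
    unfolding tilt_def using that by (intro tendsto_intros assms(2)) auto
qed

text \<open>The Karush-Kuhn-Tucker conditions at a minimizer of the dual. In place of one-sided
  derivatives, one multiplier is perturbed, the subgradient inequality is applied at the perturbed
  point, and the perturbation is sent to 0 by continuity of the entropies.\<close>

lemma optimal_gibbs_flow:
  assumes G: "\<And>k. k \<in> {1..n} \<Longrightarrow> 0 < G k"
  obtains c l f where "density_flow f"
    and "\<And>k. k \<in> {1..n} \<Longrightarrow> 0 \<le> l k"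
    and "\<And>k. k \<in> {1..n} \<Longrightarrow> flow_entropy f k \<le> G k"
    and "\<And>k. k \<in> {1..n} \<Longrightarrow> l k * flow_entropy f k = l k * G k"
    and "\<And>x. \<Phi> x = c + ln (f n x) + (\<Sum>k=1..n. l k * ln (f k x))"
proof -
  obtain z where z: "z \<in> space M" using L.P.not_empty by blast
  have C: "C \<ge> 0" using Phi_bound[OF z] by linarith
  define Gm where "Gm = Min (insert 1 (G ` {1..n}))"
  have Gm: "Gm > 0" unfolding Gm_def using G by (subst Min_gr_iff) auto
  have Gle: "Gm \<le> G k" if "k \<in> {1..n}" for k unfolding Gm_def using that by (intro Min_le) auto
  \<comment> \<open>At l = 0 the dual value is at most C, while a single multiplier above L pushes
    its linear part above 2 C + 1 and so the dual value above C + 1. A minimizer over [0, L + 1]^n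
    thus has all entries at most L, and the spare unit leaves room to raise an entry.\<close>
  define L where "L = (2 * C + 1) / Gm"
  have L: "L > 0" "L * Gm = 2 * C + 1" using Gm C by (auto simp: L_def)
  have L1: "0 \<le> L + 1" using L by simp
  obtain l where lbox: "l \<in> tilt_box (L + 1)"
    and min: "\<And>l'. l' \<in> tilt_box (L + 1) \<Longrightarrow> dual_value G l \<le> dual_value G l'"
    using dual_value_minimizer[OF L1, of G] by blast
  have l: "\<And>k. k \<in> {1..n} \<Longrightarrow> 0 \<le> l k \<and> l k \<le> L + 1" "\<And>k. k \<notin> {1..n} \<Longrightarrow> l k = 0"
    using lbox by (auto simp: tilt_box_def)
  have l0: "\<And>k. k \<in> {1..n} \<Longrightarrow> 0 \<le> l k" using l by blast
  have pot0: "\<bar>potential \<Phi> (tilt l') 0 undefined\<bar> \<le> C" if "\<And>k. k \<in> {1..n} \<Longrightarrow> 0 \<le> l' k" for l'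
  proof -
    have "potential \<Phi> (tilt l') 0 undefined = potential \<Phi> (tilt l') 0 z"
      by (rule depends_uptoD[OF potential_depends]) auto
    moreover have "0 < tilt l' j" if "j \<in> {1..n}" for j
      using tilt_ge_1[of l' j] that \<open>\<And>k. k \<in> {1..n} \<Longrightarrow> 0 \<le> l' k\<close> by force
    ultimately show ?thesis using potential_bound(1)[of "tilt l'" 0 z] z by simp
  qed
  have lL: "l k \<le> L" if k: "k \<in> {1..n}" for k
  proof (rule ccontr)
    assume "\<not> l k \<le> L"
    then have "L * Gm < l k * G k" using Gle[OF k] L Gm by (intro mult_less_le_imp_less) auto
    also have "\<dots> \<le> (\<Sum>k=1..n. l k * G k)"
      by (rule member_le_sum[OF k]) (auto intro!: mult_nonneg_nonneg[OF l0 less_imp_le[OF G]])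
    finally have "dual_value G l > C + 1"
      using pot0[of l, OF l0] L unfolding dual_value_def by (auto simp: abs_le_iff)
    moreover have "dual_value G (\<lambda>_. 0) \<le> C"
      using pot0[of "\<lambda>_. 0"] by (auto simp: dual_value_def)
    moreover have "dual_value G l \<le> dual_value G (\<lambda>_. 0)" by (rule min) (use L in \<open>auto simp: tilt_box_def\<close>)
    ultimately show False by linarith
  qed
  define H where "H l = flow_entropy (gibbs_flow \<Phi> (tilt l))" for l
  have single: "dual_value G l' + (l k - l' k) * (G k - H l' k) \<le> dual_value G l"
    if k: "k \<in> {1..n}" and l': "l' = l(k := t)" "0 \<le> t" for l' k t
  proof -
    have "(\<Sum>j=1..n. (l j - l' j) * (G j - H l' j)) = (l k - l' k) * (G k - H l' k)"
      by (subst sum.remove[OF _ k]) (auto intro!: sum.neutral simp: l')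
    then show ?thesis
      using dual_value_subgradient[of l' l G] l' l0 by (auto simp: H_def)
  qed
  have upper: "H l k \<le> G k" if k: "k \<in> {1..n}" for k
  proof -
    \<comment> \<open>By minimality, raising entry k by t does not lower the dual value; the
      subgradient inequality at the raised point bounds the gain by t times the slack there. Hence
      this slack is nonnegative.\<close>
    define lm where "lm m = l(k := l k + inverse (real (Suc m)))" for m
    have "H (lm m) k \<le> G k" for m
    proof -
      define t where "t = inverse (real (Suc m))"
      have t: "t > 0" "t \<le> 1" unfolding t_def by (auto simp: inverse_le_1_iff)
      have "dual_value G l \<le> dual_value G (lm m)"
      proof (rule min, unfold tilt_box_def, intro CollectI conjI[of "Ball _ _"] ballI allI impI)
        show "0 \<le> lm m j \<and> lm m j \<le> L + 1" if "j \<in> {1..n}" for j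
          using l(1)[OF that] l0[OF k] lL[OF k] t by (auto simp: lm_def t_def[symmetric] simp del: of_nat_Suc)
        show "lm m j = 0" if "j \<notin> {1..n}" for j using l(2)[OF that] k that by (auto simp: lm_def)
      qed
      moreover have "dual_value G (lm m) + (l k - lm m k) * (G k - H (lm m) k) \<le> dual_value G l"
        by (rule single[of k "lm m" "l k + t", OF k]) (use l0[OF k] t in \<open>auto simp: lm_def t_def\<close>)
      ultimately have "t * (G k - H (lm m) k) \<ge> 0" by (simp add: lm_def t_def[symmetric] del: of_nat_Suc)
      then show ?thesis using t by (simp add: zero_le_mult_iff)
    qed
    moreover have "(\<lambda>m. H (lm m) k) \<longlonglongrightarrow> H l k"
      unfolding H_def
    proof (rule flow_entropy_tilt_tendsto)
      show "0 \<le> lm m j" if "j \<in> {1..n}" for m j using l0[OF that] by (auto simp: lm_def)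
      show "(\<lambda>m. lm m j) \<longlonglongrightarrow> l j" for j
        using LIMSEQ_inverse_real_of_nat_add[of "l k"] by (cases "j = k") (auto simp: lm_def)
    qed (use k in auto)
    ultimately show ?thesis by (intro LIMSEQ_le_const2[of _ _ "G k"]) auto
  qed
  have lower: "G k \<le> H l k" if k: "k \<in> {1..n}" and pos: "l k > 0" for k
  proof -
    \<comment> \<open>A decrease proportional to \<open>l k\<close> keeps the entry nonnegative and
      is a genuine move because \<open>l k\<close> > 0; the same comparison then gives a slack of
      the opposite sign.\<close>
    define lm where "lm m = l(k := l k + - (l k * inverse (real (Suc m))))" for m
    have t: "0 < l k * inverse (real (Suc m))" "l k * inverse (real (Suc m)) \<le> l k" for m
      using pos by (auto simp: inverse_eq_divide divide_le_eq)
    have "G k \<le> H (lm m) k" for m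
    proof -
      define t where "t = l k * inverse (real (Suc m))"
      have t: "t > 0" "t \<le> l k" unfolding t_def by fact+
      have "dual_value G l \<le> dual_value G (lm m)"
      proof (rule min, unfold tilt_box_def, intro CollectI conjI[of "Ball _ _"] ballI allI impI)
        show "0 \<le> lm m j \<and> lm m j \<le> L + 1" if "j \<in> {1..n}" for j
          using l(1)[OF that] l(1)[OF k] t by (auto simp: lm_def t_def[symmetric] simp del: of_nat_Suc)
        show "lm m j = 0" if "j \<notin> {1..n}" for j using l(2)[OF that] k that by (auto simp: lm_def)
      qed
      moreover have "dual_value G (lm m) + (l k - lm m k) * (G k - H (lm m) k) \<le> dual_value G l"
        by (rule single[of k "lm m" "l k + - t", OF k]) (use t in \<open>auto simp: lm_def t_def\<close>)
      ultimately have "t * (G k - H (lm m) k) \<le> 0" by (simp add: lm_def t_def[symmetric] del: of_nat_Suc)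
      then show ?thesis using t by (simp add: mult_le_0_iff)
    qed
    moreover have "(\<lambda>m. H (lm m) k) \<longlonglongrightarrow> H l k"
      unfolding H_def
    proof (rule flow_entropy_tilt_tendsto)
      show "0 \<le> lm m j" if "j \<in> {1..n}" for m j using l0[OF that] t(2)[of m] by (auto simp: lm_def)
      have "(\<lambda>m. l k + - (l k * inverse (real (Suc m)))) \<longlonglongrightarrow> l k + - (l k * 0)"
        by (intro tendsto_intros LIMSEQ_inverse_real_of_nat)
      then show "(\<lambda>m. lm m j) \<longlonglongrightarrow> l j" for j by (cases "j = k") (auto simp: lm_def)
    qed (use k in auto)
    ultimately show ?thesis by (intro LIMSEQ_le_const[of _ _ "G k"]) auto
  qed
  show ?thesis
  proof (rule that[of "gibbs_flow \<Phi> (tilt l)" l "potential \<Phi> (tilt l) 0 undefined"])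
    show "density_flow (gibbs_flow \<Phi> (tilt l))"
      by (rule density_flow_gibbs_flow[OF tilt_ge_1[OF l0]])
    show "\<Phi> x = potential \<Phi> (tilt l) 0 undefined + ln (gibbs_flow \<Phi> (tilt l) n x)
        + (\<Sum>k=1..n. l k * ln (gibbs_flow \<Phi> (tilt l) k x))" for x
    proof (rule tilted_potential_identity)
      show "tilt l j = 1 + (\<Sum>k=j..n. l k)" for j by (rule tilt_def)
      show "0 < tilt l j" if "j \<in> {1..n}" for j using tilt_ge_1[of l j, OF l0 that] by simp
    qed
    show "flow_entropy (gibbs_flow \<Phi> (tilt l)) k \<le> G k" if "k \<in> {1..n}" for k
      using upper[OF that] by (simp add: H_def)
    show "l k * flow_entropy (gibbs_flow \<Phi> (tilt l)) k = l k * G k" if "k \<in> {1..n}" for k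
      using upper[OF that] lower[OF that] l0[OF that] by (cases "l k = 0") (auto simp: H_def)
  qed (fact l0)
qed

end

end

section \<open>The hierarchical environment\<close>

lemma finite_configs: "finite (configs \<gamma> N j)"
  unfolding configs_def by (rule finite_PiE) auto

lemma finite_env_index: "finite (env_index n \<gamma> N)"
  unfolding env_index_def by (auto intro!: finite_SigmaI finite_configs)

lemma restrict_configs: "\<alpha> \<in> configs \<gamma> N n \<Longrightarrow> j \<le> n \<Longrightarrow> restrict \<alpha> {1..j} \<in> configs \<gamma> N j"
  unfolding configs_def by (auto simp: PiE_iff)

lemma env_indexI: "\<alpha> \<in> configs \<gamma> N n \<Longrightarrow> j \<in> {1..n} \<Longrightarrow> i \<in> {1..N} \<Longrightarrow> (j, restrict \<alpha> {1..j}, i) \<in> env_index n \<gamma> N"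
  unfolding env_index_def using restrict_configs by auto

lemma restrict_eq_mono: "restrict \<alpha> {1..k} = restrict \<beta> {1..k} \<Longrightarrow> j \<le> k \<Longrightarrow> restrict \<alpha> {1..j} = restrict \<beta> {1..j::nat}"
  by (auto simp: restrict_def fun_eq_iff) (metis atLeastAtMost_iff order_trans)+

text \<open>The overlap of two configurations, that is, the length of their longest common prefix;
  the empty prefix guarantees that there is one.\<close>

lemma overlap_exists:
  obtains k where "k \<le> n" "restrict \<alpha> {1..k} = restrict \<beta> {1..k}"
    "\<And>j. k < j \<Longrightarrow> j \<le> n \<Longrightarrow> restrict \<alpha> {1..j} \<noteq> restrict \<beta> {1..j::nat}"
proof -
  let ?P = "\<lambda>k. k \<le> n \<and> restrict \<alpha> {1..k} = restrict \<beta> {1..k}"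
  have P0: "?P 0" by auto
  have "?P (Greatest ?P)" by (rule GreatestI_nat[where P="?P", OF P0]) auto
  moreover have "\<not> ?P j" if "Greatest ?P < j" for j
    using Greatest_le_nat[of ?P j n] that by auto
  ultimately show ?thesis using that[of "Greatest ?P"] by blast
qed

text \<open>The first k entries are frozen and entry j > k keeps 2^(gamma_j N) choices.
  Admissibility makes the floors exact, and the total weight 1 turns the remaining exponents into N
  (1 - Gamma_k).\<close>

lemma card_configs_prefix:
  assumes \<alpha>: "\<alpha> \<in> configs \<gamma> N n" and k: "k \<le> n" and N: "N \<in> admissible_sizes n \<gamma>"
    and pos: "\<And>k. k \<in> {1..n} \<Longrightarrow> 0 < \<gamma> k" and sum1: "(\<Sum>k=1..n. \<gamma> k) = 1"
  shows "real (card {\<beta> \<in> configs \<gamma> N n. restrict \<beta> {1..k} = restrict \<alpha> {1..k}})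
    = exp (real N * (ln 2 - (\<Sum>j=1..k. \<gamma> j) * ln 2))"
proof -
  define s where "s j = nat \<lfloor>\<gamma> j * real N\<rfloor>" for j
  have s: "real (s j) = \<gamma> j * real N" if "j \<in> {1..n}" for j
  proof -
    have "\<gamma> j * real N \<in> \<int>" using N that by (auto simp: admissible_sizes_def)
    moreover have "0 \<le> \<gamma> j * real N" using pos[OF that] by simp
    ultimately show ?thesis unfolding s_def by (auto elim!: Ints_cases)
  qed
  have "{\<beta> \<in> configs \<gamma> N n. restrict \<beta> {1..k} = restrict \<alpha> {1..k}}
    = PiE {1..n} (\<lambda>j. if j \<le> k then {\<alpha> j} else {1..2 ^ s j})"
  proof (intro set_eqI iffI)
    fix \<beta> assume b: "\<beta> \<in> {\<beta> \<in> configs \<gamma> N n. restrict \<beta> {1..k} = restrict \<alpha> {1..k}}"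
    then have "\<beta> j = \<alpha> j" if "j \<in> {1..k}" for j using that by (metis (mono_tags, lifting) mem_Collect_eq restrict_apply')
    with b show "\<beta> \<in> PiE {1..n} (\<lambda>j. if j \<le> k then {\<alpha> j} else {1..2 ^ s j})"
      by (auto simp: configs_def PiE_iff s_def)
  next
    fix \<beta> assume b: "\<beta> \<in> PiE {1..n} (\<lambda>j. if j \<le> k then {\<alpha> j} else {1..2 ^ s j})"
    then have eq: "\<beta> j = \<alpha> j" if "j \<in> {1..k}" for j using that k by (force simp: PiE_iff)
    have "\<beta> j \<in> {1..2 ^ s j}" if "j \<in> {1..n}" for j
    proof (cases "j \<le> k")
      case True
      then show ?thesis using PiE_mem[OF \<alpha>[unfolded configs_def] that] that by (simp add: eq s_def)
    next
      case False
      then show ?thesis using PiE_mem[OF b that] by simp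
    qed
    then have "\<beta> \<in> configs \<gamma> N n" using b by (auto simp: configs_def PiE_iff s_def)
    then show "\<beta> \<in> {\<beta> \<in> configs \<gamma> N n. restrict \<beta> {1..k} = restrict \<alpha> {1..k}}"
      using eq by (auto simp: restrict_def fun_eq_iff)
  qed
  then have "real (card {\<beta> \<in> configs \<gamma> N n. restrict \<beta> {1..k} = restrict \<alpha> {1..k}})
    = (\<Prod>j=1..n. if j \<le> k then 1 else exp (real N * (\<gamma> j * ln 2)))"
  proof -
    have "real (2 ^ s j) = exp (real N * (\<gamma> j * ln 2))" if "j \<in> {1..n}" for j
    proof -
      have "real (2 ^ s j) = exp (real (s j) * ln 2)" by (simp add: exp_of_nat_mult)
      then show ?thesis by (simp add: s[OF that] mult_ac)
    qed
    moreover assume "{\<beta> \<in> configs \<gamma> N n. restrict \<beta> {1..k} = restrict \<alpha> {1..k}}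
      = PiE {1..n} (\<lambda>j. if j \<le> k then {\<alpha> j} else {1..2 ^ s j})"
    ultimately show ?thesis
      by (simp add: card_PiE) (rule prod.cong, auto)
  qed
  also have "\<dots> = exp (\<Sum>j=1..n. if j \<le> k then 0 else real N * (\<gamma> j * ln 2))"
    by (subst exp_sum) (auto intro!: prod.cong)
  also have "(\<Sum>j=1..n. if j \<le> k then 0 else real N * (\<gamma> j * ln 2))
    = (\<Sum>j=1..n. real N * (\<gamma> j * ln 2)) - (\<Sum>j=1..n. if j \<le> k then real N * (\<gamma> j * ln 2) else 0)"
    by (subst sum_subtractf[symmetric]) (auto intro!: sum.cong)
  also have "(\<Sum>j=1..n. if j \<le> k then real N * (\<gamma> j * ln 2) else 0) = (\<Sum>j=1..k. real N * (\<gamma> j * ln 2))"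
    using k by (intro sum.mono_neutral_cong_right) auto
  also have "(\<Sum>j=1..n. real N * (\<gamma> j * ln 2)) - (\<Sum>j=1..k. real N * (\<gamma> j * ln 2))
     = real N * (ln 2 - (\<Sum>j=1..k. \<gamma> j) * ln 2)"
    unfolding sum_distrib_left[symmetric] sum_distrib_right[symmetric] sum1 by (simp add: algebra_simps)
  finally show ?thesis .
qed

section \<open>The law of the environment and the moments of the prefix weights\<close>

context product_law
begin

text \<open>All variables of one size N as a single random point of a finite product. The estimates
  for fixed N are made under this law, and \<open>env_distr\<close> transfers them to the given
  probability space.\<close>

definition env_law :: "(nat \<Rightarrow> real) \<Rightarrow> nat \<Rightarrow> (nat \<times> (nat \<Rightarrow> nat) \<times> nat \<Rightarrow> 's) measure" where
  "env_law \<gamma> N = PiM (env_index n \<gamma> N) (\<lambda>p. \<mu> (fst p))"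

definition env_vec :: "(nat \<Rightarrow> nat) \<Rightarrow> nat \<Rightarrow> (nat \<times> (nat \<Rightarrow> nat) \<times> nat \<Rightarrow> 's) \<Rightarrow> nat \<Rightarrow> 's" where
  "env_vec \<alpha> i w = (\<lambda>j\<in>{1..n}. w (j, restrict \<alpha> {1..j}, i))"

lemma env_vec_space: "env_vec \<alpha> i w \<in> space M"
  by (auto simp: env_vec_def space_M)

text \<open>This and the next two lemmas record which variable influences which vector: a change at
  (j, beta, i') reaches \<open>env_vec \<alpha> i\<close> only if i' = i and beta is the prefix of
  \<alpha> of length j, and then it changes coordinate j alone.\<close>

lemma env_vec_upd:
  "j \<in> {1..n} \<Longrightarrow> env_vec \<alpha> i (w((j, restrict \<alpha> {1..j}, i) := y)) = (env_vec \<alpha> i w)(j := y)"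
  by (auto simp: env_vec_def fun_eq_iff restrict_def)

lemma env_vec_upd_other:
  "restrict \<alpha> {1..j} \<noteq> \<beta> \<or> i \<noteq> i' \<Longrightarrow> env_vec \<alpha> i (w((j, \<beta>, i') := y)) = env_vec \<alpha> i w"
  unfolding env_vec_def by (intro restrict_ext) (metis fun_upd_other Pair_inject)

lemma env_vec_upd_depends:
  "depends_upto k f \<Longrightarrow> k < j \<Longrightarrow> f (env_vec \<alpha> i (w((j, \<beta>, i') := y))) = f (env_vec \<alpha> i w)"
  by (erule depends_uptoD) (auto simp: env_vec_def)

lemma env_vec_prefix:
  "depends_upto k f \<Longrightarrow> restrict \<alpha> {1..k} = restrict \<beta> {1..k} \<Longrightarrow> f (env_vec \<alpha> i w) = f (env_vec \<beta> i w)"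
  by (erule depends_uptoD) (auto simp: env_vec_def dest: restrict_eq_mono)

lemma env_vec_measurable:
  assumes "\<alpha> \<in> configs \<gamma> N n" "i \<in> {1..N}"
  shows "env_vec \<alpha> i \<in> env_law \<gamma> N \<rightarrow>\<^sub>M M"
  unfolding env_vec_def[abs_def] env_law_def
proof (rule measurable_restrict)
  fix j assume "j \<in> {1..n}"
  from measurable_component_singleton[OF env_indexI[OF assms(1) this assms(2)], of "\<lambda>p. \<mu> (fst p)"]
  show "(\<lambda>w. w (j, restrict \<alpha> {1..j}, i)) \<in> PiM (env_index n \<gamma> N) (\<lambda>p. \<mu> (fst p)) \<rightarrow>\<^sub>M \<mu> j" by simp
qed

lemma product_prob_space_env: "product_prob_space (\<lambda>p. \<mu> (fst p))"
  unfolding product_prob_space_def product_sigma_finite_def product_prob_space_axioms_def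
  using prob_factor prob_space_imp_sigma_finite by blast

lemma prob_space_env: "prob_space (env_law \<gamma> N)"
  unfolding env_law_def by (intro prob_space_PiM prob_factor)

definition prefix_weight :: "((nat \<Rightarrow> 's) \<Rightarrow> real) \<Rightarrow> nat \<Rightarrow> (nat \<Rightarrow> nat) \<Rightarrow> (nat \<times> (nat \<Rightarrow> nat) \<times> nat \<Rightarrow> 's) \<Rightarrow> real" where
  "prefix_weight g N \<alpha> w = (\<Prod>i=1..N. g (env_vec \<alpha> i w))"

context
  fixes \<gamma> :: "nat \<Rightarrow> real" and N :: nat
begin

lemma env_measurable [measurable]:
  assumes "\<alpha> \<in> configs \<gamma> N n" "i \<in> {1..N}" "q \<in> borel_measurable M"
  shows "(\<lambda>w. q (env_vec \<alpha> i w)) \<in> borel_measurable (env_law \<gamma> N)"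
  by (rule measurable_compose[OF env_vec_measurable[OF assms(1,2)] assms(3)])

text \<open>The level-j variables on the branch of \<alpha> are distinct for distinct i, so each can
  be averaged separately. \<open>G\<close> is arbitrary in the induction because the factors already
  averaged are moved into it; the factor for time a does not react to resampling at other
  times.\<close>

lemma resample_product:
  assumes \<alpha>: "\<alpha> \<in> configs \<gamma> N n" and j: "j \<in> {1..n}" and q: "q \<in> borel_measurable M"
    and A: "A \<subseteq> {1..N}" and G: "G \<in> borel_measurable (env_law \<gamma> N)"
    and indep: "\<And>w y i. i \<in> A \<Longrightarrow> G (w((j, restrict \<alpha> {1..j}, i) := y)) = G w"
  shows "(\<integral>\<^sup>+w. G w * (\<Prod>i\<in>A. q (env_vec \<alpha> i w)) \<partial>env_law \<gamma> N)
    = (\<integral>\<^sup>+w. G w * (\<Prod>i\<in>A. \<integral>\<^sup>+y. q ((env_vec \<alpha> i w)(j := y)) \<partial>\<mu> j) \<partial>env_law \<gamma> N)"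
proof -
  have "finite A" using A finite_subset by blast
  then show ?thesis using A G indep
  proof (induction A arbitrary: G)
    case (insert a A)
    let ?T = "\<lambda>i w. \<integral>\<^sup>+y. q ((env_vec \<alpha> i w)(j := y)) \<partial>\<mu> j"
    let ?p = "(j, restrict \<alpha> {1..j}, a)"
    have a: "a \<in> {1..N}" and A: "A \<subseteq> {1..N}" using insert by auto
    note [measurable] = insert.prems(2)
    have mq: "(\<lambda>w. q (env_vec \<alpha> i w)) \<in> borel_measurable (env_law \<gamma> N)" if "i \<in> {1..N}" for i
      using env_measurable[OF \<alpha> that q] .
    have mT: "?T a \<in> borel_measurable (env_law \<gamma> N)"
      by (rule env_measurable[OF \<alpha> a measurable_upd_nn_integral[OF j q]])
    have mA: "(\<lambda>w. \<Prod>i\<in>A. q (env_vec \<alpha> i w)) \<in> borel_measurable (env_law \<gamma> N)"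
      using mq A by (intro borel_measurable_prod_ennreal) auto
    have "(\<integral>\<^sup>+w. G w * (\<Prod>i\<in>insert a A. q (env_vec \<alpha> i w)) \<partial>env_law \<gamma> N)
      = (\<integral>\<^sup>+w. G w * (\<Prod>i\<in>A. q (env_vec \<alpha> i w)) * q (env_vec \<alpha> a w) \<partial>env_law \<gamma> N)"
      using insert by (simp add: mult_ac)
    also have "\<dots> = (\<integral>\<^sup>+w. \<integral>\<^sup>+y. G (w(?p := y)) * (\<Prod>i\<in>A. q (env_vec \<alpha> i (w(?p := y)))) * q (env_vec \<alpha> a (w(?p := y))) \<partial>\<mu> j \<partial>env_law \<gamma> N)"
      using product_prob_space.nn_integral_resample[OF product_prob_space_env finite_env_index env_indexI[OF \<alpha> j a],
          of "\<lambda>w. G w * (\<Prod>i\<in>A. q (env_vec \<alpha> i w)) * q (env_vec \<alpha> a w)"]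
        insert.prems(2) mA mq[OF a] by (simp add: env_law_def[symmetric])
    also have "\<dots> = (\<integral>\<^sup>+w. G w * (\<Prod>i\<in>A. q (env_vec \<alpha> i w)) * ?T a w \<partial>env_law \<gamma> N)"
    proof (rule nn_integral_cong)
      fix w
      have "(\<integral>\<^sup>+y. G (w(?p := y)) * (\<Prod>i\<in>A. q (env_vec \<alpha> i (w(?p := y)))) * q (env_vec \<alpha> a (w(?p := y))) \<partial>\<mu> j)
        = (\<integral>\<^sup>+y. G w * (\<Prod>i\<in>A. q (env_vec \<alpha> i w)) * q ((env_vec \<alpha> a w)(j := y)) \<partial>\<mu> j)"
      proof (intro nn_integral_cong arg_cong2[where f="(*)"] prod.cong refl)
        fix y i assume "i \<in> A"
        then have "i \<noteq> a" using insert by auto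
        then show "q (env_vec \<alpha> i (w(?p := y))) = q (env_vec \<alpha> i w)" by (simp add: env_vec_upd_other)
      qed (simp_all add: env_vec_upd[OF j] insert.prems(3))
      also have "\<dots> = G w * (\<Prod>i\<in>A. q (env_vec \<alpha> i w)) * ?T a w"
        by (rule nn_integral_cmult, rule measurable_compose[OF measurable_upd_slice[OF j env_vec_space] q])
      finally show "(\<integral>\<^sup>+y. G (w(?p := y)) * (\<Prod>i\<in>A. q (env_vec \<alpha> i (w(?p := y)))) * q (env_vec \<alpha> a (w(?p := y))) \<partial>\<mu> j)
        = G w * (\<Prod>i\<in>A. q (env_vec \<alpha> i w)) * ?T a w" .
    qed
    also have "\<dots> = (\<integral>\<^sup>+w. (G w * ?T a w) * (\<Prod>i\<in>A. q (env_vec \<alpha> i w)) \<partial>env_law \<gamma> N)"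
      by (simp add: mult_ac)
    also have "\<dots> = (\<integral>\<^sup>+w. (G w * ?T a w) * (\<Prod>i\<in>A. ?T i w) \<partial>env_law \<gamma> N)"
    proof (rule insert.IH[OF A])
      show "(\<lambda>w. G w * ?T a w) \<in> borel_measurable (env_law \<gamma> N)" using mT insert.prems(2) by simp
      fix w y i assume "i \<in> A"
      then have "i \<noteq> a" using insert by auto
      then show "G (w((j, restrict \<alpha> {1..j}, i) := y)) * ?T a (w((j, restrict \<alpha> {1..j}, i) := y)) = G w * ?T a w"
        using \<open>i \<in> A\<close> by (simp only: insert.prems(3)[OF insertI2] env_vec_upd_other[OF disjI2])
    qed
    finally show ?case by (simp only: prod.insert[OF insert.hyps(1,2)] mult.assoc)
  qed simp
qed

lemma prefix_weight_measurable:
  "\<alpha> \<in> configs \<gamma> N n \<Longrightarrow> g \<in> borel_measurable M \<Longrightarrow> prefix_weight g N \<alpha> \<in> borel_measurable (env_law \<gamma> N)"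
  unfolding prefix_weight_def[abs_def] by (intro borel_measurable_prod env_measurable) auto

lemma flow_weight_pos: "density_flow f \<Longrightarrow> k \<le> n \<Longrightarrow> 0 < prefix_weight (f k) N \<alpha> w"
  unfolding prefix_weight_def by (auto intro!: prod_pos density_flow_pos env_vec_space)

text \<open>The counterpart of \<open>density_flow_tower\<close> on the tree: at each level the N
  variables on the branch of \<alpha> are averaged together. The condition on \<open>G\<close> says
  that it does not look at them.\<close>

lemma flow_weight_tower:
  assumes f: "density_flow f" and \<alpha>: "\<alpha> \<in> configs \<gamma> N n" and km: "k \<le> m" "m \<le> n"
    and G: "G \<in> borel_measurable (env_law \<gamma> N)"
    and indep: "\<And>w y i j. k < j \<Longrightarrow> j \<le> m \<Longrightarrow> G (w((j, restrict \<alpha> {1..j}, i) := y)) = G w"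
  shows "(\<integral>\<^sup>+w. G w * ennreal (prefix_weight (f m) N \<alpha> w) \<partial>env_law \<gamma> N)
    = (\<integral>\<^sup>+w. G w * ennreal (prefix_weight (f k) N \<alpha> w) \<partial>env_law \<gamma> N)"
  using km indep
proof (induction m rule: dec_induct)
  case (step m)
  have pw: "ennreal (prefix_weight (f j) N \<alpha> w) = (\<Prod>i=1..N. ennreal (f j (env_vec \<alpha> i w)))" if "j \<le> n" for j w
    unfolding prefix_weight_def using density_flow_pos[OF f that env_vec_space]
    by (intro prod_ennreal[symmetric]) (auto intro: less_imp_le)
  have j: "Suc m \<in> {1..n}" using step by auto
  have "(\<integral>\<^sup>+w. G w * ennreal (prefix_weight (f (Suc m)) N \<alpha> w) \<partial>env_law \<gamma> N)
    = (\<integral>\<^sup>+w. G w * (\<Prod>i=1..N. \<integral>\<^sup>+y. ennreal (f (Suc m) ((env_vec \<alpha> i w)(Suc m := y))) \<partial>\<mu> (Suc m)) \<partial>env_law \<gamma> N)"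
    unfolding pw[OF step.prems(1)]
  proof (rule resample_product[OF \<alpha> j _ order.refl G])
    show "(\<lambda>x. ennreal (f (Suc m) x)) \<in> borel_measurable M"
      using density_flow_measurable[OF f step.prems(1)] by simp
    show "G (w((Suc m, restrict \<alpha> {1..Suc m}, i) := y)) = G w" for w y i
      by (rule step.prems(2)) (use step.hyps in auto)
  qed
  also have "\<dots> = (\<integral>\<^sup>+w. G w * ennreal (prefix_weight (f m) N \<alpha> w) \<partial>env_law \<gamma> N)"
    using step.prems(1) by (simp add: density_flow_step_nn[OF f j env_vec_space] pw)
  also have "\<dots> = (\<integral>\<^sup>+w. G w * ennreal (prefix_weight (f k) N \<alpha> w) \<partial>env_law \<gamma> N)"
    by (rule step.IH) (use step.prems in auto)
  finally show ?case .
qed simp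

lemma flow_weight_integral:
  assumes f: "density_flow f" and \<alpha>: "\<alpha> \<in> configs \<gamma> N n" and k: "k \<le> n"
  shows "(\<integral>\<^sup>+w. ennreal (prefix_weight (f k) N \<alpha> w) \<partial>env_law \<gamma> N) = 1"
  using flow_weight_tower[OF f \<alpha> le0 k, of "\<lambda>_. 1"] prob_space.emeasure_space_1[OF prob_space_env]
  by (simp add: prefix_weight_def density_flow_0[OF f])

text \<open>In the truncated square of the common weight, one factor is at most \<open>c\<close> and
  the other has mean one. The hypothesis on longer prefixes says that above level k the two branches
  have no variable in common. Each overlap uses its own truncation level, so the truncation has to
  hold at all levels.\<close>

lemma flow_weight_overlap:
  assumes f: "density_flow f" and \<alpha>: "\<alpha> \<in> configs \<gamma> N n" and \<beta>: "\<beta> \<in> configs \<gamma> N n" and k: "k \<le> n"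
    and eq: "restrict \<alpha> {1..k} = restrict \<beta> {1..k}"
    and neq: "\<And>j. k < j \<Longrightarrow> j \<le> n \<Longrightarrow> restrict \<alpha> {1..j} \<noteq> restrict \<beta> {1..j}"
  shows "(\<integral>\<^sup>+w. (if prefix_weight (f k) N \<alpha> w \<le> c then 1 else 0) * ennreal (prefix_weight (f n) N \<alpha> w)
      * ennreal (prefix_weight (f n) N \<beta> w) \<partial>env_law \<gamma> N) \<le> ennreal c"
proof -
  let ?I = "\<lambda>w. if prefix_weight (f k) N \<alpha> w \<le> c then 1 else 0 :: ennreal"
  let ?W = "\<lambda>k \<alpha> w. ennreal (prefix_weight (f k) N \<alpha> w)"
  have mW: "?W j \<alpha> \<in> borel_measurable (env_law \<gamma> N)" if "\<alpha> \<in> configs \<gamma> N n" "j \<le> n" for \<alpha> j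
    using prefix_weight_measurable[OF that(1) density_flow_measurable[OF f that(2)]] by simp
  have mI: "?I \<in> borel_measurable (env_law \<gamma> N)"
    using prefix_weight_measurable[OF \<alpha> density_flow_measurable[OF f k]] by simp
  have dep: "prefix_weight (f k) N \<alpha> (w((j, \<sigma>, i) := y)) = prefix_weight (f k) N \<alpha> w" if "k < j" for j \<sigma> i y w
    unfolding prefix_weight_def using env_vec_upd_depends[OF density_flow_depends[OF f k] that] by simp
  have same: "prefix_weight (f k) N \<beta> w = prefix_weight (f k) N \<alpha> w" for w
    unfolding prefix_weight_def using env_vec_prefix[OF density_flow_depends[OF f k] eq] by simp
  txt \<open>Integrating out the levels above \<open>k\<close>, first of \<open>\<beta>\<close> and then of \<open>\<alpha>\<close>, leaves the truncated square
    of the common prefix weight.\<close>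
  have "(\<integral>\<^sup>+w. ?I w * ?W n \<alpha> w * ?W n \<beta> w \<partial>env_law \<gamma> N) = (\<integral>\<^sup>+w. ?I w * ?W n \<alpha> w * ?W k \<beta> w \<partial>env_law \<gamma> N)"
  proof (rule flow_weight_tower[OF f \<beta> k order.refl])
    show "(\<lambda>w. ?I w * ?W n \<alpha> w) \<in> borel_measurable (env_law \<gamma> N)" using mI mW[OF \<alpha>] by simp
    fix w y i j assume j: "k < j" "j \<le> n"
    have "prefix_weight (f n) N \<alpha> (w((j, restrict \<beta> {1..j}, i) := y)) = prefix_weight (f n) N \<alpha> w"
      unfolding prefix_weight_def using neq[OF j] by (simp add: env_vec_upd_other)
    then show "?I (w((j, restrict \<beta> {1..j}, i) := y)) * ?W n \<alpha> (w((j, restrict \<beta> {1..j}, i) := y)) = ?I w * ?W n \<alpha> w"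
      using dep[OF j(1)] by simp
  qed
  also have "\<dots> = (\<integral>\<^sup>+w. ?I w * ?W k \<alpha> w * ?W n \<alpha> w \<partial>env_law \<gamma> N)"
    by (simp add: same mult_ac)
  also have "\<dots> = (\<integral>\<^sup>+w. ?I w * ?W k \<alpha> w * ?W k \<alpha> w \<partial>env_law \<gamma> N)"
    by (rule flow_weight_tower[OF f \<alpha> k order.refl]) (use mI mW[OF \<alpha> k] dep in auto)
  also have "\<dots> \<le> (\<integral>\<^sup>+w. ennreal c * ?W k \<alpha> w \<partial>env_law \<gamma> N)"
    by (intro nn_integral_mono mult_right_mono) (auto intro: ennreal_leI)
  also have "\<dots> = ennreal c"
    using flow_weight_integral[OF f \<alpha> k] mW[OF \<alpha> k] by (simp add: nn_integral_cmult)
  finally show ?thesis .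
qed

text \<open>Along one configuration the vectors for i = 1, ..., N are independent with law
  \<open>M\<close>. Both integrals are kept unchanged while \<open>q\<close> is averaged over
  coordinates n, ..., 1; what remains is a constant, for which the claim is trivial.\<close>

lemma nn_integral_env_iid:
  assumes \<alpha>: "\<alpha> \<in> configs \<gamma> N n" and q: "q \<in> borel_measurable M" and dep: "depends_upto n q"
  shows "(\<integral>\<^sup>+w. (\<Prod>i=1..N. q (env_vec \<alpha> i w)) \<partial>env_law \<gamma> N) = (\<integral>\<^sup>+x. q x \<partial>M) ^ N"
proof -
  have "\<exists>r \<in> borel_measurable M. depends_upto j r \<and> (\<integral>\<^sup>+x. r x \<partial>M) = (\<integral>\<^sup>+x. q x \<partial>M) \<and>
      (\<integral>\<^sup>+w. (\<Prod>i=1..N. r (env_vec \<alpha> i w)) \<partial>env_law \<gamma> N) = (\<integral>\<^sup>+w. (\<Prod>i=1..N. q (env_vec \<alpha> i w)) \<partial>env_law \<gamma> N)"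
    if "j \<le> n" for j
    using that
  proof (induction j rule: down_induct)
    case top
    then show ?case using q dep by blast
  next
    case (step j)
    then obtain r where r: "r \<in> borel_measurable M" "depends_upto j r" "(\<integral>\<^sup>+x. r x \<partial>M) = (\<integral>\<^sup>+x. q x \<partial>M)"
      "(\<integral>\<^sup>+w. (\<Prod>i=1..N. r (env_vec \<alpha> i w)) \<partial>env_law \<gamma> N) = (\<integral>\<^sup>+w. (\<Prod>i=1..N. q (env_vec \<alpha> i w)) \<partial>env_law \<gamma> N)"
      by blast
    let ?r = "\<lambda>x. \<integral>\<^sup>+y. r (x(j := y)) \<partial>\<mu> j"
    have "depends_upto (j - 1) ?r"
      unfolding depends_upto_def
    proof (intro allI impI nn_integral_cong depends_uptoD[OF r(2)])
      fix x y :: "nat \<Rightarrow> 's" and z i assume *: "\<forall>i\<in>{1..j - 1}. x i = y i" and "i \<in> {1..j}"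
      then have "i = j \<or> i \<in> {1..j - 1}" by auto
      then show "(x(j := z)) i = (y(j := z)) i" using * by auto
    qed
    moreover have "(\<integral>\<^sup>+x. ?r x \<partial>M) = (\<integral>\<^sup>+x. q x \<partial>M)"
      using L.nn_integral_resample[OF _ step(1) r(1)] r(3) by simp
    moreover have "(\<integral>\<^sup>+w. (\<Prod>i=1..N. ?r (env_vec \<alpha> i w)) \<partial>env_law \<gamma> N) = (\<integral>\<^sup>+w. (\<Prod>i=1..N. q (env_vec \<alpha> i w)) \<partial>env_law \<gamma> N)"
      using resample_product[OF \<alpha> step(1) r(1) order.refl, of "\<lambda>_. 1"] r(4) by simp
    ultimately show ?case using measurable_upd_nn_integral[OF step(1) r(1)] by blast
  qed
  from this[of 0] obtain r where r: "r \<in> borel_measurable M" "depends_upto 0 r" "(\<integral>\<^sup>+x. r x \<partial>M) = (\<integral>\<^sup>+x. q x \<partial>M)"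
      "(\<integral>\<^sup>+w. (\<Prod>i=1..N. r (env_vec \<alpha> i w)) \<partial>env_law \<gamma> N) = (\<integral>\<^sup>+w. (\<Prod>i=1..N. q (env_vec \<alpha> i w)) \<partial>env_law \<gamma> N)"
    by auto
  have const: "r x = r undefined" for x using r(2) by (rule depends_uptoD) auto
  have "(\<integral>\<^sup>+x. r x \<partial>M) = r undefined"
    by (subst const) (simp add: L.P.emeasure_space_1)
  moreover have "(\<integral>\<^sup>+w. (\<Prod>i=1..N. r (env_vec \<alpha> i w)) \<partial>env_law \<gamma> N) = r undefined ^ N"
    by (subst const) (simp add: prob_space.emeasure_space_1[OF prob_space_env])
  ultimately show ?thesis using r by simp
qed

end

end

section \<open>Exponential estimates\<close>

text \<open>This turns a mean and a bound into an estimate of an exponential moment. For t = - u < 0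
  it follows from exp u >= 1 + u + u^2 / 2, because the product of this polynomial with 1 - u + u^2
  is at least 1.\<close>

lemma exp_le_quadratic:
  fixes t :: real
  assumes "t \<le> 1"
  shows "exp t \<le> 1 + t + t\<^sup>2"
proof (cases "0 \<le> t")
  case True
  then show ?thesis using assms by (simp add: exp_bound)
next
  case False
  define u where "u = - t"
  have u: "u > 0" using False by (simp add: u_def)
  have "1 \<le> (1 - u + u\<^sup>2) * (1 + u + u\<^sup>2 / 2)"
  proof -
    have "(1 - u + u\<^sup>2) * (1 + u + u\<^sup>2 / 2) = 1 + u\<^sup>2 / 2 + u ^ 3 / 2 + u ^ 4 / 2"
      by (simp add: field_simps power2_eq_square power3_eq_cube power4_eq_xxxx)
    then show ?thesis using u by simp
  qed
  also have "\<dots> \<le> (1 - u + u\<^sup>2) * exp u"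
  proof (rule mult_left_mono)
    show "1 + u + u\<^sup>2 / 2 \<le> exp u" using u by (intro exp_lower_Taylor_quadratic) simp
    have "0 \<le> (1 - u)\<^sup>2 + u" using u by (intro add_nonneg_nonneg) auto
    then show "0 \<le> 1 - u + u\<^sup>2" using u by (simp add: power2_eq_square algebra_simps)
  qed
  finally show ?thesis by (simp add: u_def exp_minus field_simps)
qed

text \<open>Convexity of x ln x between a and 1, where it vanishes at 1; the two tangent
  inequalities at the mixture b are combined with weights 1 - d and d.\<close>

lemma convex_xlnx_mix:
  fixes a d :: real
  assumes a: "0 < a" and d: "0 < d" "d < 1"
  shows "((1 - d) * a + d) * ln ((1 - d) * a + d) \<le> (1 - d) * (a * ln a)"
proof -
  define b where "b = (1 - d) * a + d"
  have b: "b > 0" using a d by (auto simp: b_def intro!: add_nonneg_pos mult_nonneg_nonneg)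
  have "a * (ln b - ln a) \<le> b - a"
  proof -
    have "a * ln (b / a) \<le> a * (b / a - 1)" using a b by (intro mult_left_mono ln_le_minus_one) auto
    then show ?thesis using a b by (simp add: ln_div right_diff_distrib)
  qed
  then have "(1 - d) * (a * ln b - (b - a)) \<le> (1 - d) * (a * ln a)"
    using d by (intro mult_left_mono) (auto simp: algebra_simps)
  moreover have "d * ln b \<le> d * (b - 1)"
    using d ln_le_minus_one[OF b] by (intro mult_left_mono) auto
  moreover have "b * ln b = (1 - d) * (a * ln b - (b - a)) + d * ln b - d * (b - 1)"
    by (simp add: b_def algebra_simps)
  ultimately show ?thesis unfolding b_def[symmetric] by linarith
qed

context product_law
begin

text \<open>Under the law tilted by the weight of \<alpha>, the vectors along \<alpha> are
  independent with density \<open>f n\<close>, and the mean of \<open>g\<close> is m. The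
  exponential Markov inequality gives a rate \<rho> that is uniform in N and \<alpha>.\<close>

lemma flow_chernoff:
  assumes f: "density_flow f" and g: "g \<in> borel_measurable M" "depends_upto n g"
    "\<And>x. x \<in> space M \<Longrightarrow> \<bar>g x\<bar> \<le> K"
    and m: "m = (\<integral>x. f n x * g x \<partial>M)" and \<epsilon>: "\<epsilon> > 0"
  obtains \<rho> where "0 \<le> \<rho>" "\<rho> < 1"
    "\<And>\<gamma> N \<alpha>. \<alpha> \<in> configs \<gamma> N n \<Longrightarrow>
      (\<integral>\<^sup>+w. (if real N * (m + \<epsilon>) \<le> (\<Sum>i=1..N. g (env_vec \<alpha> i w)) then 1 else 0)
          * ennreal (prefix_weight (f n) N \<alpha> w) \<partial>env_law \<gamma> N) \<le> ennreal (\<rho> ^ N)"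
proof -
  define t where "t x = g x - (m + \<epsilon>)" for x
  define K1 where "K1 = \<bar>K\<bar> + \<bar>m + \<epsilon>\<bar> + 1"
  have K1: "K1 > 0" by (simp add: K1_def add_nonneg_pos)
  have tK: "\<bar>t x\<bar> \<le> K1" if "x \<in> space M" for x
    using g(3)[OF that] unfolding t_def K1_def by linarith
  \<comment> \<open>The first bound makes \<open>s * t x\<close> at most 1, as the quadratic
    estimate requires. The second lets the quadratic term cost at most s \<epsilon> / 2, half of the
    drift - s \<epsilon> of \<open>s * t x\<close>, so that \<rho> <= 1 - s \<epsilon> / 2.\<close>
  define s where "s = min (1 / K1) (\<epsilon> / (2 * K1\<^sup>2))"
  have s: "s > 0" "s * K1 \<le> 1" "s * K1\<^sup>2 \<le> \<epsilon> / 2"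
  proof -
    show "s > 0" using K1 \<epsilon> by (simp add: s_def)
    have "s * K1 \<le> 1 / K1 * K1" using K1 by (intro mult_right_mono) (auto simp: s_def)
    then show "s * K1 \<le> 1" using K1 by simp
    have "s * K1\<^sup>2 \<le> \<epsilon> / (2 * K1\<^sup>2) * K1\<^sup>2" by (intro mult_right_mono) (auto simp: s_def)
    then show "s * K1\<^sup>2 \<le> \<epsilon> / 2" using K1 by simp
  qed
  note fm = density_flow_measurable[OF f order.refl]
  have mt: "t \<in> borel_measurable M" unfolding t_def[abs_def] using g(1) by simp
  have et: "exp (s * t x) \<le> 1 + s * t x + s * (\<epsilon> / 2)" if "x \<in> space M" for x
  proof -
    have "s * t x \<le> s * K1" using tK[OF that] s(1) by (intro mult_left_mono) auto
    then have "exp (s * t x) \<le> 1 + s * t x + (s * t x)\<^sup>2" using s(2) by (intro exp_le_quadratic) simp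
    also have "(s * t x)\<^sup>2 \<le> s * (s * K1\<^sup>2)"
    proof -
      have "(t x)\<^sup>2 \<le> K1\<^sup>2" using tK[OF that] K1 by (intro abs_le_square_iff[THEN iffD1]) simp
      then have "s * (s * (t x)\<^sup>2) \<le> s * (s * K1\<^sup>2)" using s(1) by (intro mult_left_mono) auto
      then show ?thesis by (simp add: power2_eq_square mult_ac)
    qed
    also have "s * (s * K1\<^sup>2) \<le> s * (\<epsilon> / 2)" using s by (intro mult_left_mono) auto
    finally show ?thesis by simp
  qed
  define q where "q x = f n x * exp (s * t x)" for x
  have mq: "q \<in> borel_measurable M" unfolding q_def[abs_def] using fm mt by simp
  have q0: "0 \<le> q x" if "x \<in> space M" for x
    using density_flow_pos[OF f order.refl that] by (simp add: q_def)
  have iq: "integrable M q"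
    unfolding q_def[abs_def]
  proof (rule integrable_flow[OF f order.refl, of _ "exp 1"])
    show "(\<lambda>x. exp (s * t x)) \<in> borel_measurable M" using mt by simp
    fix x assume "x \<in> space M"
    then have "s * t x \<le> s * K1" using tK[of x] s(1) by (intro mult_left_mono) auto
    then show "\<bar>exp (s * t x)\<bar> \<le> exp 1" using s(2) by simp
  qed
  define \<rho> where "\<rho> = (\<integral>x. q x \<partial>M)"
  have ig: "integrable M (\<lambda>x. f n x * g x)"
    by (rule integrable_flow[OF f order.refl g(1,3)])
  note fi = density_flow_integral[OF f order.refl]
  have "\<rho> \<le> (\<integral>x. f n x * (1 + s * t x + s * (\<epsilon> / 2)) \<partial>M)"
    unfolding \<rho>_def
  proof (rule integral_mono[OF iq])
    show "integrable M (\<lambda>x. f n x * (1 + s * t x + s * (\<epsilon> / 2)))"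
      by (rule integrable_flow[OF f order.refl, of _ "1 + s * K1 + s * (\<epsilon> / 2)"])
         (use mt tK s \<epsilon> in \<open>auto simp: abs_mult intro!: order.trans[OF abs_triangle_ineq] add_mono mult_left_mono\<close>)
    show "q x \<le> f n x * (1 + s * t x + s * (\<epsilon> / 2))" if "x \<in> space M" for x
      unfolding q_def using et[OF that] density_flow_pos[OF f order.refl that] by (intro mult_left_mono) auto
  qed
  also have "\<dots> = (\<integral>x. (1 - s * (m + \<epsilon>) + s * (\<epsilon> / 2)) * f n x + s * (f n x * g x) \<partial>M)"
    by (rule Bochner_Integration.integral_cong) (auto simp: t_def algebra_simps)
  also have "\<dots> = (1 - s * (m + \<epsilon>) + s * (\<epsilon> / 2)) + s * m"
    using fi ig by (simp add: m)
  also have "\<dots> = 1 - s * (\<epsilon> / 2)" by (simp add: algebra_simps)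
  also have "\<dots> < 1" using s \<epsilon> by simp
  finally have \<rho>1: "\<rho> < 1" .
  have \<rho>0: "0 \<le> \<rho>" unfolding \<rho>_def using q0 by (intro integral_nonneg_AE AE_I2)
  have dq: "depends_upto n q"
    using density_flow_depends[OF f order.refl] g(2)
    unfolding q_def t_def depends_upto_def by metis
  show ?thesis
  proof (rule that[OF \<rho>0 \<rho>1])
    fix \<gamma> N \<alpha> assume \<alpha>: "\<alpha> \<in> configs \<gamma> N n"
    have "(\<integral>\<^sup>+w. (if real N * (m + \<epsilon>) \<le> (\<Sum>i=1..N. g (env_vec \<alpha> i w)) then 1 else 0)
          * ennreal (prefix_weight (f n) N \<alpha> w) \<partial>env_law \<gamma> N)
      \<le> (\<integral>\<^sup>+w. (\<Prod>i=1..N. ennreal (q (env_vec \<alpha> i w))) \<partial>env_law \<gamma> N)"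
    proof (rule nn_integral_mono)
      fix w
      have P: "(\<Prod>i=1..N. q (env_vec \<alpha> i w)) = prefix_weight (f n) N \<alpha> w * exp (s * ((\<Sum>i=1..N. g (env_vec \<alpha> i w)) - real N * (m + \<epsilon>)))"
        unfolding q_def prefix_weight_def t_def
        by (simp add: prod.distrib exp_sum[symmetric] sum_distrib_left[symmetric] sum_subtractf)
      have "(if real N * (m + \<epsilon>) \<le> (\<Sum>i=1..N. g (env_vec \<alpha> i w)) then 1 else 0)
          * ennreal (prefix_weight (f n) N \<alpha> w) \<le> ennreal (\<Prod>i=1..N. q (env_vec \<alpha> i w))"
        unfolding P using flow_weight_pos[OF f order.refl, of N \<alpha> w] s(1)
        by (auto intro!: ennreal_leI)
      then show "(if real N * (m + \<epsilon>) \<le> (\<Sum>i=1..N. g (env_vec \<alpha> i w)) then 1 else 0)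
          * ennreal (prefix_weight (f n) N \<alpha> w) \<le> (\<Prod>i=1..N. ennreal (q (env_vec \<alpha> i w)))"
        using q0[OF env_vec_space] by (simp add: prod_ennreal)
    qed
    also have "\<dots> = (\<integral>\<^sup>+x. ennreal (q x) \<partial>M) ^ N"
      by (rule nn_integral_env_iid[OF \<alpha>]) (use mq depends_upto_comp[OF dq] in auto)
    also have "(\<integral>\<^sup>+x. ennreal (q x) \<partial>M) = ennreal \<rho>"
      unfolding \<rho>_def by (rule nn_integral_eq_integral[OF iq]) (use q0 in auto)
    also have "ennreal \<rho> ^ N = ennreal (\<rho> ^ N)" using \<rho>0 by (simp add: ennreal_power)
    finally show "(\<integral>\<^sup>+w. (if real N * (m + \<epsilon>) \<le> (\<Sum>i=1..N. g (env_vec \<alpha> i w)) then 1 else 0)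
          * ennreal (prefix_weight (f n) N \<alpha> w) \<partial>env_law \<gamma> N) \<le> ennreal (\<rho> ^ N)" .
  qed
qed

section \<open>Mixing with the product measure, and the partition sum\<close>

text \<open>The flow of the mixture (1 - d) nu + d mu. Taking marginals is linear and mu has density
  1 at every level, so a single d serves all levels.\<close>

definition mix_flow :: "real \<Rightarrow> (nat \<Rightarrow> (nat \<Rightarrow> 's) \<Rightarrow> real) \<Rightarrow> nat \<Rightarrow> (nat \<Rightarrow> 's) \<Rightarrow> real" where
  "mix_flow d f k x = (1 - d) * f k x + d"

lemma density_flow_mix:
  assumes f: "density_flow f" and d: "0 < d" "d < 1"
  shows "density_flow (mix_flow d f)"
proof -
  obtain K where K: "K > 0" "\<And>k x. k \<le> n \<Longrightarrow> x \<in> space M \<Longrightarrow> f k x \<le> exp K"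
    using density_flow_bounds[OF f] by metis
  have "mix_flow d f k \<in> borel_measurable M" if "k \<le> n" for k
    unfolding mix_flow_def[abs_def] using density_flow_measurable[OF f that] by simp
  moreover have "depends_upto k (mix_flow d f k)" if "k \<le> n" for k
    unfolding mix_flow_def[abs_def] using density_flow_depends[OF f that] by (rule depends_upto_comp)
  moreover have "mix_flow d f 0 x = 1" for x
    by (simp add: mix_flow_def density_flow_0[OF f])
  moreover have "0 < mix_flow d f k x \<and> \<bar>ln (mix_flow d f k x)\<bar> \<le> K + \<bar>ln d\<bar>" if "k \<le> n" "x \<in> space M" for k x
  proof -
    have pos: "0 < f k x" by (rule density_flow_pos[OF f that])
    have ge: "d \<le> mix_flow d f k x" using pos d by (simp add: mix_flow_def)
    have "mix_flow d f k x \<le> (1 - d) * exp K + d * exp K"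
      unfolding mix_flow_def using K d that by (intro add_mono mult_left_mono) auto
    then have le: "mix_flow d f k x \<le> exp K" by (simp add: algebra_simps)
    have "ln d \<le> ln (mix_flow d f k x)" using ge d by (subst ln_le_cancel_iff) auto
    moreover have "ln (mix_flow d f k x) \<le> K" using le ge d by (metis ln_exp ln_le_cancel_iff exp_gt_zero less_le_trans)
    ultimately have "\<bar>ln (mix_flow d f k x)\<bar> \<le> K + \<bar>ln d\<bar>" using K(1) by linarith
    then show ?thesis using ge d by simp
  qed
  moreover have "(\<integral>y. mix_flow d f k (x(k := y)) \<partial>\<mu> k) = mix_flow d f (k - 1) x"
    if k: "k \<in> {1..n}" and x: "x \<in> space M" for k x
  proof -
    have "integrable (\<mu> k) (\<lambda>y. f k (x(k := y)))"
      by (rule integrable_slice[of _ _ _ "exp K"])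
         (use k x K density_flow_pos[OF f] in \<open>auto simp: density_flow_measurable[OF f] less_imp_le\<close>)
    then show ?thesis
      unfolding mix_flow_def by (simp add: density_flow_step[OF f k x] L.M.prob_space)
  qed
  ultimately show ?thesis unfolding density_flow_def by blast
qed

lemma flow_entropy_mix:
  assumes f: "density_flow f" and d: "0 < d" "d < 1" and k: "k \<le> n"
  shows "flow_entropy (mix_flow d f) k \<le> (1 - d) * flow_entropy f k"
proof -
  note mf = density_flow_mix[OF f d]
  have "flow_entropy (mix_flow d f) k \<le> (\<integral>x. (1 - d) * (f k x * ln (f k x)) \<partial>M)"
    unfolding flow_entropy_def
  proof (rule integral_mono)
    show "integrable M (\<lambda>x. mix_flow d f k x * ln (mix_flow d f k x))" by (rule integrable_flow_ln[OF mf k mf k])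
    show "integrable M (\<lambda>x. (1 - d) * (f k x * ln (f k x)))" using integrable_flow_ln[OF f k f k] by simp
    show "mix_flow d f k x * ln (mix_flow d f k x) \<le> (1 - d) * (f k x * ln (f k x))" if "x \<in> space M" for x
      unfolding mix_flow_def by (rule convex_xlnx_mix[OF density_flow_pos[OF f k that] d])
  qed
  then show ?thesis by (simp add: flow_entropy_def)
qed

definition partition_sum :: "(nat \<Rightarrow> real) \<Rightarrow> ((nat \<Rightarrow> 's) \<Rightarrow> real) \<Rightarrow> nat \<Rightarrow> (nat \<times> (nat \<Rightarrow> nat) \<times> nat \<Rightarrow> 's) \<Rightarrow> real" where
  "partition_sum \<gamma> \<Phi> N w = (\<Sum>\<alpha>\<in>configs \<gamma> N n. exp (\<Sum>i=1..N. \<Phi> (env_vec \<alpha> i w)))"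

lemma partition_sum_measurable:
  "\<Phi> \<in> borel_measurable M \<Longrightarrow> partition_sum \<gamma> \<Phi> N \<in> borel_measurable (env_law \<gamma> N)"
  unfolding partition_sum_def[abs_def]
  by (intro borel_measurable_sum measurable_compose[OF _ borel_measurable_exp] env_measurable) auto

lemma ln_prefix_weight:
  assumes f: "density_flow f" and k: "k \<le> n"
  shows "(\<Sum>i=1..N. ln (f k (env_vec \<alpha> i w))) = ln (prefix_weight (f k) N \<alpha> w)"
  unfolding prefix_weight_def
  using density_flow_pos[OF f k env_vec_space] by (intro ln_prod[symmetric]) (simp, metis less_irrefl)

end

section \<open>The upper bound by first moments\<close>

locale tree_law = product_law n \<mu> for n and \<mu> :: "nat \<Rightarrow> 's::polish_space measure" +
  fixes \<gamma> :: "nat \<Rightarrow> real"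
  assumes \<gamma>_pos: "\<And>k. k \<in> {1..n} \<Longrightarrow> 0 < \<gamma> k" and \<gamma>_sum: "(\<Sum>k=1..n. \<gamma> k) = 1"
begin

definition rate :: "nat \<Rightarrow> real" where "rate k = (\<Sum>j=1..k. \<gamma> j) * ln 2"

lemma rate_0: "rate 0 = 0" and rate_top: "rate n = ln 2"
  using \<gamma>_sum by (simp_all add: rate_def)

lemma rate_pos: "k \<in> {1..n} \<Longrightarrow> 0 < rate k"
  unfolding rate_def by (intro mult_pos_pos sum_pos \<gamma>_pos) auto

lemma n_pos: "n \<in> {1..n}"
  using \<gamma>_sum by (cases n) auto

lemma card_prefix:
  "\<alpha> \<in> configs \<gamma> N n \<Longrightarrow> k \<le> n \<Longrightarrow> N \<in> admissible_sizes n \<gamma> \<Longrightarrow>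
    real (card {\<beta> \<in> configs \<gamma> N n. restrict \<beta> {1..k} = restrict \<alpha> {1..k}}) = exp (real N * (ln 2 - rate k))"
  unfolding rate_def by (rule card_configs_prefix[OF _ _ _ \<gamma>_pos \<gamma>_sum])

lemma card_configs:
  assumes N: "N \<in> admissible_sizes n \<gamma>"
  shows "real (card (configs \<gamma> N n)) = exp (real N * ln 2)"
proof -
  have "(\<lambda>j\<in>{1..n}. 1) \<in> configs \<gamma> N n" by (auto simp: configs_def)
  from card_prefix[OF this le0 N] show ?thesis by (simp add: rate_0 restrict_def)
qed

text \<open>The sum runs over all 2^N configurations also for k < n. A prefix of length k is then
  counted 2^((1 - Gamma_k) N) times, so the mean is 2^N and the threshold is the same at every
  level.\<close>

lemma flow_sum_markov:
  assumes f: "density_flow f" and k: "k \<le> n" and N: "N \<in> admissible_sizes n \<gamma>"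
  shows "measure (env_law \<gamma> N) {w \<in> space (env_law \<gamma> N).
      exp (real N * (ln 2 + \<epsilon>)) \<le> (\<Sum>\<alpha>\<in>configs \<gamma> N n. prefix_weight (f k) N \<alpha> w)} \<le> exp (- \<epsilon>) ^ N"
proof -
  interpret E: prob_space "env_law \<gamma> N" by (rule prob_space_env)
  let ?S = "\<lambda>w. \<Sum>\<alpha>\<in>configs \<gamma> N n. prefix_weight (f k) N \<alpha> w"
  let ?B = "{w \<in> space (env_law \<gamma> N). exp (real N * (ln 2 + \<epsilon>)) \<le> ?S w}"
  have mW: "prefix_weight (f k) N \<alpha> \<in> borel_measurable (env_law \<gamma> N)" if "\<alpha> \<in> configs \<gamma> N n" for \<alpha>
    by (rule prefix_weight_measurable[OF that density_flow_measurable[OF f k]])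
  then have [measurable]: "?S \<in> borel_measurable (env_law \<gamma> N)" by (intro borel_measurable_sum)
  have "ennreal (exp (real N * (ln 2 + \<epsilon>))) * emeasure (env_law \<gamma> N) ?B
    = (\<integral>\<^sup>+w. ennreal (exp (real N * (ln 2 + \<epsilon>))) * indicator ?B w \<partial>env_law \<gamma> N)"
    by (subst nn_integral_cmult_indicator) auto
  also have "\<dots> \<le> (\<integral>\<^sup>+w. ennreal (?S w) \<partial>env_law \<gamma> N)"
    by (intro nn_integral_mono) (auto split: split_indicator intro!: ennreal_leI)
  also have "\<dots> = (\<integral>\<^sup>+w. (\<Sum>\<alpha>\<in>configs \<gamma> N n. ennreal (prefix_weight (f k) N \<alpha> w)) \<partial>env_law \<gamma> N)"
    using flow_weight_pos[OF f k] by (intro nn_integral_cong) (auto simp: sum_ennreal less_imp_le)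
  also have "\<dots> = (\<Sum>\<alpha>\<in>configs \<gamma> N n. 1)"
    using mW by (subst nn_integral_sum) (auto simp: flow_weight_integral[OF f _ k])
  also have "\<dots> = ennreal (exp (real N * ln 2))"
    by (simp add: card_configs[OF N, symmetric] ennreal_of_nat_eq_real_of_nat)
  finally have "exp (real N * (ln 2 + \<epsilon>)) * E.prob ?B \<le> exp (real N * ln 2)"
    by (simp add: E.emeasure_eq_measure ennreal_mult[symmetric])
  then have "E.prob ?B \<le> exp (real N * ln 2) / exp (real N * (ln 2 + \<epsilon>))"
    by (simp add: pos_le_divide_eq mult.commute)
  also have "\<dots> = exp (- \<epsilon>) ^ N"
  proof -
    have "real N * ln 2 - real N * (ln 2 + \<epsilon>) = real N * (- \<epsilon>)" by (simp add: algebra_simps)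
    then show ?thesis unfolding exp_diff[symmetric] by (simp only: exp_of_nat_mult)
  qed
  finally show ?thesis .
qed

text \<open>Deterministic on the event that the sums of \<open>flow_sum_markov\<close> are small.
  The terms \<open>l k * ln (f k x)\<close> are bounded configuration by configuration, which uses l
  k >= 0, whereas ln (f n x) is kept as the weight F_n and summed.\<close>

lemma partition_sum_upper:
  assumes f: "density_flow f" and N: "N \<in> admissible_sizes n \<gamma>"
    and l: "\<And>k. k \<in> {1..n} \<Longrightarrow> 0 \<le> l k"
    and eq: "\<And>x. \<Phi> x = c + ln (f n x) + (\<Sum>k=1..n. l k * ln (f k x))"
    and good: "\<And>k. k \<in> {1..n} \<Longrightarrow> (\<Sum>\<alpha>\<in>configs \<gamma> N n. prefix_weight (f k) N \<alpha> w) < exp (real N * (ln 2 + \<epsilon>))"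
  shows "partition_sum \<gamma> \<Phi> N w \<le> exp (real N * (c + (\<Sum>k=1..n. l k * (rate k + \<epsilon>)) + ln 2 + \<epsilon>))"
proof -
  have single: "ln (prefix_weight (f k) N \<alpha> w) \<le> real N * (rate k + \<epsilon>)"
    if \<alpha>: "\<alpha> \<in> configs \<gamma> N n" and k: "k \<in> {1..n}" for \<alpha> k
  proof -
    let ?A = "{\<beta> \<in> configs \<gamma> N n. restrict \<beta> {1..k} = restrict \<alpha> {1..k}}"
    have kn: "k \<le> n" using k by simp
    have same: "prefix_weight (f k) N \<beta> w = prefix_weight (f k) N \<alpha> w" if "\<beta> \<in> ?A" for \<beta>
    proof -
      from that have "restrict \<beta> {1..k} = restrict \<alpha> {1..k}" by blast
      from env_vec_prefix[OF density_flow_depends[OF f kn] this] show ?thesis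
        unfolding prefix_weight_def by (simp only:)
    qed
    \<comment> \<open>All configurations with the same prefix as \<alpha> carry the same weight, so
      the total bounds that weight times their number.\<close>
    have "exp (real N * (ln 2 - rate k)) * prefix_weight (f k) N \<alpha> w = (\<Sum>\<beta>\<in>?A. prefix_weight (f k) N \<beta> w)"
      using card_prefix[OF \<alpha> kn N] by (simp add: same)
    also have "\<dots> \<le> (\<Sum>\<beta>\<in>configs \<gamma> N n. prefix_weight (f k) N \<beta> w)"
      by (intro sum_mono2 finite_configs) (auto intro: less_imp_le flow_weight_pos[OF f kn])
    also have "\<dots> \<le> exp (real N * (ln 2 + \<epsilon>))" using good[OF k] by simp
    finally have "prefix_weight (f k) N \<alpha> w \<le> exp (real N * (ln 2 + \<epsilon>)) / exp (real N * (ln 2 - rate k))"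
      by (simp add: pos_le_divide_eq mult.commute)
    also have "\<dots> = exp (real N * (rate k + \<epsilon>))" by (simp add: exp_diff[symmetric] algebra_simps)
    finally show ?thesis
      using flow_weight_pos[OF f kn] by (metis exp_le_cancel_iff exp_ln)
  qed
  let ?R = "\<Sum>k=1..n. l k * (rate k + \<epsilon>)"
  have "partition_sum \<gamma> \<Phi> N w \<le> (\<Sum>\<alpha>\<in>configs \<gamma> N n. exp (real N * (c + ?R)) * prefix_weight (f n) N \<alpha> w)"
    unfolding partition_sum_def
  proof (rule sum_mono)
    fix \<alpha> assume \<alpha>: "\<alpha> \<in> configs \<gamma> N n"
    have "(\<Sum>i=1..N. \<Phi> (env_vec \<alpha> i w)) = real N * c + ln (prefix_weight (f n) N \<alpha> w)
        + (\<Sum>i=1..N. \<Sum>k=1..n. l k * ln (f k (env_vec \<alpha> i w)))"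
      unfolding eq by (simp add: sum.distrib ln_prefix_weight[OF f order.refl])
    also have "(\<Sum>i=1..N. \<Sum>k=1..n. l k * ln (f k (env_vec \<alpha> i w))) = (\<Sum>k=1..n. l k * ln (prefix_weight (f k) N \<alpha> w))"
      by (subst sum.swap) (auto simp: sum_distrib_left[symmetric] ln_prefix_weight[OF f] intro!: sum.cong)
    also have "\<dots> \<le> (\<Sum>k=1..n. l k * (real N * (rate k + \<epsilon>)))"
      by (intro sum_mono mult_left_mono single[OF \<alpha>] l)
    also have "\<dots> = real N * ?R" by (simp add: sum_distrib_left mult_ac)
    finally have "exp (\<Sum>i=1..N. \<Phi> (env_vec \<alpha> i w)) \<le> exp (real N * (c + ?R) + ln (prefix_weight (f n) N \<alpha> w))"
      by (simp add: distrib_left)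
    also have "\<dots> = exp (real N * (c + ?R)) * prefix_weight (f n) N \<alpha> w"
      using flow_weight_pos[OF f order.refl] by (simp add: exp_add)
    finally show "exp (\<Sum>i=1..N. \<Phi> (env_vec \<alpha> i w)) \<le> exp (real N * (c + ?R)) * prefix_weight (f n) N \<alpha> w" .
  qed
  also have "\<dots> = exp (real N * (c + ?R)) * (\<Sum>\<alpha>\<in>configs \<gamma> N n. prefix_weight (f n) N \<alpha> w)"
    by (simp add: sum_distrib_left)
  also have "\<dots> \<le> exp (real N * (c + ?R)) * exp (real N * (ln 2 + \<epsilon>))"
    using good[OF n_pos] by (intro mult_left_mono) auto
  also have "\<dots> = exp (real N * (c + ?R + ln 2 + \<epsilon>))"
    by (simp add: exp_add[symmetric] algebra_simps)
  finally show ?thesis .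
qed

end

section \<open>The lower bound\<close>

context tree_law
begin

text \<open>On a tame configuration the Boltzmann factor is at least exp (N L) times F_n, so it
  suffices that the tame configurations carry half of the expected mass of F_n. The environment is
  fixed here.\<close>

lemma partition_sum_lower:
  assumes f: "density_flow f" and N: "N \<in> admissible_sizes n \<gamma>"
    and tame: "\<And>\<alpha>. tame \<alpha> \<Longrightarrow> real N * L \<le> (\<Sum>i=1..N. \<Phi> (env_vec \<alpha> i w) - ln (f n (env_vec \<alpha> i w)))"
    and W: "1 / 2 < (\<Sum>\<alpha>\<in>configs \<gamma> N n. if tame \<alpha> then prefix_weight (f n) N \<alpha> w else 0) / exp (real N * ln 2)"
  shows "exp (real N * (ln 2 + L)) / 2 \<le> partition_sum \<gamma> \<Phi> N w"
proof -
  let ?W = "\<Sum>\<alpha>\<in>configs \<gamma> N n. if tame \<alpha> then prefix_weight (f n) N \<alpha> w else 0"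
  have "exp (real N * (ln 2 + L)) / 2 = exp (real N * L) * (exp (real N * ln 2) * (1 / 2))"
    by (simp add: exp_add distrib_left)
  also have "\<dots> \<le> exp (real N * L) * ?W"
    using W by (intro mult_left_mono) (auto simp: less_divide_eq)
  also have "\<dots> \<le> partition_sum \<gamma> \<Phi> N w"
    unfolding partition_sum_def sum_distrib_left
  proof (rule sum_mono)
    fix \<alpha>
    show "exp (real N * L) * (if tame \<alpha> then prefix_weight (f n) N \<alpha> w else 0) \<le> exp (\<Sum>i=1..N. \<Phi> (env_vec \<alpha> i w))"
    proof (cases "tame \<alpha>")
      case True
      have "real N * L + ln (prefix_weight (f n) N \<alpha> w) \<le> (\<Sum>i=1..N. \<Phi> (env_vec \<alpha> i w))"
        using tame[OF True] by (simp add: sum_subtractf ln_prefix_weight[OF f order.refl])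
      then have "exp (real N * L + ln (prefix_weight (f n) N \<alpha> w)) \<le> exp (\<Sum>i=1..N. \<Phi> (env_vec \<alpha> i w))" by simp
      then show ?thesis using True flow_weight_pos[OF f order.refl] by (simp add: exp_add)
    qed simp
  qed
  finally show ?thesis .
qed

text \<open>Chebyshev's inequality for the normalized truncated sum W, whose mean is at least 1 - r.
  A fraction exp (- N rate k) of the pairs shares a prefix of length k, and each such pair is
  charged exp (N (rate k - \<eta>)); so the levels k >= 1 add at most n exp (- \<eta> N) to the
  second moment and level 0 adds 1. The factor 4 is due to (W - 1)^2 >= 1/4 when W <= 1/2.\<close>

lemma truncated_second_moment:
  fixes tame :: "(nat \<Rightarrow> nat) \<Rightarrow> (nat \<times> (nat \<Rightarrow> nat) \<times> nat \<Rightarrow> 's) \<Rightarrow> bool"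
  assumes f: "density_flow f" and N: "N \<in> admissible_sizes n \<gamma>"
    and tame_meas: "\<And>\<alpha>. \<alpha> \<in> configs \<gamma> N n \<Longrightarrow> Measurable.pred (env_law \<gamma> N) (tame \<alpha>)"
    and tame: "\<And>\<alpha> w k. tame \<alpha> w \<Longrightarrow> k \<in> {1..n} \<Longrightarrow> prefix_weight (f k) N \<alpha> w \<le> exp (real N * (rate k - \<eta>))"
    and mass: "\<And>\<alpha>. \<alpha> \<in> configs \<gamma> N n \<Longrightarrow>
      (\<integral>\<^sup>+w. (if tame \<alpha> w then 0 else 1) * ennreal (prefix_weight (f n) N \<alpha> w) \<partial>env_law \<gamma> N) \<le> ennreal r"
    and r: "0 \<le> r"
  shows "measure (env_law \<gamma> N) {w \<in> space (env_law \<gamma> N).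
      (\<Sum>\<alpha>\<in>configs \<gamma> N n. if tame \<alpha> w then prefix_weight (f n) N \<alpha> w else 0) / exp (real N * ln 2) \<le> 1 / 2}
    \<le> 4 * (real n * exp (- \<eta>) ^ N + 2 * r)"
proof -
  interpret E: prob_space "env_law \<gamma> N" by (rule prob_space_env)
  let ?E = "env_law \<gamma> N" and ?C = "configs \<gamma> N n"
  define Y where "Y \<alpha> w = (if tame \<alpha> w then prefix_weight (f n) N \<alpha> w else 0)" for \<alpha> w
  define W where "W w = (\<Sum>\<alpha>\<in>?C. Y \<alpha> w) / exp (real N * ln 2)" for w
  obtain K where K: "K > 0" "\<And>k x. k \<le> n \<Longrightarrow> x \<in> space M \<Longrightarrow> f k x \<le> exp K"
    using density_flow_bounds[OF f] by metis
  have F_le: "prefix_weight (f n) N \<alpha> w \<le> exp K ^ N" for \<alpha> w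
  proof -
    have "prefix_weight (f n) N \<alpha> w \<le> (\<Prod>i=1..N. exp K)"
      unfolding prefix_weight_def
      using density_flow_pos[OF f order.refl env_vec_space] K(2)[OF order.refl env_vec_space]
      by (intro prod_mono) (auto intro: less_imp_le)
    then show ?thesis by simp
  qed
  note F_pos = flow_weight_pos[OF f order.refl, of N]
  have F_meas: "prefix_weight (f k) N \<alpha> \<in> borel_measurable ?E" if "\<alpha> \<in> ?C" "k \<le> n" for \<alpha> k
    by (rule prefix_weight_measurable[OF that(1) density_flow_measurable[OF f that(2)]])
  have Y_meas: "Y \<alpha> \<in> borel_measurable ?E" if "\<alpha> \<in> ?C" for \<alpha>
    unfolding Y_def[abs_def] using tame_meas[OF that] F_meas[OF that order.refl] by measurable
  have Y0: "0 \<le> Y \<alpha> w" and YB: "Y \<alpha> w \<le> exp K ^ N" and YF: "Y \<alpha> w \<le> prefix_weight (f n) N \<alpha> w" for \<alpha> w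
    using F_pos[of \<alpha> w] F_le[of \<alpha> w] by (auto simp: Y_def)
  have Y_int: "integrable ?E (Y \<alpha>)" if "\<alpha> \<in> ?C" for \<alpha>
    using Y_meas[OF that] Y0 YB by (intro E.integrable_const_bound[of _ "exp K ^ N"]) auto
  have YY_int: "integrable ?E (\<lambda>w. Y \<alpha> w * Y \<beta> w)" if "\<alpha> \<in> ?C" "\<beta> \<in> ?C" for \<alpha> \<beta>
    using Y_meas[OF that(1)] Y_meas[OF that(2)] Y0 YB
    by (intro E.integrable_const_bound[of _ "exp K ^ N * exp K ^ N"]) (auto intro!: mult_mono)
  have first: "1 - r \<le> (\<integral>w. Y \<alpha> w \<partial>?E)" if \<alpha>: "\<alpha> \<in> ?C" for \<alpha>
  proof -
    have "1 = (\<integral>\<^sup>+w. ennreal (prefix_weight (f n) N \<alpha> w) \<partial>?E)"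
      by (simp add: flow_weight_integral[OF f \<alpha>])
    also have "\<dots> = (\<integral>\<^sup>+w. ennreal (Y \<alpha> w) + (if tame \<alpha> w then 0 else 1) * ennreal (prefix_weight (f n) N \<alpha> w) \<partial>?E)"
      by (intro nn_integral_cong) (auto simp: Y_def)
    also have "\<dots> = (\<integral>\<^sup>+w. ennreal (Y \<alpha> w) \<partial>?E) + (\<integral>\<^sup>+w. (if tame \<alpha> w then 0 else 1) * ennreal (prefix_weight (f n) N \<alpha> w) \<partial>?E)"
    proof (rule nn_integral_add)
      note [measurable] = Y_meas[OF \<alpha>] F_meas[OF \<alpha> order.refl] tame_meas[OF \<alpha>]
      show "(\<lambda>w. ennreal (Y \<alpha> w)) \<in> borel_measurable ?E" by measurable
      have "Measurable.pred ?E (\<lambda>w. tame \<alpha> w)" using tame_meas[OF \<alpha>] by simp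
      then have "(\<lambda>w. if tame \<alpha> w then 0 else 1 :: ennreal) \<in> borel_measurable ?E"
        by (intro measurable_If) (auto simp: pred_def)
      then show "(\<lambda>w. (if tame \<alpha> w then 0 else 1) * ennreal (prefix_weight (f n) N \<alpha> w)) \<in> borel_measurable ?E"
        by (intro borel_measurable_times_ennreal) (use F_meas[OF \<alpha> order.refl] in auto)
    qed
    also have "\<dots> \<le> ennreal (\<integral>w. Y \<alpha> w \<partial>?E) + ennreal r"
      using mass[OF \<alpha>] nn_integral_eq_integral[OF Y_int[OF \<alpha>]] Y0 by (intro add_mono) auto
    also have "\<dots> = ennreal ((\<integral>w. Y \<alpha> w \<partial>?E) + r)"
      using r Y0 by (intro ennreal_plus[symmetric]) (auto intro!: integral_nonneg_AE)
    finally have "ennreal 1 \<le> ennreal ((\<integral>w. Y \<alpha> w \<partial>?E) + r)" by simp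
    then have "1 \<le> (\<integral>w. Y \<alpha> w \<partial>?E) + r"
      using r Y0 by (subst (asm) ennreal_le_iff) (auto intro!: add_nonneg_nonneg integral_nonneg_AE)
    then show ?thesis by simp
  qed
  \<comment> \<open>At level 0 the weight is identically 1, which is not below exp (- \<eta> N);
    disjoint branches contribute the leading term of the second moment.\<close>
  define c where "c k = (if k = 0 then 1 else exp (real N * (rate k - \<eta>)))" for k
  have c0: "0 \<le> c k" for k by (simp add: c_def)
  \<comment> \<open>All common prefixes are summed and not just the longest one: the extra terms are
    nonnegative, and summing over \<beta> then reduces to counting prefixes.\<close>
  have second: "(\<integral>w. Y \<alpha> w * Y \<beta> w \<partial>?E) \<le> (\<Sum>k\<le>n. if restrict \<beta> {1..k} = restrict \<alpha> {1..k} then c k else 0)"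
    if \<alpha>: "\<alpha> \<in> ?C" and \<beta>: "\<beta> \<in> ?C" for \<alpha> \<beta>
  proof -
    obtain k where k: "k \<le> n" "restrict \<alpha> {1..k} = restrict \<beta> {1..k}"
      "\<And>j. k < j \<Longrightarrow> j \<le> n \<Longrightarrow> restrict \<alpha> {1..j} \<noteq> restrict \<beta> {1..j}"
      using overlap_exists[of n \<alpha> \<beta>] by blast
    have trunc: "prefix_weight (f k) N \<alpha> w \<le> c k" if "tame \<alpha> w" for w
    proof (cases "k = 0")
      case True
      then show ?thesis by (simp add: c_def prefix_weight_def density_flow_0[OF f])
    next
      case False
      then show ?thesis using tame[OF that, of k] k(1) by (simp add: c_def)
    qed
    have "ennreal (\<integral>w. Y \<alpha> w * Y \<beta> w \<partial>?E) = (\<integral>\<^sup>+w. ennreal (Y \<alpha> w * Y \<beta> w) \<partial>?E)"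
      by (rule nn_integral_eq_integral[symmetric, OF YY_int[OF \<alpha> \<beta>]]) (auto intro!: mult_nonneg_nonneg Y0)
    also have "\<dots> \<le> (\<integral>\<^sup>+w. (if prefix_weight (f k) N \<alpha> w \<le> c k then 1 else 0) * ennreal (prefix_weight (f n) N \<alpha> w)
      * ennreal (prefix_weight (f n) N \<beta> w) \<partial>?E)"
    proof (rule nn_integral_mono)
      fix w
      have "Y \<alpha> w * Y \<beta> w \<le> (if prefix_weight (f k) N \<alpha> w \<le> c k then 1 else 0) * prefix_weight (f n) N \<alpha> w * prefix_weight (f n) N \<beta> w"
        using trunc[of w] YF[of \<beta> w] F_pos[of \<alpha> w] F_pos[of \<beta> w]
        by (cases "tame \<alpha> w") (auto simp: Y_def)
      then have "ennreal (Y \<alpha> w * Y \<beta> w) \<le> ennreal ((if prefix_weight (f k) N \<alpha> w \<le> c k then 1 else 0) * prefix_weight (f n) N \<alpha> w * prefix_weight (f n) N \<beta> w)"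
        by (rule ennreal_leI)
      also have "\<dots> = (if prefix_weight (f k) N \<alpha> w \<le> c k then 1 else 0) * ennreal (prefix_weight (f n) N \<alpha> w)
        * ennreal (prefix_weight (f n) N \<beta> w)"
        using F_pos[of \<alpha> w] F_pos[of \<beta> w] by (auto simp: ennreal_mult less_imp_le)
      finally show "ennreal (Y \<alpha> w * Y \<beta> w) \<le> (if prefix_weight (f k) N \<alpha> w \<le> c k then 1 else 0) * ennreal (prefix_weight (f n) N \<alpha> w)
        * ennreal (prefix_weight (f n) N \<beta> w)" .
    qed
    also have "\<dots> \<le> ennreal (c k)"
      by (rule flow_weight_overlap[OF f \<alpha> \<beta> k])
    finally have "(\<integral>w. Y \<alpha> w * Y \<beta> w \<partial>?E) \<le> c k" using c0 by (simp add: ennreal_le_iff)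
    also have "c k = (if restrict \<beta> {1..k} = restrict \<alpha> {1..k} then c k else 0)" using k(2) by simp
    also have "\<dots> \<le> (\<Sum>k\<le>n. if restrict \<beta> {1..k} = restrict \<alpha> {1..k} then c k else 0)"
      by (rule member_le_sum) (use k(1) c0 in auto)
    finally show ?thesis .
  qed
  have W_int: "integrable ?E W" and W2_int: "integrable ?E (\<lambda>w. (W w)\<^sup>2)"
  proof -
    have sq: "(W w)\<^sup>2 = (\<Sum>\<alpha>\<in>?C. \<Sum>\<beta>\<in>?C. Y \<alpha> w * Y \<beta> w) / (exp (real N * ln 2))\<^sup>2" for w
      by (simp add: W_def power_divide power2_eq_square sum_product)
    show "integrable ?E W" unfolding W_def[abs_def] using Y_int by auto
    show "integrable ?E (\<lambda>w. (W w)\<^sup>2)" unfolding sq using YY_int by auto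
  qed
  have EW: "1 - r \<le> (\<integral>w. W w \<partial>?E)"
  proof -
    have "exp (real N * ln 2) * (1 - r) = (\<Sum>\<alpha>\<in>?C. 1 - r)"
      by (simp add: card_configs[OF N])
    also have "\<dots> \<le> (\<Sum>\<alpha>\<in>?C. \<integral>w. Y \<alpha> w \<partial>?E)" by (intro sum_mono first)
    also have "\<dots> = exp (real N * ln 2) * (\<integral>w. W w \<partial>?E)"
      unfolding W_def using Y_int by simp
    finally show ?thesis by simp
  qed
  have EW2: "(\<integral>w. (W w)\<^sup>2 \<partial>?E) \<le> 1 + real n * exp (- \<eta>) ^ N"
  proof -
    let ?e = "exp (real N * ln 2)"
    have "(\<integral>w. (W w)\<^sup>2 \<partial>?E) = (\<integral>w. (\<Sum>\<alpha>\<in>?C. \<Sum>\<beta>\<in>?C. Y \<alpha> w * Y \<beta> w) / (?e)\<^sup>2 \<partial>?E)"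
      by (simp add: W_def power_divide power2_eq_square sum_product)
    also have "\<dots> = (\<Sum>\<alpha>\<in>?C. \<Sum>\<beta>\<in>?C. \<integral>w. Y \<alpha> w * Y \<beta> w \<partial>?E) / (?e)\<^sup>2"
      using YY_int by simp
    also have "\<dots> \<le> (\<Sum>\<alpha>\<in>?C. \<Sum>\<beta>\<in>?C. \<Sum>k\<le>n. if restrict \<beta> {1..k} = restrict \<alpha> {1..k} then c k else 0) / (?e)\<^sup>2"
      by (intro divide_right_mono sum_mono second) auto
    also have "\<dots> = (\<Sum>\<alpha>\<in>?C. \<Sum>k\<le>n. exp (real N * (ln 2 - rate k)) * c k) / (?e)\<^sup>2"
    proof -
      have "(\<Sum>\<beta>\<in>?C. \<Sum>k\<le>n. if restrict \<beta> {1..k} = restrict \<alpha> {1..k} then c k else 0)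
        = (\<Sum>k\<le>n. exp (real N * (ln 2 - rate k)) * c k)" if "\<alpha> \<in> ?C" for \<alpha>
        by (subst sum.swap, intro sum.cong refl)
           (simp add: card_prefix[OF that _ N, symmetric] sum.inter_filter[OF finite_configs, symmetric])
      then show ?thesis by simp
    qed
    also have "\<dots> = (\<Sum>k\<le>n. exp (real N * (ln 2 - rate k)) * c k / ?e)"
      by (simp add: card_configs[OF N] power2_eq_square sum_divide_distrib)
    also have "\<dots> = (\<Sum>k\<le>n. if k = 0 then 1 else exp (- \<eta>) ^ N)"
    proof (intro sum.cong refl)
      fix k
      have "exp (real N * (ln 2 - rate k)) * exp (real N * (rate k - \<eta>)) / ?e = exp (real N * (- \<eta>))"
        by (simp add: exp_add[symmetric] exp_diff[symmetric]) (simp add: algebra_simps)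
      then show "exp (real N * (ln 2 - rate k)) * c k / ?e = (if k = 0 then 1 else exp (- \<eta>) ^ N)"
        by (auto simp: c_def rate_0 exp_of_nat_mult[symmetric])
    qed
    also have "\<dots> = 1 + real n * exp (- \<eta>) ^ N"
      by (simp add: atMost_atLeast0 sum.atLeast_Suc_atMost)
    finally show ?thesis .
  qed
  have "E.prob {w \<in> space ?E. W w \<le> 1 / 2} \<le> E.prob {w \<in> space ?E. 1 / 4 \<le> (W w - 1)\<^sup>2}"
  proof (rule E.finite_measure_mono)
    show "{w \<in> space ?E. W w \<le> 1 / 2} \<subseteq> {w \<in> space ?E. 1 / 4 \<le> (W w - 1)\<^sup>2}"
    proof safe
      fix w assume "W w \<le> 1 / 2"
      then have "(1 / 2)\<^sup>2 \<le> (1 - W w)\<^sup>2" by (intro power_mono) auto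
      then show "1 / 4 \<le> (W w - 1)\<^sup>2" by (simp add: power2_commute power_divide)
    qed
    show "{w \<in> space ?E. 1 / 4 \<le> (W w - 1)\<^sup>2} \<in> sets ?E"
      using borel_measurable_integrable[OF W_int] by measurable
  qed
  also have "\<dots> \<le> (\<integral>w. (W w - 1)\<^sup>2 \<partial>?E) / (1 / 4)"
  proof (rule integral_Markov_inequality_measure[where A="{}"])
    show "integrable ?E (\<lambda>w. (W w - 1)\<^sup>2)" using W_int W2_int by (simp add: power2_diff)
  qed auto
  also have "(\<integral>w. (W w - 1)\<^sup>2 \<partial>?E) = (\<integral>w. (W w)\<^sup>2 \<partial>?E) - 2 * (\<integral>w. W w \<partial>?E) + 1"
    using W_int W2_int by (simp add: power2_diff E.prob_space)
  also have "\<dots> / (1 / 4) \<le> 4 * (real n * exp (- \<eta>) ^ N + 2 * r)"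
    using EW EW2 by simp
  finally show ?thesis by (simp add: W_def Y_def)
qed

text \<open>Under the tilted law the log weights of all levels and the energy concentrate around
  their means. Being tame means that none of these n + 1 sums exceeds its mean by \<eta> N; failure
  has exponentially small tilted mass, which makes \<open>b\<close> summable.\<close>

lemma partition_sum_lower_event:
  assumes f: "density_flow f"
    and \<Phi>: "\<Phi> \<in> borel_measurable M" "depends_upto n \<Phi>" "\<And>x. x \<in> space M \<Longrightarrow> \<bar>\<Phi> x\<bar> \<le> C"
    and H: "\<And>k. k \<in> {1..n} \<Longrightarrow> flow_entropy f k < rate k" and \<epsilon>: "\<epsilon> > 0"
    and L: "L = (\<integral>x. f n x * \<Phi> x \<partial>M) - flow_entropy f n"
  obtains b where "summable b" "\<And>N. 0 \<le> b N" "\<And>N. N \<in> admissible_sizes n \<gamma> \<Longrightarrow>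
    measure (env_law \<gamma> N) {w \<in> space (env_law \<gamma> N). partition_sum \<gamma> \<Phi> N w < exp (real N * (ln 2 + (L - \<epsilon>))) / 2} \<le> b N"
proof -
  obtain K where K: "K > 0" "\<And>k x. k \<le> n \<Longrightarrow> x \<in> space M \<Longrightarrow> \<bar>ln (f k x)\<bar> \<le> K"
    using density_flow_bounds[OF f] by metis
  \<comment> \<open>Half of the smallest entropy gap, so that \<eta> serves twice: as fluctuation
    above the entropy and as distance of the truncation level below \<open>rate k\<close>. Including
    \<epsilon> lets the same \<eta> control the energy.\<close>
  define \<eta> where "\<eta> = Min (insert \<epsilon> ((\<lambda>k. (rate k - flow_entropy f k) / 2) ` {1..n}))"
  have \<eta>: "\<eta> > 0" unfolding \<eta>_def using \<epsilon> H by (subst Min_gr_iff) auto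
  have \<eta>\<epsilon>: "\<eta> \<le> \<epsilon>" unfolding \<eta>_def by (intro Min_le) auto
  have \<eta>H: "flow_entropy f k + \<eta> \<le> rate k - \<eta>" if "k \<in> {1..n}" for k
  proof -
    have "\<eta> \<le> (rate k - flow_entropy f k) / 2" unfolding \<eta>_def using that by (intro Min_le) auto
    then show ?thesis by simp
  qed
  \<comment> \<open>Index 0 stands for the energy, with mean - L. The sign turns the required lower
    bound on the sum of \<Phi> - ln (f n) into an upper deviation, like those of the
    entropies.\<close>
  define g where "g k x = (if k = 0 then ln (f n x) - \<Phi> x else ln (f k x))" for k x
  define m where "m k = (\<integral>x. f n x * g k x \<partial>M)" for k
  have g_meas: "g k \<in> borel_measurable M" if "k \<le> n" for k
    using measurable_ln_flow[OF f that] measurable_ln_flow[OF f order.refl] \<Phi>(1) by (cases "k = 0") (auto simp: g_def[abs_def])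
  have g_dep: "depends_upto n (g k)" if "k \<le> n" for k
  proof (cases "k = 0")
    case True
    show ?thesis
      unfolding depends_upto_def g_def True
      using density_flow_depends[OF f order.refl] \<Phi>(2) unfolding depends_upto_def by simp metis
  next
    case False
    then show ?thesis
      using depends_upto_mono[OF depends_upto_comp[OF density_flow_depends[OF f that], of ln] that]
      by (simp add: g_def[abs_def])
  qed
  have g_bound: "\<bar>g k x\<bar> \<le> K + \<bar>C\<bar>" if "k \<le> n" "x \<in> space M" for k x
    using K(2)[OF that] K(2)[OF order.refl that(2)] \<Phi>(3)[OF that(2)] K(1) unfolding g_def by auto
  have m0: "m 0 = - L"
  proof -
    have "m 0 = (\<integral>x. f n x * ln (f n x) - f n x * \<Phi> x \<partial>M)"
      unfolding m_def g_def by (simp add: algebra_simps)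
    also have "\<dots> = - L"
      using integrable_flow_ln[OF f order.refl f order.refl] integrable_flow[OF f order.refl \<Phi>(1,3)]
      by (simp add: L flow_entropy_def)
    finally show ?thesis .
  qed
  have mk: "m k = flow_entropy f k" if "k \<in> {1..n}" for k
    using flow_ln_tower[OF f _ f, of k] that by (simp add: m_def g_def flow_entropy_def)
  have "\<exists>\<rho>. \<forall>k\<le>n. 0 \<le> \<rho> k \<and> \<rho> k < 1 \<and> (\<forall>N. \<forall>\<alpha>\<in>configs \<gamma> N n.
      (\<integral>\<^sup>+w. (if real N * (m k + \<eta>) \<le> (\<Sum>i=1..N. g k (env_vec \<alpha> i w)) then 1 else 0)
          * ennreal (prefix_weight (f n) N \<alpha> w) \<partial>env_law \<gamma> N) \<le> ennreal (\<rho> k ^ N))"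
  proof (intro choice allI)
    fix k
    show "\<exists>\<rho>. k \<le> n \<longrightarrow> 0 \<le> \<rho> \<and> \<rho> < 1 \<and> (\<forall>N. \<forall>\<alpha>\<in>configs \<gamma> N n.
      (\<integral>\<^sup>+w. (if real N * (m k + \<eta>) \<le> (\<Sum>i=1..N. g k (env_vec \<alpha> i w)) then 1 else 0)
          * ennreal (prefix_weight (f n) N \<alpha> w) \<partial>env_law \<gamma> N) \<le> ennreal (\<rho> ^ N))"
    proof (cases "k \<le> n")
      case True
      show ?thesis
        by (rule flow_chernoff[OF f g_meas[OF True] g_dep[OF True] g_bound[OF True] m_def \<eta>]) blast+
    qed simp
  qed
  then obtain \<rho> where \<rho>: "\<And>k. k \<le> n \<Longrightarrow> 0 \<le> \<rho> k" "\<And>k. k \<le> n \<Longrightarrow> \<rho> k < 1"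
    "\<And>k N \<alpha>. k \<le> n \<Longrightarrow> \<alpha> \<in> configs \<gamma> N n \<Longrightarrow>
      (\<integral>\<^sup>+w. (if real N * (m k + \<eta>) \<le> (\<Sum>i=1..N. g k (env_vec \<alpha> i w)) then 1 else 0)
          * ennreal (prefix_weight (f n) N \<alpha> w) \<partial>env_law \<gamma> N) \<le> ennreal (\<rho> k ^ N)"
    by blast
  define tame where "tame N \<alpha> w \<longleftrightarrow> (\<forall>k\<in>{..n}. (\<Sum>i=1..N. g k (env_vec \<alpha> i w)) < real N * (m k + \<eta>))" for N \<alpha> w
  define b where "b N = 4 * (real n * exp (- \<eta>) ^ N + 2 * (\<Sum>k\<le>n. \<rho> k ^ N))" for N
  show ?thesis
  proof (rule that[of b])
    show "summable b"
      unfolding b_def using \<rho>(1,2) \<eta> by (intro summable_mult summable_add summable_sum summable_geometric) auto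
    show "0 \<le> b N" for N
      unfolding b_def using \<rho>(1) by (auto intro!: mult_nonneg_nonneg add_nonneg_nonneg sum_nonneg)
    fix N assume N: "N \<in> admissible_sizes n \<gamma>"
    interpret E: prob_space "env_law \<gamma> N" by (rule prob_space_env)
    let ?W = "\<lambda>w. (\<Sum>\<alpha>\<in>configs \<gamma> N n. if tame N \<alpha> w then prefix_weight (f n) N \<alpha> w else 0) / exp (real N * ln 2)"
    have sum_meas: "(\<lambda>w. \<Sum>i=1..N. g k (env_vec \<alpha> i w)) \<in> borel_measurable (env_law \<gamma> N)"
      if "k \<le> n" "\<alpha> \<in> configs \<gamma> N n" for k \<alpha>
      using g_meas[OF that(1)] that(2) by (intro borel_measurable_sum env_measurable) auto
    have tame_meas: "Measurable.pred (env_law \<gamma> N) (tame N \<alpha>)" if "\<alpha> \<in> configs \<gamma> N n" for \<alpha>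
      unfolding tame_def[abs_def]
    proof (rule pred_intros_finite(3))
      show "Measurable.pred (env_law \<gamma> N) (\<lambda>w. (\<Sum>i=1..N. g k (env_vec \<alpha> i w)) < real N * (m k + \<eta>))"
        if "k \<in> {..n}" for k
        using sum_meas[of k \<alpha>] that \<open>\<alpha> \<in> _\<close> by (intro borel_measurable_pred_less) auto
    qed simp
    have ln_le: "real N * (L - \<epsilon>) \<le> (\<Sum>i=1..N. \<Phi> (env_vec \<alpha> i w) - ln (f n (env_vec \<alpha> i w)))" if "tame N \<alpha> w" for \<alpha> w
    proof -
      have "(\<Sum>i=1..N. g 0 (env_vec \<alpha> i w)) < real N * (- L + \<eta>)" using that m0 unfolding tame_def by force
      moreover have "real N * (- L + \<eta>) \<le> real N * (- L + \<epsilon>)" using \<eta>\<epsilon> by (intro mult_left_mono) auto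
      ultimately show ?thesis by (simp add: g_def sum_subtractf algebra_simps)
    qed
    have wt: "prefix_weight (f k) N \<alpha> w \<le> exp (real N * (rate k - \<eta>))" if "tame N \<alpha> w" "k \<in> {1..n}" for k \<alpha> w
    proof -
      have kn: "k \<le> n" using that by simp
      have "ln (prefix_weight (f k) N \<alpha> w) = (\<Sum>i=1..N. g k (env_vec \<alpha> i w))"
        using ln_prefix_weight[OF f kn] that(2) by (simp add: g_def)
      also have "\<dots> \<le> real N * (m k + \<eta>)" using that kn unfolding tame_def by force
      also have "\<dots> \<le> real N * (rate k - \<eta>)" using \<eta>H[OF that(2)] mk[OF that(2)] by (intro mult_left_mono) auto
      finally show ?thesis using flow_weight_pos[OF f kn, of N \<alpha> w] by (metis exp_le_cancel_iff exp_ln)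
    qed
    have mass: "(\<integral>\<^sup>+w. (if tame N \<alpha> w then 0 else 1) * ennreal (prefix_weight (f n) N \<alpha> w) \<partial>env_law \<gamma> N) \<le> ennreal (\<Sum>k\<le>n. \<rho> k ^ N)"
      if \<alpha>: "\<alpha> \<in> configs \<gamma> N n" for \<alpha>
    proof -
      let ?b = "\<lambda>k w. (if real N * (m k + \<eta>) \<le> (\<Sum>i=1..N. g k (env_vec \<alpha> i w)) then 1 else 0 :: ennreal)
          * ennreal (prefix_weight (f n) N \<alpha> w)"
      have "(\<integral>\<^sup>+w. (if tame N \<alpha> w then 0 else 1) * ennreal (prefix_weight (f n) N \<alpha> w) \<partial>env_law \<gamma> N)
        \<le> (\<integral>\<^sup>+w. (\<Sum>k\<le>n. ?b k w) \<partial>env_law \<gamma> N)"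
      proof (rule nn_integral_mono)
        fix w
        show "(if tame N \<alpha> w then 0 else 1) * ennreal (prefix_weight (f n) N \<alpha> w) \<le> (\<Sum>k\<le>n. ?b k w)"
        proof (cases "tame N \<alpha> w")
          case False
          then obtain k where k: "k \<in> {..n}" "real N * (m k + \<eta>) \<le> (\<Sum>i=1..N. g k (env_vec \<alpha> i w))"
            unfolding tame_def by (auto simp: not_less)
          have "?b k w \<le> (\<Sum>k\<le>n. ?b k w)" by (rule member_le_sum[OF k(1)]) auto
          then show ?thesis using k False by simp
        qed simp
      qed
      also have "\<dots> = (\<Sum>k\<le>n. \<integral>\<^sup>+w. ?b k w \<partial>env_law \<gamma> N)"
      proof (rule nn_integral_sum)
        fix k assume "k \<in> {..n}"
        then have [measurable]: "(\<lambda>w. \<Sum>i=1..N. g k (env_vec \<alpha> i w)) \<in> borel_measurable (env_law \<gamma> N)"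
          using sum_meas \<alpha> by simp
        have [measurable]: "prefix_weight (f n) N \<alpha> \<in> borel_measurable (env_law \<gamma> N)"
          by (rule prefix_weight_measurable[OF \<alpha> density_flow_measurable[OF f order.refl]])
        show "?b k \<in> borel_measurable (env_law \<gamma> N)" by measurable
      qed
      also have "\<dots> \<le> (\<Sum>k\<le>n. ennreal (\<rho> k ^ N))" by (intro sum_mono \<rho>(3) \<alpha>) auto
      also have "\<dots> = ennreal (\<Sum>k\<le>n. \<rho> k ^ N)" using \<rho>(1) by (intro sum_ennreal) auto
      finally show ?thesis .
    qed
    have "E.prob {w \<in> space (env_law \<gamma> N). partition_sum \<gamma> \<Phi> N w < exp (real N * (ln 2 + (L - \<epsilon>))) / 2}
      \<le> E.prob {w \<in> space (env_law \<gamma> N). ?W w \<le> 1 / 2}"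
    proof (rule E.finite_measure_mono)
      show "{w \<in> space (env_law \<gamma> N). partition_sum \<gamma> \<Phi> N w < exp (real N * (ln 2 + (L - \<epsilon>))) / 2}
        \<subseteq> {w \<in> space (env_law \<gamma> N). ?W w \<le> 1 / 2}"
        using partition_sum_lower[OF f N ln_le] by (auto simp: not_less[symmetric])
      have "?W \<in> borel_measurable (env_law \<gamma> N)"
        using tame_meas prefix_weight_measurable[OF _ density_flow_measurable[OF f order.refl]]
        by (intro borel_measurable_divide borel_measurable_sum measurable_If) auto
      then show "{w \<in> space (env_law \<gamma> N). ?W w \<le> 1 / 2} \<in> sets (env_law \<gamma> N)" by measurable
    qed
    also have "\<dots> \<le> b N"
      unfolding b_def
      by (rule truncated_second_moment[OF f N tame_meas wt mass]) (use \<rho>(1) in \<open>auto intro!: sum_nonneg\<close>)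
    finally show "E.prob {w \<in> space (env_law \<gamma> N). partition_sum \<gamma> \<Phi> N w < exp (real N * (ln 2 + (L - \<epsilon>))) / 2} \<le> b N" .
  qed
qed

end

section \<open>The variational problem\<close>

text \<open>The entropy is phrased through the Radon-Nikodym derivative, which is determined only
  almost everywhere; uniqueness identifies it with \<open>g\<close>.\<close>

lemma relative_entropy_density:
  assumes "prob_space Q" and g: "g \<in> borel_measurable Q" "\<And>x. x \<in> space Q \<Longrightarrow> 0 \<le> g x"
    and int: "integrable Q (\<lambda>x. g x * ln (g x))"
  shows "relative_entropy (density Q (\<lambda>x. ennreal (g x))) Q = ereal (\<integral>x. g x * ln (g x) \<partial>Q)"
proof -
  interpret Q: prob_space Q by fact
  let ?N = "density Q (\<lambda>x. ennreal (g x))"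
  have log: "log (exp 1) = ln" by (simp add: log_def fun_eq_iff)
  have nn: "AE x in Q. 0 \<le> g x" using g(2) by (rule AE_I2)
  have "AE x in Q. RN_deriv Q ?N x = ennreal (g x)"
    using Q.RN_deriv_unique[of "\<lambda>x. ennreal (g x)" ?N] g(1) by (auto elim: eventually_mono)
  then have "AE x in Q. g x * entropy_density (exp 1) Q ?N x = g x * ln (g x)"
    using nn by eventually_elim (simp add: entropy_density_def log)
  then have "integrable Q (\<lambda>x. g x * entropy_density (exp 1) Q ?N x)"
    using int g(1) by (subst integrable_cong_AE[of _ _ "\<lambda>x. g x * ln (g x)"]) auto
  then have "integrable ?N (entropy_density (exp 1) Q ?N)"
    using g(1) nn by (subst integrable_real_density) auto
  moreover have "KL_divergence (exp 1) Q ?N = (\<integral>x. g x * ln (g x) \<partial>Q)"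
    using Q.KL_density[OF _ g(1) nn, of "exp 1"] by (simp add: log)
  moreover have "absolutely_continuous Q ?N"
    using g(1) by (intro absolutely_continuousI_density) auto
  ultimately show ?thesis by (simp add: relative_entropy_def)
qed

text \<open>With D the density of R, the integral of ln (g / D) under R is at most that of g / D -
  1, which is at most 0. In contrast to \<open>flow_gibbs\<close>, R is any competitor of finite
  entropy, and D may vanish or be unbounded.\<close>

lemma relative_entropy_gibbs:
  assumes "prob_space Q" "prob_space R" and sets: "sets R = sets Q"
    and rel: "relative_entropy R Q \<le> ereal a"
    and g: "g \<in> borel_measurable Q" "\<And>x. x \<in> space Q \<Longrightarrow> 0 < g x" "\<And>x. x \<in> space Q \<Longrightarrow> \<bar>ln (g x)\<bar> \<le> K"
    and g1: "(\<integral>\<^sup>+x. ennreal (g x) \<partial>Q) \<le> 1"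
  shows "(\<integral>x. ln (g x) \<partial>R) \<le> a"
proof -
  interpret Q: prob_space Q by fact
  interpret R: prob_space R by fact
  have ac: "absolutely_continuous Q R" and ent: "integrable R (entropy_density (exp 1) Q R)"
    and KL: "KL_divergence (exp 1) Q R \<le> a"
    using rel by (auto simp: relative_entropy_def split: if_splits)
  note [measurable_cong] = sets
  have space: "space R = space Q" by (rule sets_eq_imp_space_eq[OF sets])
  have log: "log (exp 1) = ln" by (simp add: log_def fun_eq_iff)
  obtain D where D: "D \<in> borel_measurable Q" "AE x in Q. RN_deriv Q R x = ennreal (D x)"
    "AE x in R. 0 < D x" "\<And>x. 0 \<le> D x"
    using Q.real_RN_deriv[OF R.finite_measure_axioms ac sets] by blast
  note [measurable] = D(1) g(1)
  have dens: "R = density Q (\<lambda>x. ennreal (D x))"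
    using Q.density_RN_deriv[OF ac sets] D(2) density_cong[of "RN_deriv Q R" Q "\<lambda>x. ennreal (D x)"] by simp
  have entD: "AE x in R. entropy_density (exp 1) Q R x = ln (D x)"
  proof -
    have "AE x in R. RN_deriv Q R x = ennreal (D x)"
      by (rule absolutely_continuous_AE[OF sets ac D(2)])
    then show ?thesis by eventually_elim (simp add: entropy_density_def log D(4))
  qed
  have iD: "integrable R (\<lambda>x. ln (D x))"
    using ent entD D(1) by (subst (asm) integrable_cong_AE[of _ _ "\<lambda>x. ln (D x)"])
      (auto simp: entropy_density_def[abs_def])
  have KLD: "(\<integral>x. ln (D x) \<partial>R) \<le> a"
    using KL entD integral_cong_AE[of "entropy_density (exp 1) Q R" R "\<lambda>x. ln (D x)"] D(1)
    by (simp add: KL_divergence_def entropy_density_def[abs_def])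
  have ig: "integrable R (\<lambda>x. ln (g x))"
    using g by (intro R.integrable_const_bound[of _ K]) (auto simp: space)
  have "(\<integral>\<^sup>+x. ennreal (g x / D x) \<partial>R) = (\<integral>\<^sup>+x. ennreal (D x) * ennreal (g x / D x) \<partial>Q)"
    unfolding dens by (subst nn_integral_density) auto
  also have "\<dots> \<le> (\<integral>\<^sup>+x. ennreal (g x) \<partial>Q)"
  proof (rule nn_integral_mono)
    fix x assume "x \<in> space Q"
    \<comment> \<open>Where D vanishes, the quotient is 0 by convention and mass of \<open>g\<close>
      is lost; only an inequality holds.\<close>
    then show "ennreal (D x) * ennreal (g x / D x) \<le> ennreal (g x)"
      using D(4)[of x] g(2)[of x] by (cases "D x = 0") (auto simp: ennreal_mult[symmetric])
  qed
  finally have nn: "(\<integral>\<^sup>+x. ennreal (g x / D x) \<partial>R) \<le> 1" using g1 by (rule order.trans)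
  have quot: "AE x in R. 0 \<le> g x / D x"
    using g(2) D(4) by (intro AE_I2) (auto simp: space less_imp_le)
  have iq: "integrable R (\<lambda>x. g x / D x)"
    using nn quot by (intro integrableI_nonneg) (auto simp: le_less_trans)
  have "ennreal (\<integral>x. g x / D x \<partial>R) \<le> ennreal 1"
    using nn nn_integral_eq_integral[OF iq quot] by simp
  then have q1: "(\<integral>x. g x / D x \<partial>R) \<le> 1" by (subst (asm) ennreal_le_iff) auto
  have "(\<integral>x. ln (g x) - ln (D x) \<partial>R) \<le> (\<integral>x. g x / D x - 1 \<partial>R)"
  proof (rule integral_mono_AE)
    show "AE x in R. ln (g x) - ln (D x) \<le> g x / D x - 1"
      using D(3) AE_space
    proof eventually_elim
      case (elim x)
      then have "0 < g x" using g(2)[of x] space by auto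
      then show ?case using ln_le_minus_one[of "g x / D x"] elim by (simp add: ln_div)
    qed
  qed (use ig iD iq in auto)
  then show ?thesis using ig iD iq q1 KLD by (simp add: R.prob_space)
qed

context product_law
begin

text \<open>Composition with the map that fills the coordinates beyond k with
  \<open>undefined\<close>: it takes points of S^k into S^n, and \<open>f\<close> does not notice
  the filled coordinates.\<close>

lemma measurable_depends:
  assumes f: "f \<in> borel_measurable M" "depends_upto k f" and k: "k \<le> n"
  shows "f \<in> borel_measurable (product_borel k)"
proof -
  define e where "e x = (\<lambda>i\<in>{1..n}. if i \<le> k then x i else undefined :: 's)" for x
  have "e \<in> product_borel k \<rightarrow>\<^sub>M M"
    unfolding e_def[abs_def]
  proof (rule measurable_restrict)
    fix i assume i: "i \<in> {1..n}"
    show "(\<lambda>x. if i \<le> k then x i else undefined) \<in> product_borel k \<rightarrow>\<^sub>M \<mu> i"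
    proof (cases "i \<le> k")
      case True
      then have "(\<lambda>x. x i) \<in> product_borel k \<rightarrow>\<^sub>M borel"
        unfolding product_borel_def using i by (intro measurable_component_singleton) auto
      then show ?thesis using True unfolding measurable_cong_sets[OF refl sets_factor] by simp
    qed (simp add: space_factor)
  qed
  from measurable_compose[OF this f(1)]
  have "(\<lambda>x. f (e x)) \<in> borel_measurable (product_borel k)" .
  moreover have "f (e x) = f x" for x
    by (rule depends_uptoD[OF f(2)]) (use k in \<open>auto simp: e_def\<close>)
  ultimately show ?thesis by simp
qed

lemma flow_pos_marginal:
  assumes "density_flow f" "k \<le> n"
  shows "0 < f k x"
proof -
  have "f k x = f k (\<lambda>i\<in>{1..n}. x i)"
    by (rule depends_uptoD[OF density_flow_depends[OF assms]]) (use assms in auto)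
  then show ?thesis using density_flow_pos[OF assms, of "\<lambda>i\<in>{1..n}. x i"] by (auto simp: space_M)
qed

lemma restrict_measurable: "k \<le> n \<Longrightarrow> sets N = sets M \<Longrightarrow> (\<lambda>x. restrict x {1..k}) \<in> N \<rightarrow>\<^sub>M product_borel k"
  unfolding product_borel_def
  by (subst measurable_cong_sets[of _ "product_borel n" _ "PiM {1..k} (\<lambda>_. borel)"])
     (auto simp: sets_M product_borel_def intro!: measurable_restrict_subset)

lemma prob_space_marginal:
  "k \<le> n \<Longrightarrow> prob_space N \<Longrightarrow> sets N = sets M \<Longrightarrow> prob_space (marginal k N)"
  unfolding marginal_def by (rule prob_space.prob_space_distr[OF _ restrict_measurable])

lemma flow_restrict:
  "density_flow f \<Longrightarrow> k \<le> n \<Longrightarrow> f k (restrict x {1..k}) = f k x"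
  by (rule depends_uptoD[OF density_flow_depends]) auto

text \<open>The tower property, with the indicator of the preimage of a set in S^k as the function
  of the first k coordinates.\<close>

lemma marginal_density:
  assumes f: "density_flow f" and k: "k \<le> n"
  shows "marginal k (density M (\<lambda>x. ennreal (f n x))) = density (marginal k M) (\<lambda>x. ennreal (f k x))"
proof (rule measure_eqI)
  let ?r = "\<lambda>x. restrict x {1..k}"
  show "sets (marginal k (density M (\<lambda>x. ennreal (f n x)))) = sets (density (marginal k M) (\<lambda>x. ennreal (f k x)))"
    by (simp add: marginal_def)
  fix A assume "A \<in> sets (marginal k (density M (\<lambda>x. ennreal (f n x))))"
  then have A: "A \<in> sets (product_borel k)" by (simp add: marginal_def)
  note r[measurable] = restrict_measurable[OF k refl]
  note fn[measurable] = density_flow_measurable[OF f order.refl]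
  have fk[measurable]: "f k \<in> borel_measurable (product_borel k)"
    by (rule measurable_depends[OF density_flow_measurable[OF f k] density_flow_depends[OF f k] k])
  have rd: "?r \<in> density M (\<lambda>x. ennreal (f n x)) \<rightarrow>\<^sub>M product_borel k" by simp
  have iA: "(\<lambda>x. indicator A (?r x) :: ennreal) \<in> borel_measurable M"
    using A by measurable
  have "emeasure (marginal k (density M (\<lambda>x. ennreal (f n x)))) A
    = (\<integral>\<^sup>+x. ennreal (f n x) * indicator (?r -` A \<inter> space M) x \<partial>M)"
    unfolding marginal_def using A
    by (subst emeasure_distr[OF rd A], subst emeasure_density) (auto intro: measurable_sets[OF r])
  also have "\<dots> = (\<integral>\<^sup>+x. indicator A (?r x) * ennreal (f n x) \<partial>M)"
    by (intro nn_integral_cong) (auto split: split_indicator)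
  also have "\<dots> = (\<integral>\<^sup>+x. indicator A (?r x) * ennreal (f k x) \<partial>M)"
  proof (rule density_flow_tower[OF f k iA])
    show "depends_upto k (\<lambda>x. indicator A (?r x) :: ennreal)"
      unfolding depends_upto_def by (auto simp: restrict_def intro!: arg_cong[where f="indicator A"])
  qed
  also have "\<dots> = (\<integral>\<^sup>+x. ennreal (f k x) * indicator A x \<partial>marginal k M)"
    unfolding marginal_def using A
    by (subst nn_integral_distr[OF r]) (auto simp: flow_restrict[OF f k] mult.commute)
  also have "\<dots> = emeasure (density (marginal k M) (\<lambda>x. ennreal (f k x))) A"
    using A fk by (subst emeasure_density) (auto simp: marginal_def)
  finally show "emeasure (marginal k (density M (\<lambda>x. ennreal (f n x)))) A
    = emeasure (density (marginal k M) (\<lambda>x. ennreal (f k x))) A" .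
qed

lemma prob_space_flow:
  assumes f: "density_flow f"
  shows "prob_space (density M (\<lambda>x. ennreal (f n x)))"
proof (rule prob_spaceI)
  show "emeasure (density M (\<lambda>x. ennreal (f n x))) (space (density M (\<lambda>x. ennreal (f n x)))) = 1"
    using density_flow_nn_integral[OF f order.refl] density_flow_measurable[OF f order.refl]
    by (subst emeasure_density) (auto simp: cong: nn_integral_cong)
qed

lemma relative_entropy_marginal:
  assumes f: "density_flow f" and k: "k \<le> n"
  shows "relative_entropy (marginal k (density M (\<lambda>x. ennreal (f n x)))) (marginal k M) = ereal (flow_entropy f k)"
proof -
  note r = restrict_measurable[OF k refl]
  have fk: "f k \<in> borel_measurable (product_borel k)"
    by (rule measurable_depends[OF density_flow_measurable[OF f k] density_flow_depends[OF f k] k])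
  have "integrable (marginal k M) (\<lambda>x. f k x * ln (f k x))"
    unfolding marginal_def using fk integrable_flow_ln[OF f k f k]
    by (subst integrable_distr_eq[OF r]) (auto simp: flow_restrict[OF f k])
  moreover have "(\<integral>x. f k x * ln (f k x) \<partial>marginal k M) = flow_entropy f k"
    unfolding marginal_def flow_entropy_def using fk
    by (subst integral_distr[OF r]) (auto simp: flow_restrict[OF f k])
  moreover have "f k \<in> borel_measurable (marginal k M)" using fk by (simp add: marginal_def)
  ultimately show ?thesis
    unfolding marginal_density[OF f k]
    using relative_entropy_density[OF prob_space_marginal[OF k L.P.prob_space_axioms refl], of "f k"]
      flow_pos_marginal[OF f k] by (auto simp: less_imp_le)
qed

lemma relative_entropy_flow:
  assumes f: "density_flow f"
  shows "relative_entropy (density M (\<lambda>x. ennreal (f n x))) M = ereal (flow_entropy f n)"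
  unfolding flow_entropy_def
  by (rule relative_entropy_density[OF L.P.prob_space_axioms density_flow_measurable[OF f order.refl] _
        integrable_flow_ln[OF f order.refl f order.refl]])
     (rule less_imp_le[OF density_flow_pos[OF f order.refl]])

end

context tree_law
begin

text \<open>Weak duality and its equality case. Integrating the identity against a competitor leaves
  the integral of ln (f n) minus the entropy, which is at most 0, and l k times the integral of ln
  (f k), which the constraint on the k-th marginal bounds by l k * rate k. The measure with density
  \<open>f n\<close> is admissible, and complementary slackness makes it attain the bound.\<close>

lemma J_star_flow:
  assumes \<Phi>: "\<Phi> \<in> borel_measurable M" "depends_upto n \<Phi>" "\<And>x. x \<in> space M \<Longrightarrow> \<bar>\<Phi> x\<bar> \<le> C"
    and f: "density_flow f"
    and l: "\<And>k. k \<in> {1..n} \<Longrightarrow> 0 \<le> l k"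
    and H: "\<And>k. k \<in> {1..n} \<Longrightarrow> flow_entropy f k \<le> rate k"
    and slack: "\<And>k. k \<in> {1..n} \<Longrightarrow> l k * flow_entropy f k = l k * rate k"
    and eq: "\<And>x. \<Phi> x = c + ln (f n x) + (\<Sum>k=1..n. l k * ln (f k x))"
  shows "J_star n \<gamma> \<mu> \<Phi> = ereal (c + (\<Sum>k=1..n. l k * rate k))"
    and "(\<integral>x. f n x * \<Phi> x \<partial>M) - flow_entropy f n = c + (\<Sum>k=1..n. l k * rate k)"
proof -
  let ?V = "c + (\<Sum>k=1..n. l k * rate k)"
  let ?R = "\<Inter>j\<in>{1..n}. entropy_ball n \<gamma> \<mu> j"
  obtain K where K: "\<And>k x. k \<le> n \<Longrightarrow> x \<in> space M \<Longrightarrow> \<bar>ln (f k x)\<bar> \<le> K"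
    using density_flow_bounds[OF f] by metis
  show val: "(\<integral>x. f n x * \<Phi> x \<partial>M) - flow_entropy f n = ?V"
  proof -
    have "(\<integral>x. f n x * \<Phi> x \<partial>M) = c + flow_entropy f n + (\<Sum>k=1..n. l k * flow_entropy f k)"
      unfolding flow_entropy_def by (rule integral_flow_decomposition[OF \<Phi> f f eq])
    also have "(\<Sum>k=1..n. l k * flow_entropy f k) = (\<Sum>k=1..n. l k * rate k)"
      by (intro sum.cong slack) auto
    finally show ?thesis by simp
  qed
  show "J_star n \<gamma> \<mu> \<Phi> = ereal ?V"
  proof (rule antisym)
    show "J_star n \<gamma> \<mu> \<Phi> \<le> ereal ?V"
      unfolding J_star_def
    proof (rule SUP_least)
      fix \<nu> assume \<nu>: "\<nu> \<in> ?R"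
      have s\<nu>: "sets \<nu> = sets M" and p\<nu>: "prob_space \<nu>"
        using \<nu> n_pos by (auto simp: entropy_ball_def space_prob_algebra sets_M)
      interpret \<nu>: prob_space \<nu> by fact
      have sp: "space \<nu> = space M" by (rule sets_eq_imp_space_eq[OF s\<nu>])
      have lnf_meas: "(\<lambda>x. ln (f k x)) \<in> borel_measurable \<nu>" if "k \<le> n" for k
        using measurable_ln_flow[OF f that] measurable_cong_sets[OF s\<nu> refl] by blast
      have int: "integrable \<nu> (\<lambda>x. ln (f k x))" if "k \<le> n" for k
        using lnf_meas[OF that] K[OF that] by (intro \<nu>.integrable_const_bound[of _ K]) (auto simp: sp)
      have low: "(\<integral>x. ln (f k x) \<partial>\<nu>) \<le> rate k" if k: "k \<in> {1..n}" for k
      proof -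
        have kn: "k \<le> n" using k by simp
        have fk: "f k \<in> borel_measurable (product_borel k)"
          by (rule measurable_depends[OF density_flow_measurable[OF f kn] density_flow_depends[OF f kn] kn])
        have "(\<integral>x. ln (f k x) \<partial>\<nu>) = (\<integral>x. ln (f k x) \<partial>marginal k \<nu>)"
          unfolding marginal_def using fk
          by (subst integral_distr[OF restrict_measurable[OF kn s\<nu>]]) (auto simp: flow_restrict[OF f kn])
        also have "\<dots> \<le> rate k"
        proof (rule relative_entropy_gibbs[where Q="marginal k M" and R="marginal k \<nu>" and K=K])
          show "prob_space (marginal k M)" by (rule prob_space_marginal[OF kn L.P.prob_space_axioms refl])
          show "prob_space (marginal k \<nu>)" by (rule prob_space_marginal[OF kn p\<nu> s\<nu>])
          show "sets (marginal k \<nu>) = sets (marginal k M)" by (simp add: marginal_def)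
          show "relative_entropy (marginal k \<nu>) (marginal k M) \<le> ereal (rate k)"
            using \<nu> k by (auto simp: entropy_ball_def rate_def)
          show "f k \<in> borel_measurable (marginal k M)" using fk by (simp add: marginal_def)
          show "0 < f k x" for x by (rule flow_pos_marginal[OF f kn])
          show "\<bar>ln (f k x)\<bar> \<le> K" for x
          proof -
            have "f k x = f k (\<lambda>i\<in>{1..n}. x i)"
              by (rule depends_uptoD[OF density_flow_depends[OF f kn]]) (use kn in auto)
            then show ?thesis using K[OF kn, of "\<lambda>i\<in>{1..n}. x i"] by (auto simp: space_M)
          qed
          have "(\<integral>\<^sup>+x. ennreal (f k x) \<partial>marginal k M) = (\<integral>\<^sup>+x. ennreal (f k x) \<partial>M)"
            unfolding marginal_def using fk
            by (subst nn_integral_distr[OF restrict_measurable[OF kn refl]]) (auto simp: flow_restrict[OF f kn])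
          then show "(\<integral>\<^sup>+x. ennreal (f k x) \<partial>marginal k M) \<le> 1"
            by (simp add: density_flow_nn_integral[OF f kn])
        qed
        finally show ?thesis .
      qed
      show "ereal (\<integral>x. \<Phi> x \<partial>\<nu>) - relative_entropy \<nu> M \<le> ereal ?V"
      proof (cases "relative_entropy \<nu> M = \<infinity>")
        case False
        then obtain a where a: "relative_entropy \<nu> M = ereal a"
          by (auto simp: relative_entropy_def split: if_splits)
        have top: "(\<integral>x. ln (f n x) \<partial>\<nu>) \<le> a"
          by (rule relative_entropy_gibbs[OF L.P.prob_space_axioms p\<nu> s\<nu> _ density_flow_measurable[OF f order.refl]
                density_flow_pos[OF f order.refl] K[OF order.refl]])
             (auto simp: a density_flow_nn_integral[OF f order.refl])
        have "(\<integral>x. \<Phi> x \<partial>\<nu>) = c + (\<integral>x. ln (f n x) \<partial>\<nu>) + (\<Sum>k=1..n. l k * (\<integral>x. ln (f k x) \<partial>\<nu>))"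
          unfolding eq using int
          by (subst Bochner_Integration.integral_add Bochner_Integration.integral_sum | auto simp: \<nu>.prob_space)+
        also have "\<dots> \<le> c + a + (\<Sum>k=1..n. l k * rate k)"
          by (intro add_mono top order.refl sum_mono mult_left_mono low l)
        finally show ?thesis by (simp add: a)
      qed simp
    qed
    let ?\<nu> = "density M (\<lambda>x. ennreal (f n x))"
    have "?\<nu> \<in> ?R"
      using prob_space_flow[OF f] relative_entropy_marginal[OF f] H
      by (auto simp: entropy_ball_def space_prob_algebra sets_M rate_def)
    then have "ereal (\<integral>x. \<Phi> x \<partial>?\<nu>) - relative_entropy ?\<nu> M \<le> J_star n \<gamma> \<mu> \<Phi>"
      unfolding J_star_def by (rule SUP_upper)
    moreover have "(\<integral>x. \<Phi> x \<partial>?\<nu>) = (\<integral>x. f n x * \<Phi> x \<partial>M)"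
      using density_flow_measurable[OF f order.refl] density_flow_pos[OF f order.refl] \<Phi>(1)
      by (intro integral_real_density) (auto intro!: AE_I2 less_imp_le)
    ultimately show "ereal ?V \<le> J_star n \<gamma> \<mu> \<Phi>"
      using val by (simp add: relative_entropy_flow[OF f])
  qed
qed

end

section \<open>Almost sure convergence\<close>

text \<open>Independence is required within each size only; the families for different N may be
  coupled in any way.\<close>

locale env_sample = tree_law n \<mu> \<gamma> + P: prob_space P
  for n and \<mu> :: "nat \<Rightarrow> 's::polish_space measure" and \<gamma> and P :: "'w measure" +
  fixes X :: "nat \<Rightarrow> nat \<times> (nat \<Rightarrow> nat) \<times> nat \<Rightarrow> 'w \<Rightarrow> 's"
  assumes indep: "\<And>N. N \<in> admissible_sizes n \<gamma> \<Longrightarrow> P.indep_vars (\<lambda>_. borel) (X N) (env_index n \<gamma> N)"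
    and law: "\<And>N j \<beta> i. N \<in> admissible_sizes n \<gamma> \<Longrightarrow> (j, \<beta>, i) \<in> env_index n \<gamma> N \<Longrightarrow>
      distr P borel (X N (j, \<beta>, i)) = \<mu> j"
begin

abbreviation sizes :: "nat filter" where
  "sizes \<equiv> inf sequentially (principal (admissible_sizes n \<gamma>))"

definition env :: "nat \<Rightarrow> 'w \<Rightarrow> nat \<times> (nat \<Rightarrow> nat) \<times> nat \<Rightarrow> 's" where
  "env N \<omega> = (\<lambda>p\<in>env_index n \<gamma> N. X N p \<omega>)"

lemma env_distr:
  assumes N: "N \<in> admissible_sizes n \<gamma>"
  shows "env N \<in> P \<rightarrow>\<^sub>M env_law \<gamma> N" "distr P (env_law \<gamma> N) (env N) = env_law \<gamma> N"
proof -
  let ?I = "env_index n \<gamma> N"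
  have rv: "X N p \<in> P \<rightarrow>\<^sub>M borel" if "p \<in> ?I" for p
    using indep[OF N] that by (auto simp: P.indep_vars_def)
  have N0: "0 < N" using N by (simp add: admissible_sizes_def)
  have "(\<lambda>j\<in>{1..n}. 1) \<in> configs \<gamma> N n" by (auto simp: configs_def)
  \<comment> \<open>The characterization of independence by the product law asks for a nonempty
    index set; n and N are positive.\<close>
  then have ne: "?I \<noteq> {}" using env_indexI[OF _ n_pos, of _ \<gamma> N 1] N0 by auto
  have eq: "PiM ?I (\<lambda>p. distr P borel (X N p)) = env_law \<gamma> N"
    unfolding env_law_def using law[OF N] by (intro PiM_cong) auto
  have se: "sets (env_law \<gamma> N) = sets (PiM ?I (\<lambda>_. borel))"
    unfolding env_law_def by (rule sets_PiM_cong) (auto simp: sets_factor)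
  have "env N \<in> P \<rightarrow>\<^sub>M PiM ?I (\<lambda>_. borel)"
    unfolding env_def[abs_def] by (rule measurable_restrict) (rule rv)
  then show "env N \<in> P \<rightarrow>\<^sub>M env_law \<gamma> N" using measurable_cong_sets[OF refl se] by blast
  have "distr P (PiM ?I (\<lambda>_. borel)) (env N) = env_law \<gamma> N"
    unfolding env_def[abs_def] eq[symmetric]
    using P.indep_vars_iff_distr_eq_PiM'[OF ne rv] indep[OF N] by simp
  then show "distr P (env_law \<gamma> N) (env N) = env_law \<gamma> N"
    using distr_cong[OF refl se, of P "env N" "env N"] by simp
qed

lemma config_vec_env:
  "\<alpha> \<in> configs \<gamma> N n \<Longrightarrow> i \<in> {1..N} \<Longrightarrow> config_vec n (X N) \<alpha> i \<omega> = env_vec \<alpha> i (env N \<omega>)"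
  unfolding config_vec_def env_vec_def env_def using env_indexI by (auto intro!: restrict_ext)

text \<open>The first Borel-Cantelli lemma, which involves each law separately. The bad event is
  taken to be empty at the other sizes, so that summability can be stated over all N.\<close>

lemma env_borel_cantelli:
  assumes meas: "\<And>N. N \<in> admissible_sizes n \<gamma> \<Longrightarrow> A N \<in> sets (env_law \<gamma> N)"
    and le: "\<And>N. N \<in> admissible_sizes n \<gamma> \<Longrightarrow> measure (env_law \<gamma> N) (A N) \<le> b N"
    and b: "summable b" and b0: "\<And>N. 0 \<le> b N"
  shows "AE \<omega> in P. eventually (\<lambda>N. N \<in> admissible_sizes n \<gamma> \<and> env N \<omega> \<in> space (env_law \<gamma> N) - A N) sizes"
proof -
  define B where "B N = (if N \<in> admissible_sizes n \<gamma> then env N -` A N \<inter> space P else {})" for N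
  have "AE \<omega> in P. eventually (\<lambda>N. \<omega> \<in> space P - B N) sequentially"
  proof (rule borel_cantelli_AE1)
    show "B N \<in> sets P" for N
      unfolding B_def using measurable_sets[OF env_distr(1) meas] by auto
    show "emeasure P (B N) < \<infinity>" for N by (simp add: P.emeasure_eq_measure)
    have "norm (measure P (B N)) \<le> b N" for N
    proof (cases "N \<in> admissible_sizes n \<gamma>")
      case True
      have "measure P (B N) = measure (distr P (env_law \<gamma> N) (env N)) (A N)"
        unfolding measure_distr[OF env_distr(1)[OF True] meas[OF True]] using True by (simp add: B_def)
      then show ?thesis using le[OF True] by (simp add: env_distr(2)[OF True])
    qed (simp add: B_def b0)
    then show "summable (\<lambda>N. measure P (B N))"
      by (rule summable_comparison_test'[OF b])
  qed
  then show ?thesis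
  proof eventually_elim
    case (elim \<omega>)
    show ?case
      unfolding eventually_inf_principal
      using elim
    proof eventually_elim
      case (elim N)
      then show ?case using measurable_space[OF env_distr(1)] by (auto simp: B_def)
    qed
  qed
qed

lemma log_partition_upper:
  assumes f: "density_flow f" and l: "\<And>k. k \<in> {1..n} \<Longrightarrow> 0 \<le> l k"
    and eq: "\<And>x. \<Phi> x = c + ln (f n x) + (\<Sum>k=1..n. l k * ln (f k x))" and e: "e > 0"
  shows "AE \<omega> in P. eventually (\<lambda>N. 1 / real N * ln (partition_sum \<gamma> \<Phi> N (env N \<omega>))
    \<le> c + (\<Sum>k=1..n. l k * rate k) + ln 2 + e) sizes"
proof -
  define s where "s = 1 + (\<Sum>k=1..n. l k)"
  have s: "s \<ge> 1" using l by (auto simp: s_def intro!: sum_nonneg)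
  \<comment> \<open>The error \<epsilon> enters once with every multiplier and once through the sum
    of F_n, in total (1 + l 1 + ... + l n) \<epsilon> = e.\<close>
  define \<epsilon> where "\<epsilon> = e / s"
  have \<epsilon>: "\<epsilon> > 0" using e s by (simp add: \<epsilon>_def)
  have \<epsilon>s: "(\<Sum>k=1..n. l k * \<epsilon>) + \<epsilon> = e"
  proof -
    have "(\<Sum>k=1..n. l k * \<epsilon>) + \<epsilon> = s * \<epsilon>" by (simp add: s_def distrib_right sum_distrib_right)
    then show ?thesis using s by (simp add: \<epsilon>_def)
  qed
  define B where "B N k = {w \<in> space (env_law \<gamma> N).
      exp (real N * (ln 2 + \<epsilon>)) \<le> (\<Sum>\<alpha>\<in>configs \<gamma> N n. prefix_weight (f k) N \<alpha> w)}" for N k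
  have B_meas: "B N k \<in> sets (env_law \<gamma> N)" if "k \<in> {1..n}" for N k
  proof -
    have "(\<lambda>w. \<Sum>\<alpha>\<in>configs \<gamma> N n. prefix_weight (f k) N \<alpha> w) \<in> borel_measurable (env_law \<gamma> N)"
      using that by (intro borel_measurable_sum prefix_weight_measurable density_flow_measurable[OF f]) auto
    then show ?thesis unfolding B_def by measurable
  qed
  have "AE \<omega> in P. eventually (\<lambda>N. N \<in> admissible_sizes n \<gamma> \<and> env N \<omega> \<in> space (env_law \<gamma> N) - (\<Union>k\<in>{1..n}. B N k)) sizes"
  proof (rule env_borel_cantelli)
    show "(\<Union>k\<in>{1..n}. B N k) \<in> sets (env_law \<gamma> N)" for N using B_meas by blast
    show "summable (\<lambda>N. real n * exp (- \<epsilon>) ^ N)"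
      using \<epsilon> by (intro summable_mult summable_geometric) simp
    show "0 \<le> real n * exp (- \<epsilon>) ^ N" for N by simp
    fix N assume N: "N \<in> admissible_sizes n \<gamma>"
    interpret E: prob_space "env_law \<gamma> N" by (rule prob_space_env)
    have "E.prob (\<Union>k\<in>{1..n}. B N k) \<le> (\<Sum>k\<in>{1..n}. E.prob (B N k))"
      using B_meas by (intro E.finite_measure_subadditive_finite) auto
    also have "\<dots> \<le> (\<Sum>k\<in>{1..n}. exp (- \<epsilon>) ^ N)"
      unfolding B_def by (intro sum_mono flow_sum_markov[OF f _ N]) auto
    finally show "E.prob (\<Union>k\<in>{1..n}. B N k) \<le> real n * exp (- \<epsilon>) ^ N" by simp
  qed
  then show ?thesis
  proof eventually_elim
    case (elim \<omega>)
    then show ?case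
    proof eventually_elim
      case (elim N)
      then have N: "N \<in> admissible_sizes n \<gamma>" by simp
      then have N0: "0 < N" by (simp add: admissible_sizes_def)
      let ?w = "env N \<omega>"
      have "partition_sum \<gamma> \<Phi> N ?w \<le> exp (real N * (c + (\<Sum>k=1..n. l k * (rate k + \<epsilon>)) + ln 2 + \<epsilon>))"
      proof (rule partition_sum_upper[OF f N l eq])
        fix k assume "k \<in> {1..n}"
        then have "?w \<in> space (env_law \<gamma> N)" "?w \<notin> B N k" using elim by blast+
        then show "(\<Sum>\<alpha>\<in>configs \<gamma> N n. prefix_weight (f k) N \<alpha> ?w) < exp (real N * (ln 2 + \<epsilon>))"
          by (simp add: B_def not_le)
      qed
      moreover have "0 < partition_sum \<gamma> \<Phi> N ?w"
        unfolding partition_sum_def using card_configs[OF N] by (intro sum_pos finite_configs) auto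
      ultimately have "ln (partition_sum \<gamma> \<Phi> N ?w) \<le> real N * (c + (\<Sum>k=1..n. l k * (rate k + \<epsilon>)) + ln 2 + \<epsilon>)"
        by (metis exp_le_cancel_iff exp_ln)
      then have "1 / real N * ln (partition_sum \<gamma> \<Phi> N ?w) \<le> c + (\<Sum>k=1..n. l k * (rate k + \<epsilon>)) + ln 2 + \<epsilon>"
        using N0 by (simp add: divide_le_eq mult.commute)
      also have "\<dots> = c + (\<Sum>k=1..n. l k * rate k) + ln 2 + ((\<Sum>k=1..n. l k * \<epsilon>) + \<epsilon>)"
        by (simp add: distrib_left sum.distrib)
      finally show ?case unfolding \<epsilon>s .
    qed
  qed
qed

lemma log_partition_lower_strict:
  assumes f: "density_flow f"
    and \<Phi>: "\<Phi> \<in> borel_measurable M" "depends_upto n \<Phi>" "\<And>x. x \<in> space M \<Longrightarrow> \<bar>\<Phi> x\<bar> \<le> C"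
    and H: "\<And>k. k \<in> {1..n} \<Longrightarrow> flow_entropy f k < rate k" and e: "e > 0"
  shows "AE \<omega> in P. eventually (\<lambda>N. (\<integral>x. f n x * \<Phi> x \<partial>M) - flow_entropy f n + ln 2 - e
    \<le> 1 / real N * ln (partition_sum \<gamma> \<Phi> N (env N \<omega>))) sizes"
proof -
  define L where "L = (\<integral>x. f n x * \<Phi> x \<partial>M) - flow_entropy f n"
  show ?thesis
  proof (rule partition_sum_lower_event[OF f \<Phi> H half_gt_zero[OF e] L_def])
    fix b :: "nat \<Rightarrow> real"
    assume b: "summable b" "\<And>N. 0 \<le> b N" "\<And>N. N \<in> admissible_sizes n \<gamma> \<Longrightarrow>
      measure (env_law \<gamma> N) {w \<in> space (env_law \<gamma> N). partition_sum \<gamma> \<Phi> N w < exp (real N * (ln 2 + (L - e / 2))) / 2} \<le> b N"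
    have "AE \<omega> in P. eventually (\<lambda>N. N \<in> admissible_sizes n \<gamma> \<and> env N \<omega> \<in> space (env_law \<gamma> N) -
      {w \<in> space (env_law \<gamma> N). partition_sum \<gamma> \<Phi> N w < exp (real N * (ln 2 + (L - e / 2))) / 2}) sizes"
    proof (rule env_borel_cantelli[OF _ b(3,1,2)])
      fix N
      show "{w \<in> space (env_law \<gamma> N). partition_sum \<gamma> \<Phi> N w < exp (real N * (ln 2 + (L - e / 2))) / 2} \<in> sets (env_law \<gamma> N)"
        using partition_sum_measurable[OF \<Phi>(1), of \<gamma> N] by measurable
    qed
    then show "AE \<omega> in P. eventually (\<lambda>N. (\<integral>x. f n x * \<Phi> x \<partial>M) - flow_entropy f n + ln 2 - e
      \<le> 1 / real N * ln (partition_sum \<gamma> \<Phi> N (env N \<omega>))) sizes"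
    proof eventually_elim
      case (elim \<omega>)
      \<comment> \<open>One half of e is spent on the energy and weight fluctuations; the other half
        absorbs the factor 1/2 once N is large.\<close>
      have "eventually (\<lambda>N. 2 * ln 2 / e \<le> real N) sequentially"
        using eventually_ge_at_top[of "nat \<lceil>2 * ln 2 / e\<rceil>"] by eventually_elim linarith
      then have "eventually (\<lambda>N. 2 * ln 2 / e \<le> real N) sizes"
        by (rule filter_leD[rotated]) simp
      with elim show ?case
      proof eventually_elim
        case (elim N)
        then have N0: "0 < N" by (simp add: admissible_sizes_def)
        let ?Z = "partition_sum \<gamma> \<Phi> N (env N \<omega>)"
        have "exp (real N * (ln 2 + (L - e / 2))) / 2 \<le> ?Z" using elim by (auto simp: not_less)
        then have "ln (exp (real N * (ln 2 + (L - e / 2))) / 2) \<le> ln ?Z"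
          by (subst ln_le_cancel_iff) (auto intro: less_le_trans[of 0 "exp (real N * (ln 2 + (L - e / 2))) / 2"])
        then have "real N * (ln 2 + (L - e / 2)) - ln 2 \<le> ln ?Z" by (simp add: ln_div)
        moreover have "ln 2 \<le> real N * (e / 2)" using elim e by (simp add: divide_le_eq field_simps)
        ultimately have "real N * (L + ln 2 - e) \<le> ln ?Z" by (simp add: algebra_simps)
        then have "L + ln 2 - e \<le> 1 / real N * ln ?Z" using N0 by (simp add: le_divide_eq mult.commute)
        then show ?case by (simp add: L_def)
      qed
    qed
qed
qed

text \<open>Mixing multiplies all entropies by at most 1 - d, so non-strict constraints become
  strict because the rates are positive. The value, being concave along the mixture, drops by at
  most d (V - m), where m is the value at the product measure.\<close>

lemma log_partition_lower:
  assumes f: "density_flow f"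
    and \<Phi>: "\<Phi> \<in> borel_measurable M" "depends_upto n \<Phi>" "\<And>x. x \<in> space M \<Longrightarrow> \<bar>\<Phi> x\<bar> \<le> C"
    and H: "\<And>k. k \<in> {1..n} \<Longrightarrow> flow_entropy f k \<le> rate k" and e: "e > 0"
  shows "AE \<omega> in P. eventually (\<lambda>N. (\<integral>x. f n x * \<Phi> x \<partial>M) - flow_entropy f n + ln 2 - e
    \<le> 1 / real N * ln (partition_sum \<gamma> \<Phi> N (env N \<omega>))) sizes"
proof -
  define V where "V = (\<integral>x. f n x * \<Phi> x \<partial>M) - flow_entropy f n"
  define m where "m = (\<integral>x. \<Phi> x \<partial>M)"
  define t where "t = \<bar>V\<bar> + \<bar>m\<bar> + 1"
  have t: "t > 0" by (simp add: t_def add_nonneg_pos)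
  \<comment> \<open>The second bound keeps the loss below e / 2, the first keeps d below 1; the
    summand 1 in t avoids a division by zero.\<close>
  define d where "d = min (1 / 2) (e / 2 / t)"
  have d: "0 < d" "d < 1" using e t by (auto simp: d_def)
  have dV: "d * (\<bar>V\<bar> + \<bar>m\<bar>) \<le> e / 2"
  proof -
    have "d * (\<bar>V\<bar> + \<bar>m\<bar>) \<le> d * t" using d by (intro mult_left_mono) (auto simp: t_def)
    also have "\<dots> \<le> e / 2 / t * t" using t by (intro mult_right_mono) (auto simp: d_def)
    also have "\<dots> = e / 2" using t by simp
    finally show ?thesis .
  qed
  let ?g = "mix_flow d f"
  have g: "density_flow ?g" by (rule density_flow_mix[OF f d])
  have Hg: "flow_entropy ?g k < rate k" if k: "k \<in> {1..n}" for k
  proof -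
    have kn: "k \<le> n" using k by simp
    have "flow_entropy ?g k \<le> (1 - d) * flow_entropy f k" by (rule flow_entropy_mix[OF f d kn])
    also have "\<dots> \<le> (1 - d) * rate k" using H[OF k] d by (intro mult_left_mono) auto
    also have "\<dots> < rate k" using rate_pos[OF k] d by (simp add: algebra_simps)
    finally show ?thesis .
  qed
  have "V - e / 2 \<le> (\<integral>x. ?g n x * \<Phi> x \<partial>M) - flow_entropy ?g n"
  proof -
    have "(\<integral>x. ?g n x * \<Phi> x \<partial>M) = (\<integral>x. (1 - d) * (f n x * \<Phi> x) + d * \<Phi> x \<partial>M)"
      by (simp add: mix_flow_def algebra_simps)
    also have "\<dots> = (1 - d) * (\<integral>x. f n x * \<Phi> x \<partial>M) + d * m"
      unfolding m_def using integrable_flow[OF f order.refl \<Phi>(1,3)] integrable_bounded[OF \<Phi>(1,3)] by simp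
    finally have "(\<integral>x. ?g n x * \<Phi> x \<partial>M) - flow_entropy ?g n
      \<ge> (1 - d) * (\<integral>x. f n x * \<Phi> x \<partial>M) + d * m - (1 - d) * flow_entropy f n"
      using flow_entropy_mix[OF f d order.refl] by simp
    also have "(1 - d) * (\<integral>x. f n x * \<Phi> x \<partial>M) + d * m - (1 - d) * flow_entropy f n = V - d * (V - m)"
      by (simp add: V_def algebra_simps)
    finally have *: "V - d * (V - m) \<le> (\<integral>x. ?g n x * \<Phi> x \<partial>M) - flow_entropy ?g n" .
    have "d * (V - m) \<le> d * (\<bar>V\<bar> + \<bar>m\<bar>)" using d by (intro mult_left_mono) auto
    then show ?thesis using * dV by linarith
  qed
  moreover have "AE \<omega> in P. eventually (\<lambda>N. (\<integral>x. ?g n x * \<Phi> x \<partial>M) - flow_entropy ?g n + ln 2 - e / 2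
    \<le> 1 / real N * ln (partition_sum \<gamma> \<Phi> N (env N \<omega>))) sizes"
    using e by (intro log_partition_lower_strict[OF g \<Phi> Hg]) auto
  ultimately show ?thesis
    unfolding V_def[symmetric] by (auto elim!: eventually_mono)
qed

lemma log_partition_limit:
  assumes \<Phi>: "\<Phi> \<in> borel_measurable M" "depends_upto n \<Phi>" "\<And>x. x \<in> space M \<Longrightarrow> \<bar>\<Phi> x\<bar> \<le> C"
  shows "AE \<omega> in P. ((\<lambda>N. ereal (1 / real N * ln (partition_sum \<gamma> \<Phi> N (env N \<omega>))))
    \<longlongrightarrow> J_star n \<gamma> \<mu> \<Phi> + ereal (ln 2)) sizes"
proof -
  obtain c l f where f: "density_flow f" and l: "\<And>k. k \<in> {1..n} \<Longrightarrow> 0 \<le> l k"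
    and H: "\<And>k. k \<in> {1..n} \<Longrightarrow> flow_entropy f k \<le> rate k"
    and slack: "\<And>k. k \<in> {1..n} \<Longrightarrow> l k * flow_entropy f k = l k * rate k"
    and eq: "\<And>x. \<Phi> x = c + ln (f n x) + (\<Sum>k=1..n. l k * ln (f k x))"
    by (rule optimal_gibbs_flow[OF \<Phi> rate_pos]) blast+
  define V where "V = c + (\<Sum>k=1..n. l k * rate k)"
  have J: "J_star n \<gamma> \<mu> \<Phi> = ereal V" and V: "(\<integral>x. f n x * \<Phi> x \<partial>M) - flow_entropy f n = V"
    unfolding V_def using J_star_flow[OF \<Phi> f l H slack eq] by auto
  let ?a = "\<lambda>\<omega> N. 1 / real N * ln (partition_sum \<gamma> \<Phi> N (env N \<omega>))"
  \<comment> \<open>The exceptional null set depends on the error, so the errors are restricted to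
    the countable sequence 1 / (m + 1).\<close>
  have "AE \<omega> in P. \<forall>m. eventually (\<lambda>N. ?a \<omega> N \<le> V + ln 2 + inverse (real (Suc m))) sizes"
    unfolding AE_all_countable V_def
    by (intro allI log_partition_upper[OF f l eq]) auto
  moreover have "AE \<omega> in P. \<forall>m. eventually (\<lambda>N. V + ln 2 - inverse (real (Suc m)) \<le> ?a \<omega> N) sizes"
    unfolding AE_all_countable V[symmetric]
    by (intro allI log_partition_lower[OF f \<Phi> H]) auto
  ultimately show ?thesis
  proof eventually_elim
    case (elim \<omega>)
    have "(?a \<omega> \<longlongrightarrow> V + ln 2) sizes"
    proof (rule tendstoI)
      fix r :: real assume "r > 0"
      then obtain m where m: "inverse (real (Suc m)) < r" using reals_Archimedean by blast
      from elim(1)[rule_format, of m] elim(2)[rule_format, of m]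
      show "eventually (\<lambda>N. dist (?a \<omega> N) (V + ln 2) < r) sizes"
      proof eventually_elim
        case (elim N)
        then show ?case using m unfolding dist_real_def by linarith
      qed
    qed
    then show ?case by (simp add: J)
  qed
qed

end

section \<open>Transfer to the stated form\<close>

text \<open>After composition with the restriction, the function is continuous on the space of all
  sequences, whose Borel field is the product field by second countability. Embedding S^n there is
  measurable: its coordinates are projections or the constant \<open>undefined\<close>.\<close>

lemma borel_measurable_continuous_restrict:
  fixes \<phi> :: "(nat \<Rightarrow> 's::polish_space) \<Rightarrow> real"
  assumes "continuous_map (product_topology (\<lambda>_. euclidean) {1..n}) euclideanreal \<phi>"
  shows "(\<lambda>x. \<phi> (restrict x {1..n})) \<in> borel_measurable (product_borel n)"
proof -
  have "continuous_map (product_topology (\<lambda>_. euclidean) UNIV) (product_topology (\<lambda>_. euclidean) {1..n})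
      (\<lambda>x. restrict x {1..n} :: nat \<Rightarrow> 's)"
    using continuous_map_product_projection[of _ UNIV "\<lambda>_. euclidean :: 's topology"]
    by (auto simp: continuous_map_componentwise)
  from continuous_map_compose[OF this assms]
  have "continuous_on UNIV (\<lambda>x. \<phi> (restrict x {1..n}))"
    by (simp add: euclidean_product_topology comp_def)
  then have "(\<lambda>x. \<phi> (restrict x {1..n})) \<in> borel_measurable borel"
    by (rule borel_measurable_continuous_onI)
  then have "(\<lambda>x. \<phi> (restrict x {1..n})) \<in> borel_measurable (PiM UNIV (\<lambda>_. borel :: 's measure))"
    using measurable_cong_sets[OF sets_PiM_equal_borel refl] by blast
  moreover have "(\<lambda>x i. x i) \<in> product_borel n \<rightarrow>\<^sub>M PiM UNIV (\<lambda>_. borel :: 's measure)"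
  proof (rule measurable_PiM_single')
    fix i :: nat
    show "(\<lambda>x. x i) \<in> product_borel n \<rightarrow>\<^sub>M (borel :: 's measure)"
    proof (cases "i \<in> {1..n}")
      case True
      then show ?thesis unfolding product_borel_def by (rule measurable_component_singleton)
    next
      case False
      then have "x i = undefined" if "x \<in> space (product_borel n :: (nat \<Rightarrow> 's) measure)" for x
        using that by (auto simp: product_borel_def space_PiM PiE_iff extensional_def)
      then show ?thesis by (subst measurable_cong[where g="\<lambda>_. undefined"]) auto
    qed
  qed auto
  ultimately show ?thesis using measurable_compose[of "\<lambda>x. x" "product_borel n"] by simp
qed

theorem corollary2p4:
  fixes P :: "'w measure"
    and n :: nat
    and \<mu> :: "nat \<Rightarrow> 's::polish_space measure"
    and \<gamma> :: "nat \<Rightarrow> real"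
    and X :: "nat \<Rightarrow> nat \<times> (nat \<Rightarrow> nat) \<times> nat \<Rightarrow> 'w \<Rightarrow> 's"
    and \<phi> :: "(nat \<Rightarrow> 's) \<Rightarrow> real"
  assumes "\<And>j. j \<in> {1..n} \<Longrightarrow> \<mu> j \<in> space (prob_algebra borel)"
    and "\<And>k. k \<in> {1..n} \<Longrightarrow> \<gamma> k > 0"
    and "(\<Sum>k=1..n. \<gamma> k) = 1"
    and "infinite (admissible_sizes n \<gamma>)"
    and "prob_space P"
    and "\<And>N. N \<in> admissible_sizes n \<gamma> \<Longrightarrow>
           prob_space.indep_vars P (\<lambda>_. borel) (X N) (env_index n \<gamma> N)"
    and "\<And>N j \<beta> i. N \<in> admissible_sizes n \<gamma> \<Longrightarrow> (j, \<beta>, i) \<in> env_index n \<gamma> N \<Longrightarrow>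
           distr P borel (X N (j, \<beta>, i)) = \<mu> j"
    and "continuous_map (product_topology (\<lambda>_. euclidean) {1..n}) euclideanreal \<phi>"
    and "bounded (\<phi> ` PiE {1..n} (\<lambda>_. UNIV))"
  shows "AE \<omega> in P.
    ((\<lambda>N. ereal (1 / real N *
        ln (\<Sum>\<alpha>\<in>configs \<gamma> N n. exp (\<Sum>i=1..N. \<phi> (config_vec n (X N) \<alpha> i \<omega>)))))
      \<longlongrightarrow> J_star n \<gamma> \<mu> \<phi> + ereal (ln 2))
      (inf sequentially (principal (admissible_sizes n \<gamma>)))"
proof -
  interpret P: prob_space P by fact
  \<comment> \<open>The locale wants a probability measure at every index, while the hypotheses
    speak of {1..n} only; a point mass fills in elsewhere and leaves the product over {1..n}
    unchanged.\<close>
  define \<mu>' where "\<mu>' j = (if j \<in> {1..n} then \<mu> j else return borel undefined)" for j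
  have \<mu>': "prob_space (\<mu>' j)" "sets (\<mu>' j) = sets borel" for j
    using assms(1)[of j] by (auto simp: \<mu>'_def space_prob_algebra intro!: prob_space_return)
  interpret S: env_sample n \<mu>' \<gamma> P X
  proof (intro env_sample.intro tree_law.intro product_law.intro tree_law_axioms.intro env_sample_axioms.intro)
    show "prob_space (\<mu>' j)" "sets (\<mu>' j) = sets borel" for j by (rule \<mu>')+
    show "prob_space P" by fact
    show "0 < \<gamma> k" if "k \<in> {1..n}" for k by (rule assms(2)[OF that])
    show "(\<Sum>k=1..n. \<gamma> k) = 1" by fact
    show "P.indep_vars (\<lambda>_. borel) (X N) (env_index n \<gamma> N)" if "N \<in> admissible_sizes n \<gamma>" for N
      by (rule assms(6)[OF that])
    show "distr P borel (X N (j, \<beta>, i)) = \<mu>' j"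
      if "N \<in> admissible_sizes n \<gamma>" "(j, \<beta>, i) \<in> env_index n \<gamma> N" for N j \<beta> i
      using assms(7)[OF that] that(2) by (auto simp: \<mu>'_def env_index_def)
  qed
  \<comment> \<open>The given function may be arbitrary off S^n; composing with the restriction
    makes it depend on the first n coordinates everywhere and changes nothing on S^n.\<close>
  define \<Phi> where "\<Phi> x = \<phi> (restrict x {1..n})" for x
  have PiM_eq: "PiM {1..n} \<mu>' = PiM {1..n} \<mu>" by (rule PiM_cong) (auto simp: \<mu>'_def)
  have same: "\<Phi> x = \<phi> x" if "x \<in> PiE {1..n} (\<lambda>_. UNIV)" for x
    using that unfolding \<Phi>_def by (metis PiE_restrict)
  obtain C where C: "\<And>x. x \<in> PiE {1..n} (\<lambda>_. UNIV) \<Longrightarrow> \<bar>\<phi> x\<bar> \<le> C"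
    using assms(9) by (auto simp: bounded_iff)
  have \<Phi>: "\<Phi> \<in> borel_measurable (PiM {1..n} \<mu>')" "depends_upto n \<Phi>"
      "\<And>x. x \<in> space (PiM {1..n} \<mu>') \<Longrightarrow> \<bar>\<Phi> x\<bar> \<le> C"
  proof -
    show "\<Phi> \<in> borel_measurable (PiM {1..n} \<mu>')"
      unfolding \<Phi>_def[abs_def]
      using borel_measurable_continuous_restrict[OF assms(8)] measurable_cong_sets[OF S.sets_M refl] by blast
    show "depends_upto n \<Phi>"
      unfolding depends_upto_def \<Phi>_def by (auto intro!: arg_cong[where f=\<phi>] restrict_ext)
    show "\<bar>\<Phi> x\<bar> \<le> C" if "x \<in> space (PiM {1..n} \<mu>')" for x
      using C same that by (simp add: S.space_M)
  qed
  have J: "J_star n \<gamma> \<mu>' \<Phi> = J_star n \<gamma> \<mu> \<phi>"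
  proof -
    have balls: "entropy_ball n \<gamma> \<mu>' j = entropy_ball n \<gamma> \<mu> j" for j
      by (simp add: entropy_ball_def PiM_eq)
    have "(\<integral>x. \<Phi> x \<partial>\<nu>) = (\<integral>x. \<phi> x \<partial>\<nu>)" if "\<nu> \<in> (\<Inter>j\<in>{1..n}. entropy_ball n \<gamma> \<mu> j)" for \<nu>
    proof (rule Bochner_Integration.integral_cong)
      fix x assume "x \<in> space \<nu>"
      moreover have "sets \<nu> = sets (product_borel n)"
        using that S.n_pos by (auto simp: entropy_ball_def space_prob_algebra)
      ultimately show "\<Phi> x = \<phi> x"
        using sets_eq_imp_space_eq[of \<nu> "product_borel n"]
        by (intro same) (simp add: product_borel_def space_PiM)
    qed simp
    then show ?thesis
      unfolding J_star_def balls PiM_eq by (intro SUP_cong) auto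
  qed
  have Z: "(\<Sum>\<alpha>\<in>configs \<gamma> N n. exp (\<Sum>i=1..N. \<phi> (config_vec n (X N) \<alpha> i \<omega>)))
    = S.partition_sum \<gamma> \<Phi> N (S.env N \<omega>)" for N \<omega>
    unfolding S.partition_sum_def
  proof (intro sum.cong refl arg_cong[where f=exp])
    fix \<alpha> i assume "\<alpha> \<in> configs \<gamma> N n" "i \<in> {1..N}"
    then show "\<phi> (config_vec n (X N) \<alpha> i \<omega>) = \<Phi> (S.env_vec \<alpha> i (S.env N \<omega>))"
      using same S.env_vec_space[of \<alpha> i "S.env N \<omega>"] by (simp add: S.config_vec_env S.space_M)
  qed
  show ?thesis
    unfolding Z J[symmetric] by (rule S.log_partition_limit[OF \<Phi>])
qed

end
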